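(* Let $k$ be an algebraically closed field of characteristic $0$, let $R=k\langle x,y\rangle/(xy-yx-y^2)$, and let $n\geq 1$. Then: (1) Every irreducible component of the variety $\mathrm{mod}(R,n)$ contains only one stratum $\mathcal{U}_{\mathcal{P}}$, where $\mathcal{P}$ runs over the partitions of $n$, and is the closure of this stratum. (2) The number of irreducible components of $\mathrm{mod}(R,n)$ is equal to the number of partitions of $n$. (3) The variety $\mathrm{mod}(R,n)$ is equidimensional, and the dimension of its irreducible components is $n^2$.
   Context: $\mathrm{mod}(R,n)$ denotes the variety of $n$-dimensional representations of $R$, i.e. the Zariski closed subset of $M_n(k)\times M_n(k)$ consisting of pairs $(X,Y)$ of $n\times n$ matrices with $XY-YX=Y^2$ (here $X$, $Y$ are the images of $x$, $y$). For every such pair the matrix $Y$ is nilpotent. For a partition $\mathcal{P}=(n_1,\dots,n_m)$ of $n$, with $n=n_1+\dots+n_m$ and $n_1\geq\dots\geq n_m\geq 1$, the stratum $\mathcal{U}_{\mathcal{P}}\subseteq \mathrm{mod}(R,n)$ is the set of all pairs $(X,Y)\in\mathrm{mod}(R,n)$ such that the Jordan normal form of $Y$ consists of (nilpotent) Jordan blocks of sizes $n_1,\dots,n_m$. Closures and irreducible components are taken in the Zariski topology. *)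

theory Defs
  imports
    "HOL-Analysis.Abstract_Topology"
    "HOL-Library.Extended_Nat"
    "Jordan_Normal_Form.Jordan_Normal_Form"
begin

section \<open>Irreducible spaces, irreducible components, and Krull dimension\<close>

definition irreducible_space :: "'a topology \<Rightarrow> bool" where
  "irreducible_space X \<longleftrightarrow> topspace X \<noteq> {} \<and>
     (\<forall>A B. closedin X A \<and> closedin X B \<and> A \<union> B = topspace X
        \<longrightarrow> A = topspace X \<or> B = topspace X)"

definition irreducible_subset :: "'a topology \<Rightarrow> 'a set \<Rightarrow> bool" where
  "irreducible_subset X S \<longleftrightarrow> S \<subseteq> topspace X \<and> irreducible_space (subtopology X S)"

definition irreducible_components :: "'a topology \<Rightarrow> 'a set set" where
  "irreducible_components X =
     {Z. irreducible_subset X Z \<and> (\<forall>W. irreducible_subset X W \<and> Z \<subseteq> W \<longrightarrow> W = Z)}"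

text \<open>
  The supremum of the lengths \<open>l\<close> of chains \<open>Z 0 \<subset> Z 1 \<subset> \<dots> \<subset> Z l\<close> of irreducible closed
  subsets. Only used for nonempty spaces; the empty space gets the value \<open>Sup {} = 0\<close>.
\<close>

definition krull_dim :: "'a topology \<Rightarrow> enat" where
  "krull_dim X = Sup {enat l | l. \<exists>Z :: nat \<Rightarrow> 'a set.
     (\<forall>i\<le>l. closedin X (Z i) \<and> irreducible_subset X (Z i)) \<and> (\<forall>i<l. Z i \<subset> Z (Suc i))}"

definition equidimensional :: "'a topology \<Rightarrow> bool" where
  "equidimensional X \<longleftrightarrow>
     (\<forall>Z \<in> irreducible_components X. \<forall>W \<in> irreducible_components X.
        krull_dim (subtopology X Z) = krull_dim (subtopology X W))"

section \<open>The Zariski topology on pairs of matrices\<close>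

definition mat_pairs :: "nat \<Rightarrow> ('a mat \<times> 'a mat) set" where
  "mat_pairs n = carrier_mat n n \<times> carrier_mat n n"

text \<open>Polynomial functions in the \<open>2 * n\<^sup>2\<close> matrix entries.\<close>

inductive_set poly_funs :: "nat \<Rightarrow> ('a :: comm_ring_1 mat \<times> 'a mat \<Rightarrow> 'a) set" for n where
  const: "(\<lambda>_. c) \<in> poly_funs n"
| entry_fst: "i < n \<Longrightarrow> j < n \<Longrightarrow> (\<lambda>p. fst p $$ (i, j)) \<in> poly_funs n"
| entry_snd: "i < n \<Longrightarrow> j < n \<Longrightarrow> (\<lambda>p. snd p $$ (i, j)) \<in> poly_funs n"
| add: "f \<in> poly_funs n \<Longrightarrow> g \<in> poly_funs n \<Longrightarrow> (\<lambda>p. f p + g p) \<in> poly_funs n"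
| mult: "f \<in> poly_funs n \<Longrightarrow> g \<in> poly_funs n \<Longrightarrow> (\<lambda>p. f p * g p) \<in> poly_funs n"

definition zero_locus ::
    "nat \<Rightarrow> ('a :: comm_ring_1 mat \<times> 'a mat \<Rightarrow> 'a) set \<Rightarrow> ('a mat \<times> 'a mat) set" where
  "zero_locus n F = {p \<in> mat_pairs n. \<forall>f\<in>F. f p = 0}"

definition zariski_closed :: "nat \<Rightarrow> ('a :: comm_ring_1 mat \<times> 'a mat) set \<Rightarrow> bool" where
  "zariski_closed n C \<longleftrightarrow> (\<exists>F \<subseteq> poly_funs n. C = zero_locus n F)"

definition zariski :: "nat \<Rightarrow> ('a :: field mat \<times> 'a mat) topology" where
  "zariski n = topology (\<lambda>U. U \<subseteq> mat_pairs n \<and> zariski_closed n (mat_pairs n - U))"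

lemma zariski_closed_subset: "zariski_closed n C \<Longrightarrow> C \<subseteq> mat_pairs n"
  by (auto simp: zariski_closed_def zero_locus_def)

lemma zariski_closed_empty: "zariski_closed n {}"
proof -
  have "{} = zero_locus n {\<lambda>_ :: 'a mat \<times> 'a mat. 1 :: 'a}"
    by (simp add: zero_locus_def)
  moreover have "{\<lambda>_ :: 'a mat \<times> 'a mat. 1 :: 'a} \<subseteq> poly_funs n"
    by (simp add: poly_funs.const)
  ultimately show ?thesis
    unfolding zariski_closed_def by blast
qed

lemma zariski_closed_Un:
  fixes C D :: "('a :: field mat \<times> 'a mat) set"
  assumes "zariski_closed n C" "zariski_closed n D"
  shows "zariski_closed n (C \<union> D)"
proof -
  obtain F G where F: "F \<subseteq> poly_funs n" "C = zero_locus n F"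
    and G: "G \<subseteq> poly_funs n" "D = zero_locus n G"
    using assms unfolding zariski_closed_def by blast
  let ?H = "{\<lambda>p. f p * g p | f g. f \<in> F \<and> g \<in> G}"
  have "?H \<subseteq> poly_funs n"
    using F(1) G(1) by (auto intro: poly_funs.mult)
  moreover have "C \<union> D = zero_locus n ?H"
  proof
    show "C \<union> D \<subseteq> zero_locus n ?H"
      using F(2) G(2) by (auto simp: zero_locus_def)
    show "zero_locus n ?H \<subseteq> C \<union> D"
    proof
      fix p assume p: "p \<in> zero_locus n ?H"
      have prod: "f p * g p = 0" if "f \<in> F" "g \<in> G" for f g
      proof -
        have "(\<lambda>p. f p * g p) \<in> ?H" using that by blast
        then show ?thesis using p unfolding zero_locus_def by fastforce
      qed
      have "p \<in> mat_pairs n" using p by (simp add: zero_locus_def)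
      then show "p \<in> C \<union> D"
        using prod F(2) G(2) unfolding zero_locus_def by fastforce
    qed
  qed
  ultimately show ?thesis
    unfolding zariski_closed_def by blast
qed

lemma zariski_closed_Inter:
  fixes K :: "('a :: field mat \<times> 'a mat) set set"
  assumes "\<And>C. C \<in> K \<Longrightarrow> zariski_closed n C"
  shows "zariski_closed n (mat_pairs n \<inter> \<Inter>K)"
proof -
  obtain F where F: "\<And>C. C \<in> K \<Longrightarrow> F C \<subseteq> poly_funs n \<and> C = zero_locus n (F C)"
    using assms unfolding zariski_closed_def by metis
  have "mat_pairs n \<inter> \<Inter>K = zero_locus n (\<Union>C\<in>K. F C)"
  proof (intro equalityI subsetI)
    fix p assume p: "p \<in> mat_pairs n \<inter> \<Inter>K"
    have "f p = 0" if "C \<in> K" "f \<in> F C" for C f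
    proof -
      have "p \<in> zero_locus n (F C)" using p F[OF that(1)] that(1) by blast
      then show ?thesis using that(2) by (simp add: zero_locus_def)
    qed
    then show "p \<in> zero_locus n (\<Union>C\<in>K. F C)"
      using p by (auto simp: zero_locus_def)
  next
    fix p assume p: "p \<in> zero_locus n (\<Union>C\<in>K. F C)"
    have "p \<in> C" if "C \<in> K" for C
    proof -
      have "p \<in> zero_locus n (F C)" using p that by (auto simp: zero_locus_def)
      then show ?thesis using F[OF that] by blast
    qed
    then show "p \<in> mat_pairs n \<inter> \<Inter>K"
      using p by (auto simp: zero_locus_def)
  qed
  moreover have "(\<Union>C\<in>K. F C) \<subseteq> poly_funs n" using F by blast
  ultimately show ?thesis
    unfolding zariski_closed_def by blast
qed

lemma istopology_zariski:
  "istopology (\<lambda>U :: ('a :: field mat \<times> 'a mat) set.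
     U \<subseteq> mat_pairs n \<and> zariski_closed n (mat_pairs n - U))"
  unfolding istopology_def
proof (intro conjI allI impI, goal_cases)
  case (1 S T)
  then show ?case by blast
next
  case (2 S T)
  then show ?case by (simp add: Diff_Int zariski_closed_Un)
next
  case (3 \<U>)
  then show ?case by blast
next
  case (4 \<U>)
  have "zariski_closed n (mat_pairs n \<inter> \<Inter>((\<lambda>U. mat_pairs n - U) ` \<U>))"
    using 4 by (intro zariski_closed_Inter) auto
  moreover have "mat_pairs n \<inter> \<Inter>((\<lambda>U. mat_pairs n - U) ` \<U>) = mat_pairs n - \<Union>\<U>"
    by blast
  ultimately show ?case by simp
qed

lemma openin_zariski:
  "openin (zariski n) U \<longleftrightarrow> U \<subseteq> mat_pairs n \<and> zariski_closed n (mat_pairs n - U)"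
  by (simp add: zariski_def istopology_zariski topology_inverse')

lemma topspace_zariski [simp]: "topspace (zariski n) = mat_pairs n"
proof
  show "topspace (zariski n) \<subseteq> mat_pairs n"
    using openin_topspace[of "zariski n"] unfolding openin_zariski by blast
  show "mat_pairs n \<subseteq> topspace (zariski n)"
    by (rule openin_subset) (simp add: openin_zariski zariski_closed_empty)
qed

lemma closedin_zariski: "closedin (zariski n) C \<longleftrightarrow> zariski_closed n C"
proof -
  have "mat_pairs n - (mat_pairs n - C) = C" if "C \<subseteq> mat_pairs n"
    using that by blast
  then show ?thesis
    using zariski_closed_subset[of n C] by (auto simp: closedin_def openin_zariski)
qed

section \<open>The variety of representations and its strata\<close>

text \<open>
  A representation of \<open>R = k\<langle>x, y\<rangle> / (xy - yx - y\<^sup>2)\<close> on \<open>k\<^sup>n\<close> is given by the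
  images \<open>X\<close>, \<open>Y\<close> of the two generators.
\<close>

definition rep_variety :: "nat \<Rightarrow> ('a :: field mat \<times> 'a mat) set" where
  "rep_variety n =
     {(X, Y). X \<in> carrier_mat n n \<and> Y \<in> carrier_mat n n \<and> X * Y - Y * X = Y * Y}"

definition rep_space :: "nat \<Rightarrow> ('a :: field mat \<times> 'a mat) topology" where
  "rep_space n = subtopology (zariski n) (rep_variety n)"

definition partitions :: "nat \<Rightarrow> nat list set" where
  "partitions n = {P. sum_list P = n \<and> sorted_wrt (\<ge>) P \<and> (\<forall>p \<in> set P. p \<ge> 1)}"

definition stratum :: "nat \<Rightarrow> nat list \<Rightarrow> ('a :: field mat \<times> 'a mat) set" where
  "stratum n P = {(X, Y) \<in> rep_variety n. jordan_nf Y (map (\<lambda>p. (p, 0)) P)}"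

end

theory Submission
  imports Defs "Jordan_Normal_Form.Jordan_Normal_Form_Existence" "Jordan_Normal_Form.Jordan_Normal_Form_Uniqueness" "HOL-Library.Function_Algebras"
begin


text \<open>
  Write \<open>N\<close> for the nilpotent Jordan matrix of a partition and \<open>X0 = H N\<close> with \<open>H\<close> the diagonal
  matrix with entries \<open>0, -1, -2, \<dots>\<close>.  Then \<open>[H, N] = N\<close>, so \<open>[X0, N] = N\<^sup>2\<close>, and all solutions
  of \<open>[X, N] = N\<^sup>2\<close> are \<open>X0 + c\<close> with \<open>c\<close> in the centraliser of \<open>N\<close>.  The stratum is therefore the
  image of \<open>(g, c) \<mapsto> (g (X0 + c) g\<^sup>-\<^sup>1, g N g\<^sup>-\<^sup>1)\<close>.  It is irreducible, because the line through two
  parameters is mapped to a rational curve (\<open>poly_domain_orbit\<close>).  Its dimension is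
  \<open>n\<^sup>2 - dim C + dim C = n\<^sup>2\<close>, where \<open>C\<close> is the centraliser: what conjugation loses, the choice
  of \<open>c\<close> restores.

  To turn this count into Krull dimension, a rational slice removes the redundancy of \<open>g\<close>.  With a
  generalised inverse \<open>Q\<close> of \<open>ad N\<close> the map \<open>proj = 1 - Q \<circ> ad N\<close> is a projection onto \<open>C\<close>, and
  a generic \<open>g\<close> can be normalised, by right multiplication with elements of \<open>C\<close>, to \<open>proj g = 1\<close>.
  The normalised \<open>g\<close> solves a linear system whose coefficients are polynomial in \<open>Y\<close>, so Cramer's
  rule recovers \<open>g\<close>, and then \<open>c\<close>, rationally from \<open>(X, Y)\<close>.  The common denominator is \<open>good\<close>.
  Three facts follow.

  Upper bound: an open dense part of the stratum is parametrised by the \<open>n\<^sup>2\<close> entries of one matrix.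
  Comparing numbers of monomials shows that more than \<open>n\<^sup>2\<close> polynomial functions are algebraically
  dependent on it (\<open>poly_funs_dependent_on_orbit\<close>), whereas a chain of irreducible closed sets of
  length \<open>m\<close> produces \<open>m\<close> independent ones (\<open>chain_imp_independent\<close>).

  Lower bound: the images of a complete flag of coordinate subspaces have strictly increasing
  closures, since the coordinates are rational functions on the stratum (\<open>flag_image_strict\<close>).

  Openness: where \<open>good \<noteq> 0\<close>, a point of the closure of the stratum lies in the stratum
  (\<open>zclosure_orbit_good\<close>).

  Distinct strata are disjoint, by uniqueness of Jordan normal forms.  If the closure of one stratum
  were contained in that of another, the two closures would coincide, as both have dimension \<open>n\<^sup>2\<close>;
  then both strata would contain nonempty open subsets of one irreducible set and would meet
  (\<open>zclosure_stratum_incomparable\<close>).  The strata cover the variety: \<open>[X, Y\<^sup>k] = k Y\<^sup>k\<^sup>+\<^sup>1\<close> has trace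
  \<open>0\<close>, so in characteristic \<open>0\<close> all eigenvalues of \<open>Y\<close> vanish (\<open>rep_variety_covered\<close>).  Hence the
  irreducible components are exactly the closures of the finitely many strata.
\<close>

section \<open>Algebras of functions and matrices over them\<close>

definition fun_algebra :: "('w \<Rightarrow> 'k :: comm_ring_1) set \<Rightarrow> bool" where
  "fun_algebra R \<longleftrightarrow> (\<forall>c. (\<lambda>_. c) \<in> R) \<and>
     (\<forall>f\<in>R. \<forall>g\<in>R. (\<lambda>w. f w + g w) \<in> R \<and> (\<lambda>w. f w * g w) \<in> R)"

lemma fun_algebraD:
  assumes "fun_algebra R"
  shows "(\<lambda>_. c) \<in> R"
    and "f \<in> R \<Longrightarrow> g \<in> R \<Longrightarrow> (\<lambda>w. f w + g w) \<in> R"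
    and "f \<in> R \<Longrightarrow> g \<in> R \<Longrightarrow> (\<lambda>w. f w * g w) \<in> R"
  using assms unfolding fun_algebra_def by auto

lemma fun_algebra_uminus:
  assumes "fun_algebra R" "f \<in> R"
  shows "(\<lambda>w. - f w) \<in> R"
  using fun_algebraD(3)[OF assms(1) fun_algebraD(1)[OF assms(1), of "- 1"] assms(2)] by simp

lemma fun_algebra_diff:
  assumes "fun_algebra R" "f \<in> R" "g \<in> R"
  shows "(\<lambda>w. f w - g w) \<in> R"
  using fun_algebraD(2)[OF assms(1,2) fun_algebra_uminus[OF assms(1,3)]] by simp

lemma fun_algebra_sum:
  assumes R: "fun_algebra R" and "\<And>i. i \<in> I \<Longrightarrow> f i \<in> R"
  shows "(\<lambda>w. \<Sum>i\<in>I. f i w) \<in> R"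
proof (cases "finite I")
  case True
  then show ?thesis using assms(2)
    by (induction I) (simp_all add: fun_algebraD[OF R])
qed (simp add: fun_algebraD[OF R])

lemma fun_algebra_prod:
  assumes R: "fun_algebra R" and "\<And>i. i \<in> I \<Longrightarrow> f i \<in> R"
  shows "(\<lambda>w. \<Prod>i\<in>I. f i w) \<in> R"
proof (cases "finite I")
  case True
  then show ?thesis using assms(2)
    by (induction I) (simp_all add: fun_algebraD[OF R])
qed (simp add: fun_algebraD[OF R])

lemma fun_algebra_power:
  assumes R: "fun_algebra R" and "f \<in> R"
  shows "(\<lambda>w. f w ^ e) \<in> R"
  by (induction e) (simp_all add: fun_algebraD[OF R] assms(2))

lemma fun_algebra_poly_funs: "fun_algebra (poly_funs n)"
  unfolding fun_algebra_def by (auto intro: poly_funs.intros)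

text \<open>Matrices whose entries depend on a parameter \<open>w\<close> through functions in \<open>R\<close>.  Closure of these
  families under products, determinants and adjugates is what makes all later constructions
  polynomial in their parameters.\<close>

definition mat_over :: "('w \<Rightarrow> 'k) set \<Rightarrow> nat \<Rightarrow> nat \<Rightarrow> ('w \<Rightarrow> 'k :: comm_ring_1 mat) set" where
  "mat_over R m n =
     {M. (\<forall>w. M w \<in> carrier_mat m n) \<and> (\<forall>i<m. \<forall>j<n. (\<lambda>w. M w $$ (i, j)) \<in> R)}"

lemma mat_overI:
  assumes "\<And>w. M w \<in> carrier_mat m n" "\<And>i j. i < m \<Longrightarrow> j < n \<Longrightarrow> (\<lambda>w. M w $$ (i, j)) \<in> R"
  shows "M \<in> mat_over R m n"
  using assms by (auto simp: mat_over_def)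

lemma mat_overD:
  assumes "M \<in> mat_over R m n"
  shows "M w \<in> carrier_mat m n" "i < m \<Longrightarrow> j < n \<Longrightarrow> (\<lambda>w. M w $$ (i, j)) \<in> R"
  using assms by (auto simp: mat_over_def)

lemma mat_over_dim:
  assumes "M \<in> mat_over R m n"
  shows "dim_row (M w) = m" "dim_col (M w) = n"
  using mat_overD(1)[OF assms, of w] by auto

lemma mat_over_mat:
  assumes "\<And>i j. i < m \<Longrightarrow> j < n \<Longrightarrow> (\<lambda>w. a w (i, j)) \<in> R"
  shows "(\<lambda>w. mat m n (a w)) \<in> mat_over R m n"
  using assms by (intro mat_overI) auto

lemma mat_over_const:
  assumes "fun_algebra R" "A \<in> carrier_mat m n"
  shows "(\<lambda>_. A) \<in> mat_over R m n"
  using assms by (intro mat_overI) (auto intro: fun_algebraD)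

lemma mat_over_add:
  assumes R: "fun_algebra R" and "A \<in> mat_over R m n" "B \<in> mat_over R m n"
  shows "(\<lambda>w. A w + B w) \<in> mat_over R m n"
proof (rule mat_overI)
  fix i j assume ij: "i < m" "j < n"
  then have "(\<lambda>w. (A w + B w) $$ (i, j)) = (\<lambda>w. A w $$ (i, j) + B w $$ (i, j))"
    by (simp add: mat_over_dim[OF assms(3)])
  then show "(\<lambda>w. (A w + B w) $$ (i, j)) \<in> R"
    using fun_algebraD(2)[OF R mat_overD(2)[OF assms(2) ij] mat_overD(2)[OF assms(3) ij]] by (simp only:)
qed (intro add_carrier_mat mat_overD(1)[OF assms(3)])

lemma mat_over_minus:
  assumes R: "fun_algebra R" and "A \<in> mat_over R m n" "B \<in> mat_over R m n"
  shows "(\<lambda>w. A w - B w) \<in> mat_over R m n"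
proof (rule mat_overI)
  fix i j assume ij: "i < m" "j < n"
  then have "(\<lambda>w. (A w - B w) $$ (i, j)) = (\<lambda>w. A w $$ (i, j) - B w $$ (i, j))"
    by (simp add: mat_over_dim[OF assms(3)])
  then show "(\<lambda>w. (A w - B w) $$ (i, j)) \<in> R"
    using fun_algebra_diff[OF R mat_overD(2)[OF assms(2) ij] mat_overD(2)[OF assms(3) ij]] by (simp only:)
qed (intro minus_carrier_mat mat_overD(1)[OF assms(3)])

lemma mat_over_smult:
  assumes R: "fun_algebra R" and "h \<in> R" "A \<in> mat_over R m n"
  shows "(\<lambda>w. h w \<cdot>\<^sub>m A w) \<in> mat_over R m n"
proof (rule mat_overI)
  fix i j assume ij: "i < m" "j < n"
  then have "(\<lambda>w. (h w \<cdot>\<^sub>m A w) $$ (i, j)) = (\<lambda>w. h w * A w $$ (i, j))"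
    by (simp add: mat_over_dim[OF assms(3)])
  then show "(\<lambda>w. (h w \<cdot>\<^sub>m A w) $$ (i, j)) \<in> R"
    using fun_algebraD(3)[OF R assms(2) mat_overD(2)[OF assms(3) ij]] by (simp only:)
qed (intro smult_carrier_mat mat_overD(1)[OF assms(3)])

lemma mat_over_mult:
  assumes R: "fun_algebra R" and A: "A \<in> mat_over R m k" and B: "B \<in> mat_over R k n"
  shows "(\<lambda>w. A w * B w) \<in> mat_over R m n"
proof (rule mat_overI)
  fix i j assume ij: "i < m" "j < n"
  have eq: "(A w * B w) $$ (i, j) = (\<Sum>l<k. A w $$ (i, l) * B w $$ (l, j))" for w
    using ij by (simp add: scalar_prod_def mat_over_dim[OF A] mat_over_dim[OF B] lessThan_atLeast0)
  have "(\<lambda>w. \<Sum>l<k. A w $$ (i, l) * B w $$ (l, j)) \<in> R"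
    using ij by (intro fun_algebra_sum[OF R] fun_algebraD(3)[OF R]) 
      (auto intro: mat_overD[OF A] mat_overD[OF B])
  then show "(\<lambda>w. (A w * B w) $$ (i, j)) \<in> R" unfolding eq .
qed (rule mult_carrier_mat[OF mat_overD(1)[OF A] mat_overD(1)[OF B]])

lemma mat_over_det:
  assumes R: "fun_algebra R" and A: "A \<in> mat_over R n n"
  shows "(\<lambda>w. det (A w)) \<in> R"
proof -
  have "(\<lambda>w. \<Sum>p \<in> {p. p permutes {0 ..< n}}. signof p * (\<Prod>i = 0 ..< n. A w $$ (i, p i))) \<in> R"
  proof (intro fun_algebra_sum[OF R] fun_algebraD(3)[OF R] fun_algebra_prod[OF R] fun_algebraD(1)[OF R])
    fix p i assume "p \<in> {p. p permutes {0 ..< n}}" "i \<in> {0 ..< n}"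
    then have "i < n" "p i < n" using permutes_in_image[of p "{0..<n}" i] by auto
    then show "(\<lambda>w. A w $$ (i, p i)) \<in> R" by (rule mat_overD(2)[OF A])
  qed
  then show ?thesis by (simp only: det_def'[OF mat_overD(1)[OF A]])
qed

lemma mat_over_adj:
  assumes R: "fun_algebra R" and A: "A \<in> mat_over R n n"
  shows "(\<lambda>w. adj_mat (A w)) \<in> mat_over R n n"
proof (rule mat_overI)
  fix i j assume ij: "i < n" "j < n"
  have "(\<lambda>w. mat_delete (A w) j i) \<in> mat_over R (n - 1) (n - 1)"
    unfolding mat_delete_def mat_over_dim[OF A]
    by (rule mat_over_mat) (use ij in \<open>auto intro: mat_overD[OF A]\<close>)
  then have "(\<lambda>w. cofactor (A w) j i) \<in> R"
    unfolding cofactor_def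
    by (intro fun_algebraD(3)[OF R] fun_algebraD(1)[OF R] mat_over_det[OF R])
  then show "(\<lambda>w. adj_mat (A w) $$ (i, j)) \<in> R"
    using ij by (simp add: adj_mat_def mat_over_dim[OF A])
qed (intro adj_mat(1) mat_overD(1)[OF A])

text \<open>Sums and products of fractions with denominators \<open>h ^ d\<close> and \<open>h ^ e\<close> have the common
  denominator \<open>h ^ (d + e)\<close>.  With one-variable polynomials for \<open>R\<close> this serves the curves in
  irreducibility proofs, with polynomials in matrix entries the dimension count.\<close>

lemma poly_funs_pullback:
  fixes \<gamma> :: "'w \<Rightarrow> 'k :: field mat \<times> 'k mat"
  assumes R: "fun_algebra R" and h: "h \<in> R"
    and X: "\<And>i j. i < n \<Longrightarrow> j < n \<Longrightarrow> \<exists>u\<in>R. \<forall>w. h w \<noteq> 0 \<longrightarrow> fst (\<gamma> w) $$ (i, j) * h w = u w"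
    and Y: "\<And>i j. i < n \<Longrightarrow> j < n \<Longrightarrow> \<exists>u\<in>R. \<forall>w. h w \<noteq> 0 \<longrightarrow> snd (\<gamma> w) $$ (i, j) * h w = u w"
    and f: "f \<in> poly_funs n"
  shows "\<exists>e. \<exists>u\<in>R. \<forall>w. h w \<noteq> 0 \<longrightarrow> f (\<gamma> w) * h w ^ e = u w"
  using f
proof induction
  case (const c)
  show ?case by (rule exI[of _ 0], rule bexI[of _ "\<lambda>_. c"]) (auto intro: fun_algebraD[OF R])
next
  case (entry_fst i j)
  then show ?case using X[of i j] by (intro exI[of _ 1]) auto
next
  case (entry_snd i j)
  then show ?case using Y[of i j] by (intro exI[of _ 1]) auto
next
  case (add f g)
  then obtain d e u v where u: "u \<in> R" "\<And>w. h w \<noteq> 0 \<Longrightarrow> f (\<gamma> w) * h w ^ d = u w"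
    and v: "v \<in> R" "\<And>w. h w \<noteq> 0 \<Longrightarrow> g (\<gamma> w) * h w ^ e = v w" by blast
  show ?case
  proof (rule exI[of _ "d + e"], rule bexI)
    show "(\<lambda>w. u w * h w ^ e + v w * h w ^ d) \<in> R"
      by (intro fun_algebraD[OF R] fun_algebra_power[OF R] u v h)
  qed (auto simp: u(2)[symmetric] v(2)[symmetric] algebra_simps power_add)
next
  case (mult f g)
  then obtain d e u v where u: "u \<in> R" "\<And>w. h w \<noteq> 0 \<Longrightarrow> f (\<gamma> w) * h w ^ d = u w"
    and v: "v \<in> R" "\<And>w. h w \<noteq> 0 \<Longrightarrow> g (\<gamma> w) * h w ^ e = v w" by blast
  show ?case
  proof (rule exI[of _ "d + e"], rule bexI)
    show "(\<lambda>w. u w * v w) \<in> R"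
      by (intro fun_algebraD[OF R] u v)
  qed (auto simp: u(2)[symmetric] v(2)[symmetric] algebra_simps power_add)
qed

section \<open>Zariski closures and irreducibility in terms of polynomial functions\<close>

definition zclosure :: "nat \<Rightarrow> ('k :: field mat \<times> 'k mat) set \<Rightarrow> ('k mat \<times> 'k mat) set" where
  "zclosure n S = {p \<in> mat_pairs n. \<forall>f\<in>poly_funs n. (\<forall>q\<in>S. f q = 0) \<longrightarrow> f p = 0}"

lemma zclosureD: "p \<in> zclosure n S \<Longrightarrow> f \<in> poly_funs n \<Longrightarrow> (\<And>q. q \<in> S \<Longrightarrow> f q = 0) \<Longrightarrow> f p = 0"
  by (auto simp: zclosure_def)

lemma zclosure_superset: "S \<subseteq> mat_pairs n \<Longrightarrow> S \<subseteq> zclosure n S"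
  by (auto simp: zclosure_def)

lemma zclosure_subset_mat_pairs: "zclosure n S \<subseteq> mat_pairs n"
  by (auto simp: zclosure_def)

lemma zclosure_mono: "S \<subseteq> T \<Longrightarrow> zclosure n S \<subseteq> zclosure n T"
  by (auto simp: zclosure_def)

lemma zariski_closed_zclosure: "zariski_closed n (zclosure n S)"
  unfolding zariski_closed_def
  by (rule exI[of _ "{f \<in> poly_funs n. \<forall>q\<in>S. f q = 0}"]) (auto simp: zclosure_def zero_locus_def)

lemma zclosure_minimal:
  assumes "zariski_closed n C" "S \<subseteq> C"
  shows "zclosure n S \<subseteq> C"
proof -
  obtain F where "F \<subseteq> poly_funs n" "C = zero_locus n F"
    using assms(1) by (auto simp: zariski_closed_def)
  then show ?thesis using assms(2) unfolding zclosure_def zero_locus_def by blast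
qed

lemma closure_of_zariski:
  assumes "S \<subseteq> mat_pairs n"
  shows "zariski n closure_of S = zclosure n S"
proof (rule antisym)
  show "zariski n closure_of S \<subseteq> zclosure n S"
    by (rule closure_of_minimal[OF zclosure_superset[OF assms]])
       (simp only: closedin_zariski zariski_closed_zclosure)
  show "zclosure n S \<subseteq> zariski n closure_of S"
  proof (rule zclosure_minimal)
    show "zariski_closed n (zariski n closure_of S)"
      using closedin_closure_of[of "zariski n" S] by (simp only: closedin_zariski)
    show "S \<subseteq> zariski n closure_of S"
      using assms by (intro closure_of_subset) simp
  qed
qed

lemma zariski_closed_obtain_poly:
  assumes "zariski_closed n C" "p \<in> mat_pairs n" "p \<notin> C"
  obtains f where "f \<in> poly_funs n" "f p \<noteq> 0" "\<And>q. q \<in> C \<Longrightarrow> f q = 0"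
  using assms unfolding zariski_closed_def zero_locus_def by blast

text \<open>Irreducibility in algebraic form: the polynomial functions restricted to \<open>S\<close> form an
  integral domain.\<close>

definition poly_domain :: "nat \<Rightarrow> ('k :: field mat \<times> 'k mat) set \<Rightarrow> bool" where
  "poly_domain n S \<longleftrightarrow> S \<noteq> {} \<and> S \<subseteq> mat_pairs n \<and>
     (\<forall>f\<in>poly_funs n. \<forall>g\<in>poly_funs n. (\<forall>p\<in>S. f p * g p = 0) \<longrightarrow>
        (\<forall>p\<in>S. f p = 0) \<or> (\<forall>p\<in>S. g p = 0))"

lemma poly_domainD:
  assumes "poly_domain n S" "f \<in> poly_funs n" "g \<in> poly_funs n" "\<And>p. p \<in> S \<Longrightarrow> f p * g p = 0"
  shows "(\<forall>p\<in>S. f p = 0) \<or> (\<forall>p\<in>S. g p = 0)"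
  using assms unfolding poly_domain_def by blast

lemma irreducible_space_zariski_iff:
  assumes S: "S \<subseteq> mat_pairs n"
  shows "irreducible_space (subtopology (zariski n) S) \<longleftrightarrow> poly_domain n S"
proof
  assume irr: "irreducible_space (subtopology (zariski n) S)"
  have top: "topspace (subtopology (zariski n) S) = S" using S by auto
  show "poly_domain n S"
    unfolding poly_domain_def
  proof (intro conjI ballI impI S)
    show "S \<noteq> {}" using irr[unfolded irreducible_space_def top] by (rule conjunct1)
    fix f g assume fg: "f \<in> poly_funs n" "g \<in> poly_funs n" and zero: "\<forall>p\<in>S. f p * g p = 0"
    have cl: "closedin (subtopology (zariski n) S) (S \<inter> zero_locus n {f})" if "f \<in> poly_funs n" for f
    proof -
      have "closedin (zariski n) (zero_locus n {f})"
        unfolding closedin_zariski zariski_closed_def using that by (intro exI[of _ "{f}"]) simp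
      then show ?thesis by (rule closedin_subtopology_Int_closed)
    qed
    have "S \<inter> zero_locus n {f} \<union> S \<inter> zero_locus n {g} = S"
      using zero S by (auto simp: zero_locus_def)
    with irr cl fg have "S \<inter> zero_locus n {f} = S \<or> S \<inter> zero_locus n {g} = S"
      unfolding irreducible_space_def top by blast
    then show "(\<forall>p\<in>S. f p = 0) \<or> (\<forall>p\<in>S. g p = 0)"
      by (auto simp: zero_locus_def)
  qed
next
  assume dom: "poly_domain n S"
  have top: "topspace (subtopology (zariski n) S) = S" using S by auto
  show "irreducible_space (subtopology (zariski n) S)"
    unfolding irreducible_space_def top
  proof (intro conjI allI impI)
    show "S \<noteq> {}" using dom by (simp add: poly_domain_def)
    fix A B
    assume *: "closedin (subtopology (zariski n) S) A \<and> closedin (subtopology (zariski n) S) B \<and> A \<union> B = S"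
    then obtain C D where C: "zariski_closed n C" "A = C \<inter> S" and D: "zariski_closed n D" "B = D \<inter> S"
      by (auto simp: closedin_subtopology closedin_zariski)
    show "A = S \<or> B = S"
    proof (rule ccontr)
      assume "\<not> (A = S \<or> B = S)"
      then obtain p q where p: "p \<in> S" "p \<notin> C" and q: "q \<in> S" "q \<notin> D" using C D by blast
      obtain f where f: "f \<in> poly_funs n" "f p \<noteq> 0" "\<And>q. q \<in> C \<Longrightarrow> f q = 0"
        by (rule zariski_closed_obtain_poly[OF C(1) subsetD[OF S p(1)] p(2)]) blast
      obtain g where g: "g \<in> poly_funs n" "g q \<noteq> 0" "\<And>q. q \<in> D \<Longrightarrow> g q = 0"
        by (rule zariski_closed_obtain_poly[OF D(1) subsetD[OF S q(1)] q(2)]) blast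
      have "f x * g x = 0" if "x \<in> S" for x
      proof -
        have "x \<in> C \<or> x \<in> D" using that * C(2) D(2) by blast
        then show ?thesis using f(3)[of x] g(3)[of x] by auto
      qed
      then show False using poly_domainD[OF dom f(1) g(1)] f(2) g(2) p q by blast
    qed
  qed
qed

lemma poly_domain_zclosure:
  assumes "poly_domain n S"
  shows "poly_domain n (zclosure n S)"
proof -
  have S: "S \<subseteq> zclosure n S" using assms zclosure_superset by (auto simp: poly_domain_def)
  show ?thesis
    unfolding poly_domain_def
  proof (intro conjI ballI impI)
    show "zclosure n S \<noteq> {}" using S assms by (auto simp: poly_domain_def)
    fix f g assume fg: "f \<in> poly_funs n" "g \<in> poly_funs n" "\<forall>p\<in>zclosure n S. f p * g p = 0"
    then have "(\<forall>p\<in>S. f p = 0) \<or> (\<forall>p\<in>S. g p = 0)" using poly_domainD[OF assms fg(1,2)] S by (meson subsetD)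
    then show "(\<forall>p\<in>zclosure n S. f p = 0) \<or> (\<forall>p\<in>zclosure n S. g p = 0)"
      using zclosureD[OF _ fg(1)] zclosureD[OF _ fg(2)] by metis
  qed (rule zclosure_subset_mat_pairs)
qed

lemma fun_algebra_poly: "fun_algebra (range (poly :: 'k :: comm_ring_1 poly \<Rightarrow> _))"
  unfolding fun_algebra_def
proof (intro conjI allI ballI)
  show "(\<lambda>_. c) \<in> range poly" for c :: 'k by (rule image_eqI[of _ _ "[:c:]"]) auto
  fix f g :: "'k \<Rightarrow> 'k" assume "f \<in> range poly" "g \<in> range poly"
  then obtain p q where "f = poly p" "g = poly q" by auto
  then have "(\<lambda>w. f w + g w) = poly (p + q)" "(\<lambda>w. f w * g w) = poly (p * q)"
    by (simp_all add: fun_eq_iff)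
  then show "(\<lambda>w. f w + g w) \<in> range poly" "(\<lambda>w. f w * g w) \<in> range poly"
    by (simp_all only: rangeI)
qed

text \<open>Along a rational curve through a point with \<open>f \<noteq> 0\<close> and a point with \<open>g \<noteq> 0\<close>, the functions
  \<open>f\<close> and \<open>g\<close> become, up to denominators, nonzero polynomials in one parameter.  Their product is
  nonzero, and over an infinite field it has a nonzero value.\<close>

lemma poly_domain_if_rational_curves:
  fixes S :: "('k :: field_char_0 mat \<times> 'k mat) set"
  assumes S: "S \<noteq> {}" "S \<subseteq> mat_pairs n"
    and curve: "\<And>p q. p \<in> S \<Longrightarrow> q \<in> S \<Longrightarrow> \<exists>\<gamma> h. h \<in> range poly \<and> \<gamma> (0::'k) = p \<and> \<gamma> 1 = q
       \<and> h 0 \<noteq> 0 \<and> h 1 \<noteq> 0 \<and> (\<forall>t. h t \<noteq> 0 \<longrightarrow> \<gamma> t \<in> S)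
       \<and> (\<forall>i<n. \<forall>j<n. (\<exists>u\<in>range poly. \<forall>t. h t \<noteq> 0 \<longrightarrow> fst (\<gamma> t) $$ (i, j) * h t = u t)
            \<and> (\<exists>u\<in>range poly. \<forall>t. h t \<noteq> 0 \<longrightarrow> snd (\<gamma> t) $$ (i, j) * h t = u t))"
  shows "poly_domain n S"
  unfolding poly_domain_def
proof (intro conjI ballI impI S, rule ccontr)
  fix f g assume fg: "f \<in> poly_funs n" "g \<in> poly_funs n" "\<forall>p\<in>S. f p * g p = 0"
    and "\<not> ((\<forall>p\<in>S. f p = 0) \<or> (\<forall>p\<in>S. g p = 0))"
  then obtain p q where pq: "p \<in> S" "f p \<noteq> 0" "q \<in> S" "g q \<noteq> 0" by blast
  obtain \<gamma> h where c: "h \<in> range poly \<and> \<gamma> (0::'k) = p \<and> \<gamma> 1 = q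
       \<and> h 0 \<noteq> 0 \<and> h 1 \<noteq> 0 \<and> (\<forall>t. h t \<noteq> 0 \<longrightarrow> \<gamma> t \<in> S)
       \<and> (\<forall>i<n. \<forall>j<n. (\<exists>u\<in>range poly. \<forall>t. h t \<noteq> 0 \<longrightarrow> fst (\<gamma> t) $$ (i, j) * h t = u t)
            \<and> (\<exists>u\<in>range poly. \<forall>t. h t \<noteq> 0 \<longrightarrow> snd (\<gamma> t) $$ (i, j) * h t = u t))"
    using curve[OF pq(1,3)] by (elim exE)
  have pull: "\<exists>e. \<exists>u\<in>range poly. \<forall>t. h t \<noteq> 0 \<longrightarrow> f (\<gamma> t) * h t ^ e = u t" if "f \<in> poly_funs n" for f
    by (rule poly_funs_pullback[OF fun_algebra_poly _ _ _ that]) (use c in blast)+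
  obtain h' where h': "h = poly h'" using c by auto
  obtain d u where u: "\<And>t. h t \<noteq> 0 \<Longrightarrow> f (\<gamma> t) * h t ^ d = poly u t"
    using pull[OF fg(1)] by blast
  obtain e v where v: "\<And>t. h t \<noteq> 0 \<Longrightarrow> g (\<gamma> t) * h t ^ e = poly v t"
    using pull[OF fg(2)] by blast
  have "poly u 0 \<noteq> 0" using u[of 0] c pq by auto
  moreover have "poly v 1 \<noteq> 0" using v[of 1] c pq by auto
  moreover have "poly h' 0 \<noteq> 0" using c h' by simp
  ultimately have "u * v * h' \<noteq> 0" by auto
  then obtain t where t: "poly (u * v * h') t \<noteq> 0"
    using poly_all_0_iff_0 by blast
  then have "h t \<noteq> 0" by (simp add: h')
  then have "f (\<gamma> t) \<noteq> 0" "g (\<gamma> t) \<noteq> 0" "\<gamma> t \<in> S"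
    using u[of t] v[of t] t c by auto
  then show False using fg(3) by auto
qed


section \<open>Chains of irreducible closed sets and algebraic independence\<close>

fun monom_fun :: "('w \<Rightarrow> 'k :: comm_ring_1) list \<Rightarrow> nat list \<Rightarrow> 'w \<Rightarrow> 'k" where
  "monom_fun (x # xs) (j # js) w = x w ^ j * monom_fun xs js w"
| "monom_fun _ _ w = 1"

definition exponents :: "nat \<Rightarrow> nat \<Rightarrow> nat list set" where
  "exponents m d = {a. set a \<subseteq> {..d} \<and> length a = m}"

lemma exponents_0 [simp]: "exponents 0 d = {[]}"
  by (auto simp: exponents_def)

lemma finite_exponents [simp]: "finite (exponents m d)"
  unfolding exponents_def by (rule finite_lists_length_eq) simp

lemma card_exponents: "card (exponents m d) = (d + 1) ^ m"
  unfolding exponents_def by (simp add: card_lists_length_eq)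

lemma sum_exponents_Suc:
  "(\<Sum>a\<in>exponents (Suc m) d. F a) = (\<Sum>j\<le>d. \<Sum>b\<in>exponents m d. F (j # b))"
proof -
  have "exponents (Suc m) d = (\<lambda>(j, b). j # b) ` ({..d} \<times> exponents m d)"
    by (auto simp: exponents_def length_Suc_conv image_iff)
  moreover have "inj_on (\<lambda>(j, b). j # b) ({..d} \<times> exponents m d)"
    by (auto simp: inj_on_def)
  ultimately show ?thesis
    by (simp add: sum.reindex sum.cartesian_product split_def)
qed

lemma monom_fun_in_algebra:
  assumes R: "fun_algebra R" and "set xs \<subseteq> R"
  shows "monom_fun xs a \<in> R"
proof -
  have nil: "(\<lambda>_. 1) \<in> R" by (rule fun_algebraD[OF R])
  have triv: "monom_fun [] a = (\<lambda>_. 1)" "monom_fun (x # xs) [] = (\<lambda>_. 1)" for a and x :: "'a \<Rightarrow> 'b" and xs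
    by (auto simp: fun_eq_iff)
  show ?thesis using assms(2)
  proof (induction xs a rule: list_induct2')
    case (4 x xs j a)
    then have "(\<lambda>w. x w ^ j * monom_fun xs a w) \<in> R"
      by (intro fun_algebraD[OF R] fun_algebra_power[OF R]) auto
    moreover have "(\<lambda>w. x w ^ j * monom_fun xs a w) = monom_fun (x # xs) (j # a)"
      by (auto simp: fun_eq_iff)
    ultimately show ?case by simp
  qed (simp_all add: triv nil)
qed

text \<open>A function vanishing on the smaller of two nested irreducible sets but not on the larger
  one is transcendental over any functions that are independent on the smaller set: dividing a
  relation by the powers of the new function leaves one whose lowest term is a relation on the
  smaller set.  Hence a chain of length \<open>m\<close> yields \<open>m\<close> algebraically independent functions.\<close>

lemma chain_imp_independent:
  fixes Z :: "nat \<Rightarrow> ('k :: field mat \<times> 'k mat) set"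
  assumes "\<And>i. i \<le> m \<Longrightarrow> poly_domain n (Z i)"
    and "\<And>i. i \<le> m \<Longrightarrow> zariski_closed n (Z i)"
    and "\<And>i. i < m \<Longrightarrow> Z i \<subset> Z (Suc i)"
  shows "\<exists>gs. length gs = m \<and> set gs \<subseteq> poly_funs n \<and>
    (\<forall>d c. (\<forall>p\<in>Z m. (\<Sum>a\<in>exponents m d. c a * monom_fun gs a p) = 0)
        \<longrightarrow> (\<forall>a\<in>exponents m d. c a = 0))"
  using assms
proof (induction m)
  case 0
  then have "Z 0 \<noteq> {}" by (simp add: poly_domain_def)
  then obtain p where "p \<in> Z 0" by blast
  then show ?case by (intro exI[of _ "[]"]) fastforce
next
  case (Suc m)
  have R: "fun_algebra (poly_funs n :: ('k mat \<times> 'k mat \<Rightarrow> 'k) set)" by (rule fun_algebra_poly_funs)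
  have "\<exists>gs. length gs = m \<and> set gs \<subseteq> poly_funs n \<and>
    (\<forall>d c. (\<forall>p\<in>Z m. (\<Sum>a\<in>exponents m d. c a * monom_fun gs a p) = 0)
        \<longrightarrow> (\<forall>a\<in>exponents m d. c a = 0))"
    by (rule Suc.IH) (simp_all add: Suc.prems)
  then obtain gs where gs: "length gs = m" "set gs \<subseteq> poly_funs n"
    and ind: "\<And>d c. (\<forall>p\<in>Z m. (\<Sum>a\<in>exponents m d. c a * monom_fun gs a p) = 0)
        \<Longrightarrow> (\<forall>a\<in>exponents m d. c a = 0)"
    by blast
  have sub: "Z m \<subset> Z (Suc m)" using Suc.prems(3) by simp
  have dom: "poly_domain n (Z (Suc m))" using Suc.prems(1) by simp
  obtain q where q: "q \<in> Z (Suc m)" "q \<notin> Z m" using sub by blast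
  have "q \<in> mat_pairs n" using q dom by (auto simp: poly_domain_def)
  then obtain g where g: "g \<in> poly_funs n" "g q \<noteq> 0" "\<And>p. p \<in> Z m \<Longrightarrow> g p = 0"
    using zariski_closed_obtain_poly[OF Suc.prems(2)[of m] _ q(2)] by auto
  have "\<forall>a\<in>exponents (Suc m) d. c a = 0"
    if rel: "\<forall>p\<in>Z (Suc m). (\<Sum>a\<in>exponents (Suc m) d. c a * monom_fun (g # gs) a p) = 0" for d c
  proof -
    define u where "u j p = (\<Sum>b\<in>exponents m d. c (j # b) * monom_fun gs b p)" for j p
    have u: "u j \<in> poly_funs n" for j
      unfolding u_def
      by (intro fun_algebra_sum[OF R] fun_algebraD[OF R] monom_fun_in_algebra[OF R] gs)
    have rel': "(\<Sum>j\<le>d. g p ^ j * u j p) = 0" if "p \<in> Z (Suc m)" for p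
      using rel that by (simp add: sum_exponents_Suc u_def sum_distrib_left mult_ac)
    \<comment> \<open>Once the coefficients of \<open>g ^ j\<close> vanish for \<open>j < k\<close>, the relation is divisible by \<open>g ^ k\<close>.\<close>
    have "\<forall>j<k. j \<le> d \<longrightarrow> (\<forall>b\<in>exponents m d. c (j # b) = 0)" for k
    proof (induction k)
      case (Suc k)
      have "\<forall>b\<in>exponents m d. c (k # b) = 0" if "k \<le> d"
      proof -
        define v where "v p = (\<Sum>j\<in>{k..d}. g p ^ (j - k) * u j p)" for p
        have v: "v \<in> poly_funs n"
          unfolding v_def
          by (intro fun_algebra_sum[OF R] fun_algebraD[OF R] fun_algebra_power[OF R] g u)
        have "g p ^ k * v p = 0" if p: "p \<in> Z (Suc m)" for p
        proof -
          have "u j p = 0" if "j < k" for j using Suc that \<open>k \<le> d\<close> by (simp add: u_def)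
          then have "(\<Sum>j\<le>d. g p ^ j * u j p) = (\<Sum>j\<in>{k..d}. g p ^ j * u j p)"
            by (intro sum.mono_neutral_right) auto
          also have "\<dots> = g p ^ k * v p"
            unfolding v_def sum_distrib_left
            by (intro sum.cong refl) (simp add: mult.assoc[symmetric] power_add[symmetric])
          finally show ?thesis using rel'[OF p] by simp
        qed
        then have "(\<forall>p\<in>Z (Suc m). g p ^ k = 0) \<or> (\<forall>p\<in>Z (Suc m). v p = 0)"
          by (intro poly_domainD[OF dom] fun_algebra_power[OF R] g v)
        then have v0: "\<forall>p\<in>Z (Suc m). v p = 0" using g(2) q(1) by auto
        have "u k p = 0" if p: "p \<in> Z m" for p
        proof -
          have "v p = (\<Sum>j\<in>{k}. g p ^ (j - k) * u j p)"
            unfolding v_def using g(3)[OF p] \<open>k \<le> d\<close>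
            by (intro sum.mono_neutral_right) auto
          then show ?thesis using v0 p sub by auto
        qed
        then show ?thesis using ind[of "\<lambda>b. c (k # b)" d] by (simp add: u_def)
      qed
      then show ?case using Suc by (auto simp: less_Suc_eq)
    qed simp
    from this[of "Suc d"] show ?thesis
      by (auto simp: exponents_def length_Suc_conv)
  qed
  then show ?case using gs g(1) by (intro exI[of _ "g # gs"]) simp
qed

section \<open>Counting monomials\<close>

text \<open>Padding the coefficient matrix with zero rows makes it square with determinant \<open>0\<close>.\<close>

lemma homogeneous_system_nontrivial:
  fixes M :: "'b \<Rightarrow> 'a \<Rightarrow> 'k :: field"
  assumes A: "finite A" and B: "finite B" and less: "card B < card A"
  shows "\<exists>c. (\<exists>a\<in>A. c a \<noteq> 0) \<and> (\<forall>b\<in>B. (\<Sum>a\<in>A. M b a * c a) = 0)"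
proof -
  define N where "N = card A"
  obtain f where f: "bij_betw f {0..<N} A"
    using ex_bij_betw_nat_finite[OF A] by (auto simp: N_def)
  obtain g where g: "bij_betw g {0..<card B} B"
    using ex_bij_betw_nat_finite[OF B] by auto
  define T where "T = mat N N (\<lambda>(i, j). if i < card B then M (g i) (f j) else 0)"
  have T: "T \<in> carrier_mat N N" by (simp add: T_def)
  have "card B < N" using less by (simp add: N_def)
  have "T\<^sup>T *\<^sub>v unit_vec N (card B) = 0\<^sub>v N"
    by (intro eq_vecI) (use \<open>card B < N\<close> in \<open>auto simp: T_def scalar_prod_def intro!: sum.neutral\<close>)
  moreover have "unit_vec N (card B) \<noteq> (0\<^sub>v N :: 'k vec)"
    using \<open>card B < N\<close> by (metis index_unit_vec(2) index_zero_vec(1) zero_neq_one)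
  ultimately have "det (T\<^sup>T) = 0"
    using det_0_iff_vec_prod_zero[of "T\<^sup>T" N] T unit_vec_carrier by (metis transpose_carrier_mat)
  then have "det T = 0" using det_transpose[OF T] by simp
  then obtain v where v: "v \<in> carrier_vec N" "v \<noteq> 0\<^sub>v N" "T *\<^sub>v v = 0\<^sub>v N"
    using det_0_iff_vec_prod_zero[OF T] by blast
  define c where "c a = v $ (the_inv_into {0..<N} f a)" for a
  have cf: "c (f j) = v $ j" if "j < N" for j
    using that f by (simp add: c_def bij_betw_def the_inv_into_f_f)
  obtain j where j: "j < N" "v $ j \<noteq> 0" 
    using v(1,2) eq_vecI[of v "0\<^sub>v N"] by auto
  have "f j \<in> A" using f j(1) by (auto simp: bij_betw_def)
  moreover have "(\<Sum>a\<in>A. M b a * c a) = 0" if b: "b \<in> B" for b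
  proof -
    have "b \<in> g ` {0..<card B}" using g b by (simp add: bij_betw_def)
    then obtain i where i: "i < card B" "g i = b" by auto
    have "(\<Sum>a\<in>A. M b a * c a) = (\<Sum>j\<in>{0..<N}. M b (f j) * c (f j))"
      by (rule sum.reindex_bij_betw[OF f, symmetric])
    also have "\<dots> = (\<Sum>j\<in>{0..<N}. T $$ (i, j) * v $ j)"
      using i \<open>card B < N\<close> by (intro sum.cong) (auto simp: T_def cf)
    also have "\<dots> = (T *\<^sub>v v) $ i"
      using i \<open>card B < N\<close> T v(1) by (simp add: scalar_prod_def)
    also have "\<dots> = 0" using v(3) i \<open>card B < N\<close> by simp
    finally show ?thesis .
  qed
  ultimately show ?thesis using cf[OF j(1)] j(2) by (intro exI[of _ c]) (simp, metis)
qed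

text \<open>The degree is bounded in each function separately, so the monomials form a box whose size is
  a power.  The recursion reads such a polynomial as one in the first function, with coefficients
  built from the others; products then reduce to products of polynomials in one variable.\<close>

fun bounded_polys :: "('w \<Rightarrow> 'k :: idom) list \<Rightarrow> nat \<Rightarrow> ('w \<Rightarrow> 'k) set" where
  "bounded_polys [] d = range (\<lambda>c _. c)"
| "bounded_polys (x # xs) d = {\<lambda>w. \<Sum>j\<le>d. u j w * x w ^ j | u. \<forall>j. u j \<in> bounded_polys xs d}"

lemma bounded_polys_ConsI:
  assumes "\<And>j. u j \<in> bounded_polys xs d" "\<And>w. f w = (\<Sum>j\<le>d. u j w * x w ^ j)"
  shows "f \<in> bounded_polys (x # xs) d"
proof -
  have "f = (\<lambda>w. \<Sum>j\<le>d. u j w * x w ^ j)" by (rule ext) (rule assms(2))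
  then show ?thesis using assms(1) by auto
qed

lemma bounded_polys_ConsE:
  assumes "f \<in> bounded_polys (x # xs) d"
  obtains u where "\<And>j. u j \<in> bounded_polys xs d" "\<And>w. f w = (\<Sum>j\<le>d. u j w * x w ^ j)"
  using assms by auto

lemma bounded_polys_const: "(\<lambda>_. c) \<in> bounded_polys xs d"
proof (induction xs arbitrary: c)
  case (Cons x xs)
  show ?case
    by (rule bounded_polys_ConsI[of "\<lambda>j _. if j = 0 then c else 0"])
       (simp_all add: Cons if_distrib[of "\<lambda>y. y * _"] cong: if_cong)
qed simp

lemma bounded_polys_add:
  "f \<in> bounded_polys xs d \<Longrightarrow> g \<in> bounded_polys xs d \<Longrightarrow> (\<lambda>w. f w + g w) \<in> bounded_polys xs d"
proof (induction xs arbitrary: f g)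
  case (Cons x xs)
  obtain u where u: "\<And>j. u j \<in> bounded_polys xs d" "\<And>w. f w = (\<Sum>j\<le>d. u j w * x w ^ j)"
    using Cons.prems(1) by (rule bounded_polys_ConsE) blast
  obtain v where v: "\<And>j. v j \<in> bounded_polys xs d" "\<And>w. g w = (\<Sum>j\<le>d. v j w * x w ^ j)"
    using Cons.prems(2) by (rule bounded_polys_ConsE) blast
  show ?case
    by (rule bounded_polys_ConsI[OF Cons.IH[OF u(1) v(1)]])
       (simp only: u(2) v(2) sum.distrib distrib_right)
qed auto

lemma bounded_polys_mono:
  assumes "d \<le> e"
  shows "f \<in> bounded_polys xs d \<Longrightarrow> f \<in> bounded_polys xs e"
proof (induction xs arbitrary: f)
  case (Cons x xs)
  obtain u where u: "\<And>j. u j \<in> bounded_polys xs d" "\<And>w. f w = (\<Sum>j\<le>d. u j w * x w ^ j)"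
    using Cons.prems by (rule bounded_polys_ConsE) blast
  show ?case
  proof (rule bounded_polys_ConsI)
    show "(\<lambda>w. if j \<le> d then u j w else 0) \<in> bounded_polys xs e" for j
      using Cons.IH[OF u(1)] bounded_polys_const by (cases "j \<le> d") simp_all
    show "f w = (\<Sum>j\<le>e. (if j \<le> d then u j w else 0) * x w ^ j)" for w
      unfolding u(2) using \<open>d \<le> e\<close> by (intro sum.mono_neutral_cong_left) auto
  qed
qed simp

lemma bounded_polys_sum:
  "(\<And>i. i \<in> I \<Longrightarrow> f i \<in> bounded_polys xs d) \<Longrightarrow> (\<lambda>w. \<Sum>i\<in>I. f i w) \<in> bounded_polys xs d"
  by (induction I rule: infinite_finite_induct)
     (simp_all add: bounded_polys_const bounded_polys_add)

lemma bounded_polys_mult: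
  "f \<in> bounded_polys xs d \<Longrightarrow> g \<in> bounded_polys xs e \<Longrightarrow> (\<lambda>w. f w * g w) \<in> bounded_polys xs (d + e)"
proof (induction xs arbitrary: f g)
  case (Cons x xs)
  obtain u where u: "\<And>j. u j \<in> bounded_polys xs d" "\<And>w. f w = (\<Sum>j\<le>d. u j w * x w ^ j)"
    using Cons.prems(1) by (rule bounded_polys_ConsE) blast
  obtain v where v: "\<And>j. v j \<in> bounded_polys xs e" "\<And>w. g w = (\<Sum>j\<le>e. v j w * x w ^ j)"
    using Cons.prems(2) by (rule bounded_polys_ConsE) blast
  define u' v' where "u' j w = (if j \<le> d then u j w else 0)" and "v' j w = (if j \<le> e then v j w else 0)" for j w
  have u': "u' j \<in> bounded_polys xs d" for j
    using u(1)[of j] bounded_polys_const[of 0 xs d] by (cases "j \<le> d") (simp_all add: u'_def[abs_def])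
  have v': "v' j \<in> bounded_polys xs e" for j
    using v(1)[of j] bounded_polys_const[of 0 xs e] by (cases "j \<le> e") (simp_all add: v'_def[abs_def])
  show ?case
  proof (rule bounded_polys_ConsI)
    show "(\<lambda>w. \<Sum>k\<le>r. u' k w * v' (r - k) w) \<in> bounded_polys xs (d + e)" for r
      by (intro bounded_polys_sum Cons.IH u' v')
    show "f w * g w = (\<Sum>r\<le>d + e. (\<Sum>k\<le>r. u' k w * v' (r - k) w) * x w ^ r)" for w
    proof -
      have "f w * g w = (\<Sum>j\<le>d. u' j w * x w ^ j) * (\<Sum>j\<le>e. v' j w * x w ^ j)"
        by (simp add: u(2) v(2) u'_def v'_def)
      also have "\<dots> = (\<Sum>r\<le>d + e. (\<Sum>k\<le>r. u' k w * v' (r - k) w) * x w ^ r)"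
        by (rule polynomial_product) (auto simp: u'_def v'_def)
      finally show ?thesis .
    qed
  qed
qed auto

lemma bounded_polys_expand:
  "f \<in> bounded_polys xs d \<Longrightarrow>
     \<exists>c. f = (\<lambda>w. \<Sum>b\<in>exponents (length xs) d. c b * monom_fun xs b w)"
proof (induction xs arbitrary: f)
  case (Cons x xs)
  obtain u where u: "\<And>j. u j \<in> bounded_polys xs d" "\<And>w. f w = (\<Sum>j\<le>d. u j w * x w ^ j)"
    using Cons.prems by (rule bounded_polys_ConsE) blast
  have "\<forall>j. \<exists>c. u j = (\<lambda>w. \<Sum>b\<in>exponents (length xs) d. c b * monom_fun xs b w)"
    using Cons.IH[OF u(1)] by blast
  then obtain c where c: "\<And>j. u j = (\<lambda>w. \<Sum>b\<in>exponents (length xs) d. c j b * monom_fun xs b w)"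
    by metis
  show ?case
    by (rule exI[of _ "\<lambda>b. c (hd b) (tl b)"])
       (simp add: fun_eq_iff u(2) c sum_exponents_Suc sum_distrib_right sum_distrib_left mult_ac)
qed auto

definition polys_in :: "('w \<Rightarrow> 'k :: idom) list \<Rightarrow> ('w \<Rightarrow> 'k) set" where
  "polys_in xs = (\<Union>d. bounded_polys xs d)"

lemma fun_algebra_polys_in: "fun_algebra (polys_in xs)"
  unfolding fun_algebra_def
proof (intro conjI ballI allI)
  show "(\<lambda>_. c) \<in> polys_in xs" for c
    unfolding polys_in_def using bounded_polys_const by blast
  fix f g assume "f \<in> polys_in xs" "g \<in> polys_in xs"
  then obtain d e where fg: "f \<in> bounded_polys xs d" "g \<in> bounded_polys xs e"
    by (auto simp: polys_in_def)
  then have "f \<in> bounded_polys xs (d + e)" "g \<in> bounded_polys xs (d + e)"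
    by (auto elim: bounded_polys_mono[rotated])
  then have "(\<lambda>w. f w + g w) \<in> bounded_polys xs (d + e)" by (rule bounded_polys_add)
  then show "(\<lambda>w. f w + g w) \<in> polys_in xs" unfolding polys_in_def by blast
  have "(\<lambda>w. f w * g w) \<in> bounded_polys xs (d + e)" using fg by (rule bounded_polys_mult)
  then show "(\<lambda>w. f w * g w) \<in> polys_in xs" unfolding polys_in_def by blast
qed

lemma polys_in_coordinate: "x \<in> set xs \<Longrightarrow> x \<in> polys_in xs"
proof (induction xs)
  case (Cons y xs)
  show ?case
  proof (cases "x = y")
    case True
    have "x \<in> bounded_polys (y # xs) 1"
    proof (rule bounded_polys_ConsI[of "\<lambda>j _. if j = 1 then 1 else 0"])
      show "(\<lambda>_. if j = 1 then 1 else 0) \<in> bounded_polys xs 1" for j :: nat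
        by (rule bounded_polys_const)
    qed (simp add: True)
    then show ?thesis unfolding polys_in_def by blast
  next
    case False
    then obtain d where d: "x \<in> bounded_polys xs d" using Cons by (auto simp: polys_in_def)
    have "x \<in> bounded_polys (y # xs) d"
    proof (rule bounded_polys_ConsI[of "\<lambda>j w. if j = 0 then x w else 0"])
      show "(\<lambda>w. if j = 0 then x w else 0) \<in> bounded_polys xs d" for j :: nat
        using d bounded_polys_const by (cases "j = 0") simp_all
    qed (simp add: if_distrib[of "\<lambda>y. y * _"] cong: if_cong)
    then show ?thesis unfolding polys_in_def by blast
  qed
qed simp

text \<open>The power of \<open>H\<close> gives all monomials the same total degree \<open>d * m\<close>.  Dividing by
  \<open>H ^ (d * m)\<close> then turns the \<open>F\<close>'s into the fractions \<open>F / H\<close>.\<close>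

lemma homogenised_monomial_bounded:
  assumes "\<And>F. F \<in> set Fs \<Longrightarrow> F \<in> bounded_polys xs D" and H: "H \<in> bounded_polys xs D"
    and "length Fs = m" "a \<in> exponents m d"
  shows "(\<lambda>w. H w ^ (d * m - sum_list a) * monom_fun Fs a w) \<in> bounded_polys xs (d * m * D)"
proof -
  have pow: "(\<lambda>w. F w ^ j) \<in> bounded_polys xs (j * D)" if "F \<in> bounded_polys xs D" for F j
  proof (induction j)
    case (Suc j)
    show ?case using bounded_polys_mult[OF that Suc] by simp
  qed (simp add: bounded_polys_const)
  have "monom_fun Fs a \<in> bounded_polys xs (sum_list a * D) \<and> sum_list a \<le> d * m"
    using assms(1,3,4)
  proof (induction a arbitrary: Fs m)
    case Nil
    then have "monom_fun Fs [] = (\<lambda>_. 1)" by (auto simp: exponents_def fun_eq_iff)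
    then show ?case by (simp add: bounded_polys_const)
  next
    case (Cons j a)
    then obtain F Fs' m' where F: "Fs = F # Fs'" "m = Suc m'" "length Fs' = m'" "a \<in> exponents m' d" "j \<le> d"
      by (cases Fs) (auto simp: exponents_def)
    have IH: "monom_fun Fs' a \<in> bounded_polys xs (sum_list a * D)" "sum_list a \<le> d * m'"
      using Cons.IH[of Fs' m'] F Cons.prems(1) by auto
    have "(\<lambda>w. F w ^ j * monom_fun Fs' a w) \<in> bounded_polys xs (j * D + sum_list a * D)"
      using Cons.prems(1) F by (intro bounded_polys_mult pow IH) auto
    moreover have "monom_fun Fs (j # a) = (\<lambda>w. F w ^ j * monom_fun Fs' a w)"
      by (auto simp: F fun_eq_iff)
    ultimately show ?case using IH(2) F by (simp add: algebra_simps)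
  qed
  then have *: "monom_fun Fs a \<in> bounded_polys xs (sum_list a * D)" "sum_list a \<le> d * m" by auto
  have "(\<lambda>w. H w ^ (d * m - sum_list a) * monom_fun Fs a w)
      \<in> bounded_polys xs ((d * m - sum_list a) * D + sum_list a * D)"
    by (intro bounded_polys_mult pow H *)
  moreover have "(d * m - sum_list a) * D + sum_list a * D = d * m * D"
    using *(2) by (simp add: add_mult_distrib[symmetric])
  ultimately show ?thesis by simp
qed

lemma monom_fun_rescale:
  fixes h :: "'k :: field"
  assumes "length fs = length Fs" "length a = length Fs"
    and "\<And>i. i < length fs \<Longrightarrow> (Fs ! i) w = h * (fs ! i) p"
  shows "monom_fun Fs a w = h ^ sum_list a * monom_fun fs a p"
  using assms
proof (induction a arbitrary: fs Fs)
  case (Cons j a)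
  then obtain F Fs' f fs' where F: "Fs = F # Fs'" "fs = f # fs'"
    by (cases Fs; cases fs) auto
  have "monom_fun Fs' a w = h ^ sum_list a * monom_fun fs' a p"
  proof (rule Cons.IH)
    show "i < length fs' \<Longrightarrow> (Fs' ! i) w = h * (fs' ! i) p" for i
      using Cons.prems(3)[of "Suc i"] by (simp add: F)
  qed (use Cons.prems F in auto)
  moreover have "F w = h * f p" using Cons.prems(3)[of 0] by (simp add: F)
  ultimately show ?case by (simp add: F power_mult_distrib power_add mult_ac)
qed simp

text \<open>For exponents up to \<open>d\<close>, the \<open>(d + 1) ^ m\<close> monomials in \<open>m\<close> fractions lie, after clearing
  denominators, in a space spanned by \<open>O(d ^ r)\<close> monomials in the \<open>r\<close> functions \<open>xs\<close>.  For
  \<open>m > r\<close> and large \<open>d\<close> they are linearly dependent.\<close>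

lemma more_functions_than_coordinates_dependent:
  fixes xs :: "('w \<Rightarrow> 'k :: field) list"
  assumes len: "length fs = m" "length xs < m"
    and H: "H \<in> polys_in xs"
    and F: "\<And>f. f \<in> set fs \<Longrightarrow> \<exists>u\<in>polys_in xs. \<forall>w. H w \<noteq> 0 \<longrightarrow> u w = H w * f (\<phi> w)"
  shows "\<exists>d c. (\<exists>a\<in>exponents m d. c a \<noteq> 0) \<and>
     (\<forall>w. H w \<noteq> 0 \<longrightarrow> (\<Sum>a\<in>exponents m d. c a * monom_fun fs a (\<phi> w)) = 0)"
proof -
  define r where "r = length xs"
  obtain G where G: "\<And>f. f \<in> set fs \<Longrightarrow> G f \<in> polys_in xs"
      "\<And>f w. f \<in> set fs \<Longrightarrow> H w \<noteq> 0 \<Longrightarrow> G f w = H w * f (\<phi> w)"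
    using F by metis
  have "\<exists>D. \<forall>f\<in>S. f \<in> bounded_polys xs D" if "finite S" "S \<subseteq> polys_in xs" for S
    using that
  proof (induction S)
    case (insert f S)
    then obtain D E where "\<forall>f\<in>S. f \<in> bounded_polys xs D" "f \<in> bounded_polys xs E"
      by (auto simp: polys_in_def)
    then show ?case
      using bounded_polys_mono[of D "D + E" _ xs] bounded_polys_mono[of E "D + E" _ xs]
      by (intro exI[of _ "D + E"]) simp
  qed simp
  from this[of "insert H (G ` set fs)"] obtain D
    where D: "H \<in> bounded_polys xs D" "\<And>f. f \<in> set fs \<Longrightarrow> G f \<in> bounded_polys xs D"
    using H G(1) by auto
  \<comment> \<open>This value gives \<open>d + 1 > (m D + 1) ^ r\<close>, while \<open>d m D + 1 \<le> (d + 1) (m D + 1)\<close> bounds the box.\<close>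
  define d where "d = (m * D + 1) ^ r"
  define E where "E = d * m * D"
  define Fs where "Fs = map G fs"
  define T where "T a w = H w ^ (d * m - sum_list a) * monom_fun Fs a w" for a w
  have "T a \<in> bounded_polys xs E" if "a \<in> exponents m d" for a
    unfolding T_def[abs_def] E_def using that D len
    by (intro homogenised_monomial_bounded) (auto simp: Fs_def)
  then have "\<exists>C. T a = (\<lambda>w. \<Sum>b\<in>exponents r E. C b * monom_fun xs b w)" if "a \<in> exponents m d" for a
    using bounded_polys_expand that unfolding r_def by blast
  then obtain M where M: "\<And>a. a \<in> exponents m d \<Longrightarrow>
      T a = (\<lambda>w. \<Sum>b\<in>exponents r E. M a b * monom_fun xs b w)"
    by metis
  have "E + 1 \<le> (d + 1) * (m * D + 1)" by (simp add: E_def algebra_simps)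
  then have "(E + 1) ^ r \<le> (d + 1) ^ r * (m * D + 1) ^ r"
    unfolding power_mult_distrib[symmetric] by (rule power_mono) simp
  also have "\<dots> < (d + 1) ^ r * (d + 1)" by (simp add: d_def)
  also have "\<dots> = (d + 1) ^ Suc r" by simp
  also have "\<dots> \<le> (d + 1) ^ m" using len r_def by (intro power_increasing) auto
  finally have "card (exponents r E) < card (exponents m d)" by (simp only: card_exponents)
  from homogeneous_system_nontrivial[OF _ _ this, of "\<lambda>b a. M a b"] obtain c
    where c: "\<exists>a\<in>exponents m d. c a \<noteq> 0"
      "\<And>b. b \<in> exponents r E \<Longrightarrow> (\<Sum>a\<in>exponents m d. M a b * c a) = 0" by auto
  have "(\<Sum>a\<in>exponents m d. c a * monom_fun fs a (\<phi> w)) = 0" if w: "H w \<noteq> 0" for w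
  proof -
    have T: "T a w = H w ^ (d * m) * monom_fun fs a (\<phi> w)" if a: "a \<in> exponents m d" for a
    proof -
      have "sum_list a \<le> d * m"
        using a sum_list_mono[of a "\<lambda>x. x" "\<lambda>_. d"]
        by (auto simp: exponents_def sum_list_triv mult.commute subset_iff)
      moreover have "monom_fun Fs a w = H w ^ sum_list a * monom_fun fs a (\<phi> w)"
        using a len G(2)[OF _ w] by (intro monom_fun_rescale) (auto simp: Fs_def exponents_def)
      ultimately show ?thesis by (simp add: T_def power_add[symmetric] mult.assoc[symmetric])
    qed
    have "H w ^ (d * m) * (\<Sum>a\<in>exponents m d. c a * monom_fun fs a (\<phi> w))
        = (\<Sum>a\<in>exponents m d. c a * T a w)"
      by (simp add: T sum_distrib_left mult_ac)
    also have "\<dots> = (\<Sum>a\<in>exponents m d. \<Sum>b\<in>exponents r E. M a b * c a * monom_fun xs b w)"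
      by (intro sum.cong refl) (simp add: M sum_distrib_left mult_ac)
    also have "\<dots> = (\<Sum>b\<in>exponents r E. (\<Sum>a\<in>exponents m d. M a b * c a) * monom_fun xs b w)"
      by (subst sum.swap) (simp add: sum_distrib_right)
    also have "\<dots> = 0" using c(2) by simp
    finally show ?thesis using w by simp
  qed
  then show ?thesis using c(1) by blast
qed


section \<open>Linear maps on square matrices\<close>

definition mat_linear :: "nat \<Rightarrow> ('k :: field mat \<Rightarrow> 'k mat) \<Rightarrow> bool" where
  "mat_linear n L \<longleftrightarrow>
     (\<forall>A\<in>carrier_mat n n. L A \<in> carrier_mat n n) \<and>
     (\<forall>A\<in>carrier_mat n n. \<forall>B\<in>carrier_mat n n. L (A + B) = L A + L B) \<and>
     (\<forall>c. \<forall>A\<in>carrier_mat n n. L (c \<cdot>\<^sub>m A) = c \<cdot>\<^sub>m L A)"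

lemma mat_linearD:
  assumes "mat_linear n L" "A \<in> carrier_mat n n"
  shows "L A \<in> carrier_mat n n" "B \<in> carrier_mat n n \<Longrightarrow> L (A + B) = L A + L B"
    "L (c \<cdot>\<^sub>m A) = c \<cdot>\<^sub>m L A"
  using assms unfolding mat_linear_def by auto

lemma mat_linear_zero:
  assumes "mat_linear n L"
  shows "L (0\<^sub>m n n) = 0\<^sub>m n n"
proof -
  have "L (0\<^sub>m n n) = L (0 \<cdot>\<^sub>m 0\<^sub>m n n)" by (intro arg_cong[of _ _ L] eq_matI) auto
  also have "\<dots> = 0 \<cdot>\<^sub>m L (0\<^sub>m n n)" by (rule mat_linearD(3)[OF assms]) simp
  also have "\<dots> = 0\<^sub>m n n" using mat_linearD(1)[OF assms, of "0\<^sub>m n n"] by (intro eq_matI) auto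
  finally show ?thesis .
qed

lemma mat_linear_diff:
  assumes L: "mat_linear n L" and A: "A \<in> carrier_mat n n" and B: "B \<in> carrier_mat n n"
  shows "L (A - B) = L A - L B"
proof -
  have "A - B = A + (- 1) \<cdot>\<^sub>m B" using A B by (intro eq_matI) auto
  then have "L (A - B) = L A + (- 1) \<cdot>\<^sub>m L B" using mat_linearD[OF L] A B by simp
  also have "\<dots> = L A - L B"
    using mat_linearD(1)[OF L A] mat_linearD(1)[OF L B] by (intro eq_matI) auto
  finally show ?thesis .
qed

definition mat_unit :: "nat \<Rightarrow> nat \<Rightarrow> 'k :: zero_neq_one mat" where
  "mat_unit n e = mat n n (\<lambda>(i, j). if i * n + j = e then 1 else 0)"

lemma mat_unit_carrier [simp]: "mat_unit n e \<in> carrier_mat n n"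
  by (simp add: mat_unit_def)

lemma index_less_square:
  fixes i j n :: nat
  assumes "i < n" "j < n"
  shows "i * n + j < n * n"
proof -
  have "i * n + j < i * n + n" using assms by simp
  also have "\<dots> \<le> n * n" using assms(1) by (metis Suc_leI add.commute mult_Suc mult_le_mono1)
  finally show ?thesis .
qed

lemma index_div_less: "e < n * n \<Longrightarrow> e div n < n" for e n :: nat
  by (simp add: less_mult_imp_div_less)

lemma index_mod_less: "e < n * n \<Longrightarrow> e mod n < n" for e n :: nat
  by (cases n) auto

lemma mat_linear_entry:
  assumes L: "mat_linear n L" and A: "A \<in> carrier_mat n n" and ij: "i < n" "j < n"
  shows "L A $$ (i, j) = (\<Sum>e<n * n. A $$ (e div n, e mod n) * L (mat_unit n e) $$ (i, j))"
proof -
  \<comment> \<open>\<open>T m\<close> keeps the first \<open>m\<close> entries of \<open>A\<close>, so that linearity is applied one entry at a time.\<close>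
  define T where "T m = mat n n (\<lambda>(i, j). if i * n + j < m then A $$ (i, j) else 0)" for m
  have T: "T m \<in> carrier_mat n n" for m by (simp add: T_def)
  have *: "L (T m) $$ (i, j) = (\<Sum>e<m. A $$ (e div n, e mod n) * L (mat_unit n e) $$ (i, j))" if "m \<le> n * n" for m
    using that
  proof (induction m)
    case 0
    have "T 0 = 0\<^sub>m n n" by (intro eq_matI) (auto simp: T_def)
    then show ?case using mat_linear_zero[OF L] ij by simp
  next
    case (Suc m)
    have "T (Suc m) = T m + A $$ (m div n, m mod n) \<cdot>\<^sub>m mat_unit n m"
      by (intro eq_matI) (auto simp: T_def mat_unit_def less_Suc_eq)
    then have "L (T (Suc m)) = L (T m) + A $$ (m div n, m mod n) \<cdot>\<^sub>m L (mat_unit n m)"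
      using mat_linearD[OF L] T by simp
    then show ?case using Suc mat_linearD(1)[OF L mat_unit_carrier, of m] mat_linearD(1)[OF L T, of m] ij
      by simp
  qed
  have "T (n * n) = A"
    using A index_less_square by (intro eq_matI) (auto simp: T_def)
  then show ?thesis using *[of "n * n"] by simp
qed

lemma mat_over_linear:
  assumes R: "fun_algebra R" and L: "mat_linear n L" and A: "A \<in> mat_over R n n"
  shows "(\<lambda>w. L (A w)) \<in> mat_over R n n"
proof (rule mat_overI)
  fix i j assume "i < n" "j < n"
  then have eq: "L (A w) $$ (i, j)
      = (\<Sum>e<n * n. A w $$ (e div n, e mod n) * L (mat_unit n e) $$ (i, j))" for w
    by (rule mat_linear_entry[OF L mat_overD(1)[OF A]])
  have "(\<lambda>w. \<Sum>e<n * n. A w $$ (e div n, e mod n) * L (mat_unit n e) $$ (i, j)) \<in> R"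
    by (intro fun_algebra_sum[OF R] fun_algebraD[OF R] mat_overD(2)[OF A])
       (auto intro: index_div_less index_mod_less)
  then show "(\<lambda>w. L (A w) $$ (i, j)) \<in> R" unfolding eq .
qed (intro mat_linearD(1)[OF L] mat_overD(1)[OF A])

text \<open>Position \<open>(i, j)\<close> is numbered \<open>i * n + j\<close>, so that linear maps on matrices have determinants.
  Cramer's rule then solves linear equations between matrices polynomially in the coefficients.\<close>

definition mat_linear_matrix :: "nat \<Rightarrow> ('k :: field mat \<Rightarrow> 'k mat) \<Rightarrow> 'k mat" where
  "mat_linear_matrix n L =
     mat (n * n) (n * n) (\<lambda>(e, f). L (mat_unit n f) $$ (e div n, e mod n))"

definition mat_linear_det :: "nat \<Rightarrow> ('k :: field mat \<Rightarrow> 'k mat) \<Rightarrow> 'k" where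
  "mat_linear_det n L = det (mat_linear_matrix n L)"

definition flatten :: "nat \<Rightarrow> 'k mat \<Rightarrow> 'k vec" where
  "flatten n A = vec (n * n) (\<lambda>e. A $$ (e div n, e mod n))"

definition unflatten :: "nat \<Rightarrow> 'k vec \<Rightarrow> 'k mat" where
  "unflatten n v = mat n n (\<lambda>(i, j). v $ (i * n + j))"

definition cramer_solution :: "nat \<Rightarrow> ('k :: field mat \<Rightarrow> 'k mat) \<Rightarrow> 'k mat \<Rightarrow> 'k mat" where
  "cramer_solution n L B = unflatten n (adj_mat (mat_linear_matrix n L) *\<^sub>v flatten n B)"

lemma mat_linear_matrix_carrier [simp]: "mat_linear_matrix n L \<in> carrier_mat (n * n) (n * n)"
  by (simp add: mat_linear_matrix_def)

lemma flatten_carrier [simp]: "flatten n A \<in> carrier_vec (n * n)"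
  by (simp add: flatten_def)

lemma unflatten_carrier [simp]: "unflatten n v \<in> carrier_mat n n"
  by (simp add: unflatten_def)

lemma cramer_solution_carrier [simp]: "cramer_solution n L B \<in> carrier_mat n n"
  by (simp add: cramer_solution_def)

lemma unflatten_flatten: "A \<in> carrier_mat n n \<Longrightarrow> unflatten n (flatten n A) = A"
  by (intro eq_matI) (auto simp: unflatten_def flatten_def index_less_square)

lemma flatten_unflatten: "v \<in> carrier_vec (n * n) \<Longrightarrow> flatten n (unflatten n v) = v"
  by (intro eq_vecI) (auto simp: unflatten_def flatten_def index_div_less index_mod_less)

lemma unflatten_smult: "v \<in> carrier_vec (n * n) \<Longrightarrow> unflatten n (c \<cdot>\<^sub>v v) = c \<cdot>\<^sub>m unflatten n v"
  by (intro eq_matI) (auto simp: unflatten_def index_less_square)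

lemma mat_linear_matrix_mult:
  assumes L: "mat_linear n L" and A: "A \<in> carrier_mat n n"
  shows "mat_linear_matrix n L *\<^sub>v flatten n A = flatten n (L A)"
proof (intro eq_vecI)
  fix e assume "e < dim_vec (flatten n (L A))"
  then have e: "e < n * n" by (simp add: flatten_def)
  have "(mat_linear_matrix n L *\<^sub>v flatten n A) $ e
      = (\<Sum>f<n * n. L (mat_unit n f) $$ (e div n, e mod n) * A $$ (f div n, f mod n))"
    using e by (simp add: mat_linear_matrix_def flatten_def scalar_prod_def lessThan_atLeast0)
  also have "\<dots> = L A $$ (e div n, e mod n)"
    using mat_linear_entry[OF L A index_div_less[OF e] index_mod_less[OF e]] by (simp add: mult.commute)
  finally show "(mat_linear_matrix n L *\<^sub>v flatten n A) $ e = flatten n (L A) $ e"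
    using e by (simp add: flatten_def)
qed (simp add: mat_linear_matrix_def flatten_def)

lemma smult_one_mat_mult_vec:
  "v \<in> carrier_vec m \<Longrightarrow> (c \<cdot>\<^sub>m 1\<^sub>m m) *\<^sub>v v = (c :: 'k :: comm_ring_1) \<cdot>\<^sub>v v"
  by (intro eq_vecI) (auto simp: row_smult)

lemma cramer_solution_of_image:
  assumes L: "mat_linear n L" and A: "A \<in> carrier_mat n n"
  shows "cramer_solution n L (L A) = mat_linear_det n L \<cdot>\<^sub>m A"
proof -
  let ?M = "mat_linear_matrix n L"
  have "adj_mat ?M *\<^sub>v flatten n (L A) = adj_mat ?M *\<^sub>v (?M *\<^sub>v flatten n A)"
    by (simp add: mat_linear_matrix_mult[OF L A])
  also have "\<dots> = (adj_mat ?M * ?M) *\<^sub>v flatten n A"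
    by (rule assoc_mult_mat_vec[symmetric, OF adj_mat(1)[OF mat_linear_matrix_carrier]
        mat_linear_matrix_carrier flatten_carrier])
  also have "\<dots> = mat_linear_det n L \<cdot>\<^sub>v flatten n A"
    unfolding adj_mat(3)[OF mat_linear_matrix_carrier] mat_linear_det_def
    by (rule smult_one_mat_mult_vec[OF flatten_carrier])
  finally show ?thesis
    by (simp add: cramer_solution_def unflatten_smult unflatten_flatten[OF A])
qed

lemma mat_linear_cramer_solution:
  assumes L: "mat_linear n L" and B: "B \<in> carrier_mat n n"
  shows "L (cramer_solution n L B) = mat_linear_det n L \<cdot>\<^sub>m B"
proof -
  let ?M = "mat_linear_matrix n L"
  let ?v = "adj_mat ?M *\<^sub>v flatten n B"
  have v: "?v \<in> carrier_vec (n * n)"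
    by (rule mult_mat_vec_carrier[OF adj_mat(1)]) auto
  have "flatten n (L (cramer_solution n L B)) = ?M *\<^sub>v ?v"
    using mat_linear_matrix_mult[OF L, of "cramer_solution n L B"]
    by (simp add: cramer_solution_def flatten_unflatten[OF v])
  also have "\<dots> = (?M * adj_mat ?M) *\<^sub>v flatten n B"
    by (rule assoc_mult_mat_vec[symmetric, OF mat_linear_matrix_carrier
        adj_mat(1)[OF mat_linear_matrix_carrier] flatten_carrier])
  also have "\<dots> = mat_linear_det n L \<cdot>\<^sub>v flatten n B"
    unfolding adj_mat(2)[OF mat_linear_matrix_carrier] mat_linear_det_def
    by (rule smult_one_mat_mult_vec[OF flatten_carrier])
  finally have "unflatten n (flatten n (L (cramer_solution n L B)))
      = unflatten n (mat_linear_det n L \<cdot>\<^sub>v flatten n B)" by (rule arg_cong)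
  then show ?thesis
    using mat_linearD(1)[OF L] B by (simp add: unflatten_flatten unflatten_smult)
qed

lemma mat_linear_injective_imp_surjective:
  assumes L: "mat_linear n L" and B: "B \<in> carrier_mat n n"
    and inj: "\<And>A. A \<in> carrier_mat n n \<Longrightarrow> L A = 0\<^sub>m n n \<Longrightarrow> A = 0\<^sub>m n n"
  obtains A where "A \<in> carrier_mat n n" "L A = B"
proof
  have "mat_linear_det n L \<noteq> 0"
  proof
    assume "mat_linear_det n L = 0"
    then obtain v where v: "v \<in> carrier_vec (n * n)" "v \<noteq> 0\<^sub>v (n * n)"
      "mat_linear_matrix n L *\<^sub>v v = 0\<^sub>v (n * n)"
      unfolding mat_linear_det_def
      using det_0_iff_vec_prod_zero[OF mat_linear_matrix_carrier] by blast
    have "flatten n (L (unflatten n v)) = 0\<^sub>v (n * n)"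
      using mat_linear_matrix_mult[OF L, of "unflatten n v"] v by (simp add: flatten_unflatten)
    then have "unflatten n (flatten n (L (unflatten n v))) = unflatten n (0\<^sub>v (n * n))" by simp
    then have "L (unflatten n v) = 0\<^sub>m n n"
      by (auto simp: unflatten_flatten mat_linearD(1)[OF L] unflatten_def[of _ "0\<^sub>v _"] index_less_square
          intro!: eq_matI)
    then have "unflatten n v = 0\<^sub>m n n" by (rule inj[OF unflatten_carrier])
    then have "v = flatten n (0\<^sub>m n n)" using flatten_unflatten[OF v(1)] by simp
    also have "\<dots> = 0\<^sub>v (n * n)"
      by (intro eq_vecI) (auto simp: flatten_def index_div_less index_mod_less)
    finally have "v = 0\<^sub>v (n * n)" .
    then show False using v(2) by simp
  qed
  then show "L (inverse (mat_linear_det n L) \<cdot>\<^sub>m cramer_solution n L B) = B"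
    using mat_linear_cramer_solution[OF L B] mat_linearD(3)[OF L] B by (auto intro!: eq_matI)
qed simp

lemma mat_linear_det_id:
  assumes "\<And>A. A \<in> carrier_mat n n \<Longrightarrow> L A = A"
  shows "mat_linear_det n L = 1"
proof -
  have "mat_linear_matrix n L = 1\<^sub>m (n * n)"
    by (intro eq_matI)
       (auto simp: mat_linear_matrix_def assms mat_unit_def index_div_less index_mod_less)
  then show ?thesis by (simp add: mat_linear_det_def)
qed

lemma mat_linear_matrix_over:
  assumes "\<And>e. (\<lambda>w. L w (mat_unit n e)) \<in> mat_over R n n"
  shows "(\<lambda>w. mat_linear_matrix n (L w)) \<in> mat_over R (n * n) (n * n)"
  unfolding mat_linear_matrix_def
  by (rule mat_over_mat) (auto intro!: mat_overD(2)[OF assms] index_div_less index_mod_less)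

lemma mat_linear_det_over:
  assumes "fun_algebra R" "\<And>e. (\<lambda>w. L w (mat_unit n e)) \<in> mat_over R n n"
  shows "(\<lambda>w. mat_linear_det n (L w)) \<in> R"
  unfolding mat_linear_det_def by (rule mat_over_det[OF assms(1)], rule mat_linear_matrix_over, rule assms(2))

lemma cramer_solution_over:
  assumes R: "fun_algebra R" and "\<And>e. (\<lambda>w. L w (mat_unit n e)) \<in> mat_over R n n"
  shows "(\<lambda>w. cramer_solution n (L w) B) \<in> mat_over R n n"
proof (rule mat_overI)
  fix i j assume ij: "i < n" "j < n"
  have adj: "(\<lambda>w. adj_mat (mat_linear_matrix n (L w))) \<in> mat_over R (n * n) (n * n)"
    by (intro mat_over_adj[OF R] mat_linear_matrix_over assms)
  have eq: "cramer_solution n (L w) B $$ (i, j) = (\<Sum>f<n * n.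
      adj_mat (mat_linear_matrix n (L w)) $$ (i * n + j, f) * B $$ (f div n, f mod n))" for w
    using ij mat_over_dim[OF adj, of w] index_less_square[OF ij]
    by (simp add: cramer_solution_def unflatten_def flatten_def scalar_prod_def lessThan_atLeast0)
  have "(\<lambda>w. \<Sum>f<n * n.
      adj_mat (mat_linear_matrix n (L w)) $$ (i * n + j, f) * B $$ (f div n, f mod n)) \<in> R"
    by (intro fun_algebra_sum[OF R] fun_algebraD[OF R] mat_overD(2)[OF adj] index_less_square ij) auto
  then show "(\<lambda>w. cramer_solution n (L w) B $$ (i, j)) \<in> R" unfolding eq .
qed simp

text \<open>Linear maps between vector spaces split.  The use of \<open>Q\<close> is that \<open>1 - Q \<circ> D\<close> is a projection
  onto the kernel of \<open>D\<close>.\<close>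

lemma mat_linear_generalised_inverse:
  fixes D :: "'k :: field mat \<Rightarrow> 'k mat"
  assumes D: "mat_linear n D"
  obtains Q where "mat_linear n Q" "\<And>A. A \<in> carrier_mat n n \<Longrightarrow> D (Q (D A)) = D A"
proof -
  define s where "s c f = (\<lambda>x. c * f x)" for c :: 'k and f :: "nat \<times> nat \<Rightarrow> 'k"
  \<comment> \<open>Matrices of a fixed size do not form a type, so the splitting is done for functions on index pairs.\<close>
  interpret V: vector_space s
    by unfold_locales (auto simp: s_def fun_eq_iff algebra_simps)
  interpret VV: vector_space_pair s s ..
  define F where "F u x = (if fst x < n \<and> snd x < n then D (mat n n u) $$ x else 0)" for u :: "nat \<times> nat \<Rightarrow> 'k" and x
  have add: "mat n n (\<lambda>x. u x + v x) = mat n n u + mat n n v" for u v :: "nat \<times> nat \<Rightarrow> 'k"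
    by (intro eq_matI) auto
  have smult: "mat n n (\<lambda>x. c * u x) = c \<cdot>\<^sub>m mat n n u" for c and u :: "nat \<times> nat \<Rightarrow> 'k"
    by (intro eq_matI) auto
  have carr: "D (mat n n u) \<in> carrier_mat n n" for u using mat_linearD(1)[OF D] by simp
  have lin: "Vector_Spaces.linear s s F"
  proof unfold_locales
    show "F (u + v) = F u + F v" for u v
    proof
      fix x show "F (u + v) x = (F u + F v) x"
        using carr[of u] carr[of v] mat_linearD(2)[OF D, of "mat n n u" "mat n n v"]
        by (cases x) (auto simp: F_def plus_fun_def add)
    qed
    show "F (s c u) = s c (F u)" for c u
    proof
      fix x show "F (s c u) x = s c (F u) x"
        using carr[of u] mat_linearD(3)[OF D, of "mat n n u" c]
        by (cases x) (auto simp: F_def s_def smult)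
    qed
  qed
  obtain g where "g ` UNIV \<subseteq> UNIV \<and> Vector_Spaces.linear s s g \<and> (\<forall>v\<in>F ` UNIV. F (g v) = v)"
    using VV.linear_exists_right_inverse_on[OF lin V.subspace_UNIV] by (elim exE)
  then have g: "Vector_Spaces.linear s s g" "\<And>v. v \<in> range F \<Longrightarrow> F (g v) = v" by auto
  interpret g: Vector_Spaces.linear s s g by (rule g(1))
  define E where "E A x = (if fst x < n \<and> snd x < n then A $$ x else 0)" for A :: "'k mat" and x
  define Q where "Q A = mat n n (g (E A))" for A
  have E_add: "E (A + B) = E A + E B" if "A \<in> carrier_mat n n" "B \<in> carrier_mat n n" for A B
    using that by (auto simp: E_def fun_eq_iff)
  have E_smult: "E (c \<cdot>\<^sub>m A) = s c (E A)" if "A \<in> carrier_mat n n" for A c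
    using that by (auto simp: E_def fun_eq_iff s_def)
  have E_mat: "mat n n (E A) = A" if "A \<in> carrier_mat n n" for A
    using that by (intro eq_matI) (auto simp: E_def)
  have "mat_linear n Q"
    unfolding mat_linear_def
  proof (intro conjI ballI allI)
    show "Q A \<in> carrier_mat n n" for A by (simp add: Q_def)
    show "Q (A + B) = Q A + Q B" if "A \<in> carrier_mat n n" "B \<in> carrier_mat n n" for A B
      unfolding Q_def E_add[OF that] g.add by (simp add: plus_fun_def add)
    show "Q (c \<cdot>\<^sub>m A) = c \<cdot>\<^sub>m Q A" if "A \<in> carrier_mat n n" for c A
      unfolding Q_def E_smult[OF that] g.scale by (simp add: s_def smult)
  qed
  moreover have "D (Q (D A)) = D A" if A: "A \<in> carrier_mat n n" for A
  proof -
    have "E (D A) = F (E A)" 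
      by (rule ext) (unfold F_def E_mat[OF A] E_def[of "D A"], rule refl)
    then have eq: "F (g (E (D A))) = E (D A)" using g(2) by auto
    have "D (Q (D A)) = mat n n (F (g (E (D A))))"
      using carr[of "g (E (D A))"] by (intro eq_matI) (auto simp: F_def Q_def)
    also have "\<dots> = D A" unfolding eq by (rule E_mat[OF mat_linearD(1)[OF D A]])
    finally show ?thesis .
  qed
  ultimately show ?thesis by (rule that)
qed


lemma mat_linear_mult_left:
  assumes "M \<in> carrier_mat n n"
  shows "mat_linear n (\<lambda>A. M * A)"
  unfolding mat_linear_def
  using assms by (auto intro: mult_add_distrib_mat mult_smult_distrib)

lemma mat_linear_mult_right:
  assumes "M \<in> carrier_mat n n"
  shows "mat_linear n (\<lambda>A. A * M)"
  unfolding mat_linear_def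
  using assms by (auto intro: add_mult_distrib_mat mult_smult_assoc_mat)

lemma mat_linear_id: "mat_linear n (\<lambda>A. A)"
  by (auto simp: mat_linear_def)

lemma mat_linear_plus:
  assumes F: "mat_linear n F" and G: "mat_linear n G"
  shows "mat_linear n (\<lambda>A. F A + G A)"
  unfolding mat_linear_def
proof (intro conjI ballI allI)
  fix A :: "'a mat" assume A: "A \<in> carrier_mat n n"
  note cA = mat_linearD(1)[OF F A] mat_linearD(1)[OF G A]
  show "F A + G A \<in> carrier_mat n n" using cA by simp
  show "F (c \<cdot>\<^sub>m A) + G (c \<cdot>\<^sub>m A) = c \<cdot>\<^sub>m (F A + G A)" for c
    unfolding mat_linearD(3)[OF F A] mat_linearD(3)[OF G A]
    using cA by (simp add: add_smult_distrib_left_mat)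
  fix B :: "'a mat" assume B: "B \<in> carrier_mat n n"
  note cB = mat_linearD(1)[OF F B] mat_linearD(1)[OF G B]
  show "F (A + B) + G (A + B) = F A + G A + (F B + G B)"
    unfolding mat_linearD(2)[OF F A B] mat_linearD(2)[OF G A B]
    using cA cB by (intro eq_matI) auto
qed

lemma mat_linear_minus:
  assumes F: "mat_linear n F" and G: "mat_linear n G"
  shows "mat_linear n (\<lambda>A. F A - G A)"
  unfolding mat_linear_def
proof (intro conjI ballI allI)
  fix A :: "'a mat" assume A: "A \<in> carrier_mat n n"
  note cA = mat_linearD(1)[OF F A] mat_linearD(1)[OF G A]
  show "F A - G A \<in> carrier_mat n n" by (rule minus_carrier_mat[OF cA(2)])
  show "F (c \<cdot>\<^sub>m A) - G (c \<cdot>\<^sub>m A) = c \<cdot>\<^sub>m (F A - G A)" for c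
    unfolding mat_linearD(3)[OF F A] mat_linearD(3)[OF G A]
    using cA by (intro eq_matI) (auto simp: right_diff_distrib)
  fix B :: "'a mat" assume B: "B \<in> carrier_mat n n"
  note cB = mat_linearD(1)[OF F B] mat_linearD(1)[OF G B]
  show "F (A + B) - G (A + B) = F A - G A + (F B - G B)"
    unfolding mat_linearD(2)[OF F A B] mat_linearD(2)[OF G A B]
    using cA cB by (intro eq_matI) auto
qed

lemma mat_linear_compose:
  assumes "mat_linear n F" "mat_linear n G"
  shows "mat_linear n (\<lambda>A. F (G A))"
  using assms unfolding mat_linear_def by auto

section \<open>Conjugation\<close>

definition mat_inv :: "'k :: field mat \<Rightarrow> 'k mat" where
  "mat_inv g = inverse (det g) \<cdot>\<^sub>m adj_mat g"

lemma mat_inv: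
  assumes "g \<in> carrier_mat n n" "det g \<noteq> 0"
  shows "mat_inv g \<in> carrier_mat n n" "g * mat_inv g = 1\<^sub>m n" "mat_inv g * g = 1\<^sub>m n"
  using assms adj_mat[OF assms(1)]
  by (auto simp: mat_inv_def mult_smult_distrib mult_smult_assoc_mat intro!: eq_matI)

lemma mat_mult_cancel_left:
  fixes P R A :: "'k :: comm_ring_1 mat"
  assumes c: "P \<in> carrier_mat n n" "R \<in> carrier_mat n n" "A \<in> carrier_mat n n"
    and inv: "R * P = 1\<^sub>m n"
  shows "R * (P * A) = A"
  using assoc_mult_mat[OF c(2,1,3)] inv c by simp

lemma conjugate_mult:
  fixes P R A B :: "'k :: comm_ring_1 mat"
  assumes c: "P \<in> carrier_mat n n" "R \<in> carrier_mat n n" "A \<in> carrier_mat n n" "B \<in> carrier_mat n n"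
    and inv: "R * P = 1\<^sub>m n"
  shows "(P * A * R) * (P * B * R) = P * (A * B) * R"
proof -
  have "(P * A * R) * (P * B * R) = P * A * (R * (P * B * R))"
    using c by (simp add: assoc_mult_mat[of _ n n _ n _ n])
  also have "R * (P * B * R) = (R * P) * B * R"
    using c by (simp add: assoc_mult_mat[of _ n n _ n _ n])
  also have "\<dots> = B * R" using c by (simp add: inv)
  finally show ?thesis using c by (simp add: assoc_mult_mat[of _ n n _ n _ n])
qed

lemma conjugate_diff:
  fixes P R A B :: "'k :: comm_ring_1 mat"
  assumes c: "P \<in> carrier_mat n n" "R \<in> carrier_mat n n" "A \<in> carrier_mat n n" "B \<in> carrier_mat n n"
  shows "P * (A - B) * R = P * A * R - P * B * R"
  using c by (simp add: mult_minus_distrib_mat[of _ n n _ n] minus_mult_distrib_mat[of _ n n _ _ n])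

lemma conjugate_cancel:
  fixes P R A :: "'k :: comm_ring_1 mat"
  assumes c: "P \<in> carrier_mat n n" "R \<in> carrier_mat n n" "A \<in> carrier_mat n n"
    and inv: "P * R = 1\<^sub>m n"
  shows "P * (R * A * P) * R = A"
proof -
  have "P * (R * A * P) * R = (P * R) * A * (P * R)"
    using c by (simp add: assoc_mult_mat[of _ n n _ n _ n])
  then show ?thesis using c by (simp add: inv)
qed


section \<open>The representations with \<open>Y\<close> in a fixed conjugacy class\<close>

lemma rep_variety_iff:
  "(X, Y) \<in> rep_variety n \<longleftrightarrow> X \<in> carrier_mat n n \<and> Y \<in> carrier_mat n n \<and> X * Y - Y * X = Y * Y"
  by (simp add: rep_variety_def)

lemma rep_variety_subset_mat_pairs: "rep_variety n \<subseteq> mat_pairs n"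
  by (auto simp: rep_variety_def mat_pairs_def)

lemma mat_minus_eq_zero_iff:
  fixes A B :: "'a :: ab_group_add mat"
  assumes "A \<in> carrier_mat m n" "B \<in> carrier_mat m n"
  shows "A - B = 0\<^sub>m m n \<longleftrightarrow> A = B"
proof
  assume "A - B = 0\<^sub>m m n"
  then have "(A - B) $$ (i, j) = 0" if "i < m" "j < n" for i j using that by simp
  then show "A = B" using assms by (intro eq_matI) auto
qed (use assms in auto)

lemma mat_minus_eq_self_iff:
  fixes A B :: "'a :: ab_group_add mat"
  assumes "A \<in> carrier_mat m n" "B \<in> carrier_mat m n"
  shows "A - B = A \<longleftrightarrow> B = 0\<^sub>m m n"
proof
  assume *: "A - B = A"
  have "A $$ (i, j) - B $$ (i, j) = A $$ (i, j)" if "i < m" "j < n" for i j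
    using arg_cong[OF *, of "\<lambda>A. A $$ (i, j)"] that assms by simp
  then show "B = 0\<^sub>m m n" using assms by (intro eq_matI) auto
qed (use assms in \<open>auto intro!: eq_matI\<close>)

lemma mat_add_minus_add:
  fixes A B C E :: "'a :: ab_group_add mat"
  assumes "A \<in> carrier_mat m n" "B \<in> carrier_mat m n" "C \<in> carrier_mat m n" "E \<in> carrier_mat m n"
  shows "A + B - (C + E) = A - C - (E - B)"
  using assms by (intro eq_matI) auto

lemma mat_add_minus_cancel:
  fixes A B :: "'a :: ab_group_add mat"
  assumes "A \<in> carrier_mat m n" "B \<in> carrier_mat m n"
  shows "A + (B - A) = B"
  using assms by (intro eq_matI) auto

text \<open>One stratum is studied at a time.  For Jordan matrices \<open>N\<close> the solution \<open>X0\<close> of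
  \<open>[X, N] = N\<^sup>2\<close> is supplied by \<open>jordan_base\<close> below.\<close>

locale conjugacy_class =
  fixes n :: nat and N X0 :: "'k :: field_char_0 mat"
  assumes N [simp]: "N \<in> carrier_mat n n" and X0 [simp]: "X0 \<in> carrier_mat n n"
    and base: "X0 * N - N * X0 = N * N"
begin

abbreviation "M \<equiv> carrier_mat n n :: 'k mat set"

lemma M_closed [simp, intro]:
  assumes "A \<in> M" "B \<in> M"
  shows "A * B \<in> M" "A - B \<in> M" "A + B \<in> M"
  using assms by (auto intro: mult_carrier_mat minus_carrier_mat)

definition orbit :: "('k mat \<times> 'k mat) set" where
  "orbit = {(X, Y) \<in> rep_variety n. similar_mat Y N}"

definition ad :: "'k mat \<Rightarrow> 'k mat" where
  "ad A = N * A - A * N"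

definition param :: "'k mat \<Rightarrow> 'k mat \<Rightarrow> 'k mat \<times> 'k mat" where
  "param g c = (g * (X0 + c) * mat_inv g, g * N * mat_inv g)"

lemma ad_linear: "mat_linear n ad"
  unfolding ad_def by (intro mat_linear_minus mat_linear_mult_left mat_linear_mult_right N)

lemma ad_zero_iff: "c \<in> M \<Longrightarrow> ad c = 0\<^sub>m n n \<longleftrightarrow> N * c = c * N"
  unfolding ad_def by (rule mat_minus_eq_zero_iff) auto

text \<open>The condition \<open>[X, N] = N\<^sup>2\<close> is affine in \<open>X\<close> with linear part \<open>- ad\<close>.\<close>

lemma base_add:
  assumes c: "c \<in> M"
  shows "(X0 + c) * N - N * (X0 + c) = N * N \<longleftrightarrow> ad c = 0\<^sub>m n n"
proof -
  have "(X0 + c) * N - N * (X0 + c) = X0 * N + c * N - (N * X0 + N * c)"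
    using add_mult_distrib_mat[OF X0 c N] mult_add_distrib_mat[OF N X0 c] by simp
  also have "\<dots> = N * N - ad c"
    unfolding base[symmetric] ad_def by (rule mat_add_minus_add[of _ n n]) (use c in auto)
  finally show ?thesis
    using mat_minus_eq_self_iff[of "N * N" n n "ad c"] mat_linearD(1)[OF ad_linear c] by simp
qed

lemma param_in_orbit:
  assumes g: "g \<in> M" "det g \<noteq> 0" and c: "c \<in> M" "ad c = 0\<^sub>m n n"
  shows "param g c \<in> orbit"
proof -
  note h = mat_inv[OF g]
  have X: "X0 + c \<in> M" using c by simp
  let ?X = "g * (X0 + c) * mat_inv g" and ?Y = "g * N * mat_inv g"
  have "?X * ?Y - ?Y * ?X = g * ((X0 + c) * N) * mat_inv g - g * (N * (X0 + c)) * mat_inv g"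
    using conjugate_mult[OF g(1) h(1) X N h(3)] conjugate_mult[OF g(1) h(1) N X h(3)] by simp
  also have "\<dots> = g * ((X0 + c) * N - N * (X0 + c)) * mat_inv g"
    by (rule conjugate_diff[symmetric, OF g(1) h(1)]) (use X N in auto)
  also have "\<dots> = g * (N * N) * mat_inv g" using base_add[OF c(1)] c(2) by simp
  also have "\<dots> = ?Y * ?Y" using conjugate_mult[OF g(1) h(1) N N h(3)] by simp
  finally have "(?X, ?Y) \<in> rep_variety n"
    using g h X N unfolding rep_variety_iff by (meson mult_carrier_mat)
  moreover have "similar_mat ?Y N"
    by (rule similar_matI[of _ _ g "mat_inv g" n]) (use g h N in auto)
  ultimately show ?thesis by (simp add: orbit_def param_def)
qed

text \<open>Conjugating \<open>X\<close> back by \<open>g\<close> gives a solution of \<open>[X, N] = N\<^sup>2\<close>, which is \<open>X0 + c\<close>.  The matrix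
  \<open>g\<close> is prescribed here, so that a normalised intertwiner can be used later.\<close>

lemma orbit_obtain_commuting:
  assumes XY: "(X, Y) \<in> rep_variety n" and g: "g \<in> M" "det g \<noteq> 0" and Y: "Y * g = g * N"
  obtains c where "c \<in> M" "ad c = 0\<^sub>m n n" "(X, Y) = param g c" "X * g = g * (X0 + c)"
proof
  note h = mat_inv[OF g]
  have X: "X \<in> M" "Y \<in> M" "X * Y - Y * X = Y * Y" using XY by (auto simp: rep_variety_iff)
  define c where "c = mat_inv g * X * g - X0"
  have xm: "mat_inv g * X * g \<in> M" using g h X by (meson mult_carrier_mat)
  show c: "c \<in> M" unfolding c_def by (rule minus_carrier_mat[OF X0])
  have X0c: "X0 + c = mat_inv g * X * g" unfolding c_def by (rule mat_add_minus_cancel[OF X0 xm])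
  have Y': "Y = g * N * mat_inv g"
    using g h X by (simp add: Y[symmetric] assoc_mult_mat[of _ n n _ n _ n])
  have N': "N = mat_inv g * Y * g"
    using g h X by (simp add: Y assoc_mult_mat[of _ n n _ n _ n] mat_mult_cancel_left[of g n "mat_inv g"])
  have "(X0 + c) * N - N * (X0 + c)
      = mat_inv g * (X * Y) * g - mat_inv g * (Y * X) * g"
    unfolding X0c
    using conjugate_mult[OF h(1) g(1) X(1,2) h(2)] conjugate_mult[OF h(1) g(1) X(2,1) h(2)]
    by (simp add: N'[symmetric])
  also have "\<dots> = mat_inv g * (Y * Y) * g"
    using conjugate_diff[OF h(1) g(1), of "X * Y" "Y * X"] X by simp
  also have "\<dots> = N * N" using conjugate_mult[OF h(1) g(1) X(2,2) h(2)] by (simp add: N'[symmetric])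
  finally show "ad c = 0\<^sub>m n n" using base_add[OF c] by simp
  show "(X, Y) = param g c"
    unfolding param_def X0c using conjugate_cancel[OF g(1) h(1) X(1) h(2)] Y' by simp
  show "X * g = g * (X0 + c)"
    unfolding X0c using g h X
    by (simp add: assoc_mult_mat[of _ n n _ n _ n] mat_mult_cancel_left[of "mat_inv g" n g])
qed

lemma orbitE:
  assumes "p \<in> orbit"
  obtains g c where "g \<in> M" "det g \<noteq> 0" "c \<in> M" "ad c = 0\<^sub>m n n" "p = param g c"
    "snd p * g = g * N"
proof -
  obtain X Y where p: "p = (X, Y)" "(X, Y) \<in> rep_variety n" "similar_mat Y N"
    using assms by (auto simp: orbit_def)
  obtain m g h where gh: "{Y, N, g, h} \<subseteq> carrier_mat m m" "g * h = 1\<^sub>m m" "h * g = 1\<^sub>m m" "Y = g * N * h"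
    using similar_matD[OF p(3)] by blast
  have "m = n" using gh(1) carrier_matD(1)[OF N] by auto
  then have g: "g \<in> M" "h \<in> M" "Y \<in> M" "g * h = 1\<^sub>m n" "h * g = 1\<^sub>m n" "Y = g * N * h"
    using gh by auto
  have "det g * det h = 1" using det_mult[OF g(1,2)] g(4) by simp
  then have dg: "det g \<noteq> 0" by auto
  have Yg: "Y * g = g * N" unfolding g(6) using g(1,2,5) by (simp add: right_mult_one_mat[OF N] assoc_mult_mat[of _ n n _ n _ n])
  obtain c where "c \<in> M" "ad c = 0\<^sub>m n n" "(X, Y) = param g c"
    using orbit_obtain_commuting[OF p(2) g(1) dg Yg] .
  then show ?thesis using that[OF g(1) dg, of c] Yg unfolding p(1) by (metis snd_conv)
qed

lemma orbitI:
  assumes "(X, Y) \<in> rep_variety n" "g \<in> M" "det g \<noteq> 0" "Y * g = g * N"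
  shows "(X, Y) \<in> orbit"
proof -
  obtain c where "c \<in> M" "ad c = 0\<^sub>m n n" "(X, Y) = param g c"
    using orbit_obtain_commuting[OF assms] .
  then show ?thesis using param_in_orbit[OF assms(2,3), of c] by simp
qed

lemma param_entries:
  assumes R: "fun_algebra R" and g: "g \<in> mat_over R n n" and c: "c \<in> mat_over R n n"
    and ij: "i < n" "j < n"
  shows "\<exists>u\<in>R. \<forall>w. det (g w) \<noteq> 0 \<longrightarrow> fst (param (g w) (c w)) $$ (i, j) * det (g w) = u w"
    and "\<exists>u\<in>R. \<forall>w. det (g w) \<noteq> 0 \<longrightarrow> snd (param (g w) (c w)) $$ (i, j) * det (g w) = u w"
proof -
  have *: "\<exists>u\<in>R. \<forall>w. det (g w) \<noteq> 0 \<longrightarrow> (g w * A w * mat_inv (g w)) $$ (i, j) * det (g w) = u w"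
    if A: "A \<in> mat_over R n n" for A
  proof (rule bexI)
    have GA: "(\<lambda>w. g w * A w) \<in> mat_over R n n" by (rule mat_over_mult[OF R g A])
    show "(\<lambda>w. (g w * A w * adj_mat (g w)) $$ (i, j)) \<in> R"
      by (rule mat_overD(2)[OF mat_over_mult[OF R GA mat_over_adj[OF R g]] ij])
    show "\<forall>w. det (g w) \<noteq> 0 \<longrightarrow> (g w * A w * mat_inv (g w)) $$ (i, j) * det (g w)
        = (g w * A w * adj_mat (g w)) $$ (i, j)"
    proof (intro allI impI)
      fix w assume "det (g w) \<noteq> 0"
      have "adj_mat (g w) \<in> M" by (rule adj_mat(1)[OF mat_overD(1)[OF g]])
      then have "g w * A w * mat_inv (g w) = inverse (det (g w)) \<cdot>\<^sub>m (g w * A w * adj_mat (g w))"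
        unfolding mat_inv_def by (rule mult_smult_distrib[OF mat_overD(1)[OF GA]])
      moreover have "g w * A w * adj_mat (g w) \<in> M"
        using mat_overD(1)[OF mat_over_mult[OF R GA mat_over_adj[OF R g]]] .
      then have "(inverse (det (g w)) \<cdot>\<^sub>m (g w * A w * adj_mat (g w))) $$ (i, j)
          = inverse (det (g w)) * (g w * A w * adj_mat (g w)) $$ (i, j)"
        by (intro index_smult_mat(1)) (use ij carrier_matD in blast)+
      ultimately show "(g w * A w * mat_inv (g w)) $$ (i, j) * det (g w)
        = (g w * A w * adj_mat (g w)) $$ (i, j)" using \<open>det (g w) \<noteq> 0\<close> by (simp only:) simp
    qed
  qed
  show "\<exists>u\<in>R. \<forall>w. det (g w) \<noteq> 0 \<longrightarrow> fst (param (g w) (c w)) $$ (i, j) * det (g w) = u w"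
    unfolding param_def fst_conv by (rule *) (intro mat_over_add[OF R] mat_over_const[OF R] X0 c)
  show "\<exists>u\<in>R. \<forall>w. det (g w) \<noteq> 0 \<longrightarrow> snd (param (g w) (c w)) $$ (i, j) * det (g w) = u w"
    unfolding param_def snd_conv by (rule *) (intro mat_over_const[OF R] N)
qed

text \<open>The line joining two parameters is mapped to a rational curve with denominator \<open>det g\<close>.  The
  set \<open>T\<close> is kept general because both the orbit and its subsets cut out by a flag are such
  images.\<close>

lemma poly_domain_param_image:
  assumes ne: "S \<noteq> {}"
    and S: "\<And>p. p \<in> S \<longleftrightarrow> (\<exists>g c. (g, c) \<in> T \<and> det g \<noteq> 0 \<and> p = param g c)"
    and T: "\<And>g c. (g, c) \<in> T \<Longrightarrow> g \<in> M \<and> c \<in> M"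
    and line: "\<And>g c g' c' t. (g, c) \<in> T \<Longrightarrow> (g', c') \<in> T
      \<Longrightarrow> (g + t \<cdot>\<^sub>m (g' - g), c + t \<cdot>\<^sub>m (c' - c)) \<in> T"
  shows "poly_domain n S"
proof (rule poly_domain_if_rational_curves[OF ne])
  show "S \<subseteq> mat_pairs n"
  proof
    fix p assume "p \<in> S"
    then obtain g c where gc: "g \<in> M" "c \<in> M" "det g \<noteq> 0" "p = param g c" using S T by blast
    then show "p \<in> mat_pairs n"
      using mat_inv(1)[OF gc(1,3)] N X0 by (auto simp: param_def mat_pairs_def)
  qed
  fix p q assume "p \<in> S" "q \<in> S"
  then obtain g c g' c' where p: "(g, c) \<in> T" "det g \<noteq> 0" "p = param g c"
    and q: "(g', c') \<in> T" "det g' \<noteq> 0" "q = param g' c'" using S by blast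
  note C = T[OF p(1)] T[OF q(1)]
  define G where "G t = g + t \<cdot>\<^sub>m (g' - g)" for t
  define K where "K t = c + t \<cdot>\<^sub>m (c' - c)" for t
  note R = fun_algebra_poly[where 'k = 'k]
  have lin: "(\<lambda>t. A + t \<cdot>\<^sub>m B) \<in> mat_over (range poly) n n" if "A \<in> M" "B \<in> M" for A B
  proof (intro mat_over_add[OF R] mat_over_smult[OF R] mat_over_const[OF R] that)
    show "(\<lambda>t. t) \<in> range (poly :: 'k poly \<Rightarrow> _)" by (rule image_eqI[of _ _ "[:0, 1:]"]) auto
  qed
  have G: "G \<in> mat_over (range poly) n n" and K: "K \<in> mat_over (range poly) n n"
    unfolding G_def[abs_def] K_def[abs_def] using C minus_carrier_mat by (auto intro!: lin)
  have G01: "G 0 = g" "G 1 = g'" "K 0 = c" "K 1 = c'"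
    using C by (auto simp: G_def K_def intro!: eq_matI)
  have "param (G t) (K t) \<in> S" if "det (G t) \<noteq> 0" for t
    unfolding S using line[OF p(1) q(1), of t] that unfolding G_def K_def by blast
  then show "\<exists>\<gamma> h. h \<in> range poly \<and> \<gamma> (0::'k) = p \<and> \<gamma> 1 = q
       \<and> h 0 \<noteq> 0 \<and> h 1 \<noteq> 0 \<and> (\<forall>t. h t \<noteq> 0 \<longrightarrow> \<gamma> t \<in> S)
       \<and> (\<forall>i<n. \<forall>j<n. (\<exists>u\<in>range poly. \<forall>t. h t \<noteq> 0 \<longrightarrow> fst (\<gamma> t) $$ (i, j) * h t = u t)
            \<and> (\<exists>u\<in>range poly. \<forall>t. h t \<noteq> 0 \<longrightarrow> snd (\<gamma> t) $$ (i, j) * h t = u t))"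
    using mat_over_det[OF R G] p q param_entries[OF R G K]
    by (intro exI[of _ "\<lambda>t. param (G t) (K t)"] exI[of _ "\<lambda>t. det (G t)"]) (simp add: G01)
qed

lemma ad_one: "ad (1\<^sub>m n) = 0\<^sub>m n n"
  by (simp add: ad_zero_iff left_mult_one_mat[OF N] right_mult_one_mat[OF N])

lemma ad_zero: "ad (0\<^sub>m n n) = 0\<^sub>m n n"
  by (rule mat_linear_zero[OF ad_linear])

lemma base_point_in_orbit: "(X0, N) \<in> orbit"
  unfolding orbit_def using similar_mat_refl[OF N] base N X0 by (simp add: rep_variety_iff)

lemma poly_domain_orbit: "poly_domain n orbit"
proof (rule poly_domain_param_image)
  let ?T = "{(g, c). g \<in> M \<and> c \<in> M \<and> ad c = 0\<^sub>m n n}"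
  show "orbit \<noteq> {}" using base_point_in_orbit by blast
  show "p \<in> orbit \<longleftrightarrow> (\<exists>g c. (g, c) \<in> ?T \<and> det g \<noteq> 0 \<and> p = param g c)" for p
  proof
    assume "p \<in> orbit"
    then show "\<exists>g c. (g, c) \<in> ?T \<and> det g \<noteq> 0 \<and> p = param g c" by (rule orbitE) blast
  qed (use param_in_orbit in blast)
  show "g \<in> M \<and> c \<in> M" if "(g, c) \<in> ?T" for g c using that by simp
  show "(g + t \<cdot>\<^sub>m (g' - g), c + t \<cdot>\<^sub>m (c' - c)) \<in> ?T" if "(g, c) \<in> ?T" "(g', c') \<in> ?T" for g c g' c' t
  proof -
    have C: "g \<in> M" "c \<in> M" "ad c = 0\<^sub>m n n" "g' \<in> M" "c' \<in> M" "ad c' = 0\<^sub>m n n" using that by auto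
    have D: "c' - c \<in> M" "g' - g \<in> M" using C minus_carrier_mat by auto
    have "ad (c + t \<cdot>\<^sub>m (c' - c)) = 0\<^sub>m n n + t \<cdot>\<^sub>m (0\<^sub>m n n - 0\<^sub>m n n)"
      using mat_linearD(2)[OF ad_linear C(2), of "t \<cdot>\<^sub>m (c' - c)"] mat_linearD(3)[OF ad_linear D(1), of t]
        mat_linear_diff[OF ad_linear C(5,2)] C D by simp
    also have "\<dots> = 0\<^sub>m n n" by (intro eq_matI) auto
    finally show ?thesis using C D by simp
  qed
qed

end


section \<open>A rational slice: coordinates on the orbit\<close>

text \<open>Polynomial functions are defined on all pairs of matrices, of whatever size; truncating to size
  \<open>n\<close> makes matrix-valued functions total.\<close>

definition square_part :: "nat \<Rightarrow> 'k mat \<Rightarrow> 'k mat" where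
  "square_part n A = mat n n (\<lambda>(i, j). A $$ (i, j))"

lemma square_part_carrier [simp]: "square_part n A \<in> carrier_mat n n"
  by (simp add: square_part_def)

lemma square_part_id: "A \<in> carrier_mat n n \<Longrightarrow> square_part n A = A"
  by (intro eq_matI) (auto simp: square_part_def)

lemma square_part_over_fst: "(\<lambda>p. square_part n (fst p)) \<in> mat_over (poly_funs n) n n"
  unfolding square_part_def by (rule mat_over_mat) (auto intro: poly_funs.intros)

lemma square_part_over_snd: "(\<lambda>p. square_part n (snd p)) \<in> mat_over (poly_funs n) n n"
  unfolding square_part_def by (rule mat_over_mat) (auto intro: poly_funs.intros)

lemma mat_group_identities:
  fixes A B C :: "'a :: ab_group_add mat"
  assumes "A \<in> carrier_mat m n" "B \<in> carrier_mat m n" "C \<in> carrier_mat m n"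
  shows "A + B - A + (C - B) = C" "A - B = 0\<^sub>m m n - (B - A)" "A + (0\<^sub>m m n - B) = A - B"
    "A + (B - C) - A = B - C"
  using assms by (auto intro!: eq_matI)

lemma mat_cancel_minus_add:
  fixes A B C E :: "'a :: ab_group_add mat"
  assumes "A \<in> carrier_mat m n" "B \<in> carrier_mat m n" "C \<in> carrier_mat m n" "E \<in> carrier_mat m n"
    and "A - E + B = C - E + B"
  shows "A = C"
proof (rule eq_matI)
  fix i j assume ij: "i < dim_row C" "j < dim_col C"
  have "(A - E + B) $$ (i, j) = (C - E + B) $$ (i, j)" by (simp only: assms(5))
  then have "A $$ (i, j) - E $$ (i, j) + B $$ (i, j) = C $$ (i, j) - E $$ (i, j) + B $$ (i, j)"
    using ij assms(1-4) by simp
  then show "A $$ (i, j) = C $$ (i, j)" by simp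
qed (use assms in auto)

lemma mat_rescaled_coordinates:
  fixes g c X :: "'a :: comm_ring_1 mat"
  assumes "g \<in> carrier_mat n n" "c \<in> carrier_mat n n" "X \<in> carrier_mat n n"
  shows "e \<cdot>\<^sub>m (d \<cdot>\<^sub>m g - d \<cdot>\<^sub>m 1\<^sub>m n) + d \<cdot>\<^sub>m (e \<cdot>\<^sub>m (X + c) - e \<cdot>\<^sub>m X)
    = (d * e) \<cdot>\<^sub>m (g - 1\<^sub>m n + c)"
  using assms by (intro eq_matI) (auto simp: algebra_simps)

context conjugacy_class
begin

definition Q :: "'k mat \<Rightarrow> 'k mat" where
  "Q = (SOME Q. mat_linear n Q \<and> (\<forall>A\<in>M. ad (Q (ad A)) = ad A))"

lemma Q: "mat_linear n Q" "A \<in> M \<Longrightarrow> ad (Q (ad A)) = ad A"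
proof -
  have "\<exists>Q. mat_linear n Q \<and> (\<forall>A\<in>M. ad (Q (ad A)) = ad A)"
    using mat_linear_generalised_inverse[OF ad_linear] by metis
  then have "mat_linear n Q \<and> (\<forall>A\<in>M. ad (Q (ad A)) = ad A)"
    unfolding Q_def by (rule someI_ex)
  then show "mat_linear n Q" "A \<in> M \<Longrightarrow> ad (Q (ad A)) = ad A" by auto
qed

definition proj :: "'k mat \<Rightarrow> 'k mat" where
  "proj A = A - Q (ad A)"

lemma proj_linear: "mat_linear n proj"
  unfolding proj_def by (intro mat_linear_minus mat_linear_id mat_linear_compose[OF Q(1) ad_linear])

lemma Q_carrier [simp]: "A \<in> M \<Longrightarrow> Q A \<in> M"
  by (rule mat_linearD(1)[OF Q(1)])

lemma ad_carrier [simp]: "A \<in> M \<Longrightarrow> ad A \<in> M"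
  by (rule mat_linearD(1)[OF ad_linear])

lemma proj_carrier [simp]: "A \<in> M \<Longrightarrow> proj A \<in> M"
  by (rule mat_linearD(1)[OF proj_linear])

lemma Q_zero: "Q (0\<^sub>m n n) = 0\<^sub>m n n"
  by (rule mat_linear_zero[OF Q(1)])

lemma ad_proj: "A \<in> M \<Longrightarrow> ad (proj A) = 0\<^sub>m n n"
  unfolding proj_def by (simp add: mat_linear_diff[OF ad_linear] Q(2) minus_r_inv_mat[of _ n n])

lemma proj_kernel: "A \<in> M \<Longrightarrow> ad A = 0\<^sub>m n n \<Longrightarrow> proj A = A"
  by (simp add: proj_def Q_zero) (intro eq_matI, auto)

lemma proj_proj: "A \<in> M \<Longrightarrow> proj (proj A) = proj A"
  by (simp add: proj_kernel ad_proj)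

lemma proj_Q_ad: "A \<in> M \<Longrightarrow> proj (Q (ad A)) = 0\<^sub>m n n"
  unfolding proj_def by (simp add: Q(2) minus_r_inv_mat[of _ n n])

lemma proj_one: "proj (1\<^sub>m n) = 1\<^sub>m n"
  by (rule proj_kernel) (simp_all add: ad_one)

text \<open>A matrix \<open>w\<close> is split into \<open>proj w\<close>, which serves as the parameter \<open>c\<close>, and \<open>Q (ad w)\<close> in a
  complement of the centraliser, which displaces the parameter \<open>g\<close> from \<open>1\<close>.  In this way \<open>n\<^sup>2\<close>
  parameters suffice.\<close>

definition frame :: "'k mat \<Rightarrow> 'k mat" where
  "frame w = 1\<^sub>m n + Q (ad w)"

definition slice_map :: "'k mat \<Rightarrow> 'k mat \<times> 'k mat" where
  "slice_map w = param (frame w) (proj w)"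

lemma frame_carrier [simp]: "w \<in> M \<Longrightarrow> frame w \<in> M"
  by (simp add: frame_def)

lemma proj_frame: "w \<in> M \<Longrightarrow> proj (frame w) = 1\<^sub>m n"
  unfolding frame_def
  by (simp add: mat_linearD(2)[OF proj_linear] proj_one proj_Q_ad)

lemma frame_proj: "w \<in> M \<Longrightarrow> frame w - 1\<^sub>m n + proj w = w"
  unfolding frame_def proj_def by (rule mat_group_identities(1)) simp_all

lemma slice_map_in_orbit: "w \<in> M \<Longrightarrow> det (frame w) \<noteq> 0 \<Longrightarrow> slice_map w \<in> orbit"
  unfolding slice_map_def by (rule param_in_orbit) (simp_all add: ad_proj)

text \<open>The linear equation for \<open>g\<close>: where \<open>Y g = g N\<close>, the matrix \<open>solve Y g\<close> is \<open>proj g\<close>,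
  so the normalised intertwiners are the solutions of \<open>solve Y g = 1\<close>.\<close>

definition solve :: "'k mat \<Rightarrow> 'k mat \<Rightarrow> 'k mat" where
  "solve Y A = A + Q ((Y - N) * A)"

lemma solve_linear: "Y \<in> M \<Longrightarrow> mat_linear n (solve Y)"
  unfolding solve_def
  by (intro mat_linear_plus mat_linear_id mat_linear_compose[OF Q(1)] mat_linear_mult_left) simp

lemma solve_intertwiner:
  assumes "Y \<in> M" "g \<in> M" "Y * g = g * N"
  shows "solve Y g = proj g"
proof -
  have "(Y - N) * g = g * N - N * g"
    using minus_mult_distrib_mat[OF assms(1) N assms(2)] assms(3) by simp
  also have "\<dots> = 0\<^sub>m n n - ad g"
    unfolding ad_def by (rule mat_group_identities(2)[of _ n n]) (use assms in simp_all)
  finally have "Q ((Y - N) * g) = 0\<^sub>m n n - Q (ad g)"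
    using mat_linear_diff[OF Q(1), of "0\<^sub>m n n" "ad g"] assms by (simp add: Q_zero)
  then show ?thesis unfolding solve_def proj_def
    using mat_group_identities(3)[of g n n "Q (ad g)" g] assms by simp
qed

definition delta :: "'k mat \<Rightarrow> 'k" where
  "delta Y = mat_linear_det n (solve Y)"

definition sol :: "'k mat \<Rightarrow> 'k mat" where
  "sol Y = cramer_solution n (solve Y) (1\<^sub>m n)"

lemma sol_carrier [simp]: "sol Y \<in> M"
  by (simp add: sol_def)

lemma sol_normalised:
  assumes "Y \<in> M" "g \<in> M" "Y * g = g * N" "proj g = 1\<^sub>m n"
  shows "sol Y = delta Y \<cdot>\<^sub>m g"
  using cramer_solution_of_image[OF solve_linear[OF assms(1)] assms(2)]
  by (simp add: sol_def delta_def solve_intertwiner[OF assms(1-3)] assms(4))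

lemma solve_over:
  "(\<lambda>p. solve (square_part n (snd p)) (mat_unit n e)) \<in> mat_over (poly_funs n) n n"
  unfolding solve_def
  by (intro mat_over_add mat_over_linear[OF _ Q(1)] mat_over_mult[of _ _ n n] mat_over_minus
      mat_over_const fun_algebra_poly_funs square_part_over_snd N mat_unit_carrier)

lemma sol_over: "(\<lambda>p. sol (square_part n (snd p))) \<in> mat_over (poly_funs n) n n"
  unfolding sol_def by (intro cramer_solution_over fun_algebra_poly_funs solve_over)

lemma delta_poly: "(\<lambda>p. delta (square_part n (snd p))) \<in> poly_funs n"
  unfolding delta_def by (intro mat_linear_det_over fun_algebra_poly_funs solve_over)

text \<open>Where this is nonzero, the linear system for the normalised intertwiner has a unique solution,
  and that solution is invertible.\<close>

definition good :: "'k mat \<times> 'k mat \<Rightarrow> 'k" where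
  "good p = (let Y = square_part n (snd p) in delta Y * det (sol Y))"

lemma good_eq: "Y \<in> M \<Longrightarrow> good (X, Y) = delta Y * det (sol Y)"
  by (simp add: good_def Let_def square_part_id)

lemma good_poly: "good \<in> poly_funs n"
  unfolding good_def[abs_def] Let_def
  by (intro poly_funs.mult delta_poly mat_over_det[OF fun_algebra_poly_funs sol_over])

lemma good_base: "good (X0, N) = 1"
proof -
  have d: "delta N = 1"
    unfolding delta_def
  proof (rule mat_linear_det_id)
    fix A :: "'k mat" assume "A \<in> M"
    then show "solve N A = A"
      by (simp add: solve_def minus_r_inv_mat[OF N] left_mult_zero_mat[of _ n n] Q_zero)
  qed
  have "sol N = delta N \<cdot>\<^sub>m 1\<^sub>m n"
    by (rule sol_normalised) (simp_all add: proj_one left_mult_one_mat[OF N] right_mult_one_mat[OF N])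
  then have "sol N = 1\<^sub>m n" using d by (auto intro!: eq_matI)
  then show ?thesis by (simp add: good_eq d)
qed

text \<open>With \<open>g = sol Y / delta Y\<close> and \<open>c = g\<^sup>-\<^sup>1 X g - X0\<close>, this is \<open>w = g - 1 + c\<close> cleared of
  denominators.\<close>

definition coord_mat :: "'k mat \<times> 'k mat \<Rightarrow> 'k mat" where
  "coord_mat p = (let X = square_part n (fst p); Y = square_part n (snd p); S = sol Y in
     det S \<cdot>\<^sub>m (S - delta Y \<cdot>\<^sub>m 1\<^sub>m n) + delta Y \<cdot>\<^sub>m (adj_mat S * X * S - det S \<cdot>\<^sub>m X0))"

lemma coord_mat_over: "coord_mat \<in> mat_over (poly_funs n) n n"
  unfolding coord_mat_def[abs_def] Let_def
  by (intro mat_over_add mat_over_smult mat_over_minus mat_over_mult[of _ _ n n] mat_over_adj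
      mat_over_const fun_algebra_poly_funs square_part_over_fst sol_over delta_poly
      mat_over_det[OF fun_algebra_poly_funs sol_over] one_carrier_mat X0)

lemma coord_mat_slice_map:
  assumes w: "w \<in> M" "det (frame w) \<noteq> 0"
  shows "coord_mat (slice_map w) = good (slice_map w) \<cdot>\<^sub>m w"
proof -
  define g where "g = frame w"
  define c where "c = proj w"
  obtain X Y where XY: "slice_map w = (X, Y)" by fastforce
  have g: "g \<in> M" "det g \<noteq> 0" and c: "c \<in> M" using w by (simp_all add: g_def c_def)
  note h = mat_inv[OF g]
  have X: "X = g * (X0 + c) * mat_inv g" and Y: "Y = g * N * mat_inv g"
    using XY by (auto simp: slice_map_def param_def g_def c_def)
  have XYM: "X \<in> M" "Y \<in> M" unfolding X Y using g h c by auto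
  have Yg: "Y * g = g * N"
    unfolding Y using g h by (simp add: assoc_mult_mat[of _ n n _ n _ n] right_mult_one_mat[OF N])
  have Xg: "X * g = g * (X0 + c)"
    unfolding X using g h c by (simp add: assoc_mult_mat[of _ n n _ n _ n] right_mult_one_mat[of "X0 + c" n n])
  define d where "d = delta Y"
  define S where "S = sol Y"
  have S: "S = d \<cdot>\<^sub>m g"
    unfolding S_def d_def using sol_normalised[OF XYM(2) g(1) Yg] proj_frame[OF w(1)] by (simp add: g_def)
  have SM: "S \<in> M" by (simp add: S_def)
  note adj = adj_mat[OF SM]
  have "X * S = S * (X0 + c)"
    unfolding S using g XYM c Xg
    by (simp add: mult_smult_distrib[of _ n n _ n] mult_smult_assoc_mat[of _ n n _ n])
  then have "adj_mat S * X * S = (adj_mat S * S) * (X0 + c)"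
    using adj(1) XYM SM c by (simp add: assoc_mult_mat[of _ n n _ n _ n])
  also have "\<dots> = det S \<cdot>\<^sub>m (X0 + c)"
    unfolding adj(3) using c mult_smult_assoc_mat[of "1\<^sub>m n" n n "X0 + c" n] by simp
  finally have "adj_mat S * X * S = det S \<cdot>\<^sub>m (X0 + c)" .
  then have "coord_mat (slice_map w)
      = det S \<cdot>\<^sub>m (d \<cdot>\<^sub>m g - d \<cdot>\<^sub>m 1\<^sub>m n) + d \<cdot>\<^sub>m (det S \<cdot>\<^sub>m (X0 + c) - det S \<cdot>\<^sub>m X0)"
    unfolding XY coord_mat_def Let_def fst_conv snd_conv square_part_id[OF XYM(1)] square_part_id[OF XYM(2)]
      S_def[symmetric] d_def[symmetric] by (simp only: S[symmetric])
  also have "\<dots> = (d * det S) \<cdot>\<^sub>m (g - 1\<^sub>m n + c)"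
    by (rule mat_rescaled_coordinates[OF g(1) c X0])
  also have "g - 1\<^sub>m n + c = w" unfolding g_def c_def by (rule frame_proj[OF w(1)])
  finally show ?thesis unfolding XY good_eq[OF XYM(2)] d_def S_def .
qed

text \<open>If \<open>Y g = g N\<close>, then \<open>solve Y (g c) = proj (g c)\<close> for \<open>c\<close> in the centraliser of \<open>N\<close>.  As
  \<open>solve Y\<close> is injective, so is \<open>c \<mapsto> proj (g c)\<close> on the centraliser; by equality of dimensions it
  takes the value \<open>1\<close>, and then \<open>g c\<close> is a normalised intertwiner.\<close>

lemma good_imp_slice:
  assumes p: "p \<in> orbit" and good: "good p \<noteq> 0"
  shows "\<exists>w\<in>M. det (frame w) \<noteq> 0 \<and> p = slice_map w"
proof -
  obtain X Y where XY: "p = (X, Y)" by fastforce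
  have rep: "(X, Y) \<in> rep_variety n" and XYM: "X \<in> M" "Y \<in> M"
    using p by (auto simp: orbit_def XY rep_variety_iff)
  obtain g where g: "g \<in> M" "det g \<noteq> 0" "Y * g = g * N"
    using p XY by (metis orbitE snd_conv)
  have d: "delta Y \<noteq> 0" "det (sol Y) \<noteq> 0" using good XYM by (auto simp: XY good_eq)
  have inj: "A = 0\<^sub>m n n" if A: "A \<in> M" "solve Y A = 0\<^sub>m n n" for A
  proof -
    have "delta Y \<cdot>\<^sub>m A = cramer_solution n (solve Y) (0\<^sub>m n n)"
      using cramer_solution_of_image[OF solve_linear[OF XYM(2)] A(1)] A(2) by (simp add: delta_def)
    also have "\<dots> = delta Y \<cdot>\<^sub>m 0\<^sub>m n n"
      using cramer_solution_of_image[OF solve_linear[OF XYM(2)], of "0\<^sub>m n n"]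
        mat_linear_zero[OF solve_linear[OF XYM(2)]] by (simp add: delta_def)
    finally have *: "delta Y \<cdot>\<^sub>m A = delta Y \<cdot>\<^sub>m 0\<^sub>m n n" .
    have "A $$ (i, j) = 0" if "i < n" "j < n" for i j
      using arg_cong[OF *, of "\<lambda>A. A $$ (i, j)"] that A(1) d(1) by simp
    then show ?thesis using A(1) by (intro eq_matI) auto
  qed
  have inter: "Y * (g * c) = (g * c) * N" if "c \<in> M" "ad c = 0\<^sub>m n n" for c
    using that g XYM by (simp add: ad_zero_iff assoc_mult_mat[of _ n n _ n _ n, symmetric])
      (simp add: assoc_mult_mat[of _ n n _ n _ n])
  \<comment> \<open>\<open>K\<close> extends \<open>c \<mapsto> proj (g c)\<close> by the identity on the complement of the centraliser.\<close>
  define K where "K c = proj (g * proj c) + (c - proj c)" for c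
  have K: "mat_linear n K"
    unfolding K_def
    by (intro mat_linear_plus mat_linear_minus mat_linear_id proj_linear
        mat_linear_compose[OF proj_linear mat_linear_compose[OF mat_linear_mult_left[OF g(1)] proj_linear]])
  have proj_diff: "proj (c - proj c) = 0\<^sub>m n n" if "c \<in> M" for c
    using that by (simp add: mat_linear_diff[OF proj_linear] proj_proj minus_r_inv_mat[of _ n n])
  have proj_K: "proj (K c) = proj (g * proj c)" if c: "c \<in> M" for c
    unfolding K_def
    using c g by (simp add: mat_linearD(2)[OF proj_linear] proj_proj proj_diff right_add_zero_mat[of _ n n])
  have diff_K: "K c - proj (K c) = c - proj c" if c: "c \<in> M" for c
    unfolding proj_K[OF c] unfolding K_def
    by (rule mat_group_identities(4)[of _ n n]) (use c g in simp_all)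
  have inj_K: "c = 0\<^sub>m n n" if c: "c \<in> M" "K c = 0\<^sub>m n n" for c
  proof -
    have "c - proj c = 0\<^sub>m n n"
      unfolding diff_K[OF c(1), symmetric] c(2) mat_linear_zero[OF proj_linear]
      by (rule minus_r_inv_mat) simp
    then have cp: "proj c = c" using mat_minus_eq_zero_iff[of c n n "proj c"] c(1) by simp
    then have c0: "ad c = 0\<^sub>m n n" using ad_proj[OF c(1)] by simp
    have "proj (g * c) = 0\<^sub>m n n"
      using proj_K[OF c(1)] unfolding c(2) cp mat_linear_zero[OF proj_linear] by (rule sym)
    then have "solve Y (g * c) = 0\<^sub>m n n"
      using solve_intertwiner[OF XYM(2) _ inter[OF c(1) c0]] g c(1) by simp
    then have gc: "g * c = 0\<^sub>m n n" using inj g c(1) by simp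
    have "c = mat_inv g * (g * c)"
      using mat_mult_cancel_left[OF g(1) mat_inv(1)[OF g(1,2)] c(1) mat_inv(3)[OF g(1,2)]] by simp
    also have "\<dots> = 0\<^sub>m n n"
      unfolding gc using mat_inv(1)[OF g(1,2)] by simp
    finally show "c = 0\<^sub>m n n" .
  qed
  obtain c where c: "c \<in> M" "K c = 1\<^sub>m n"
    by (rule mat_linear_injective_imp_surjective[OF K one_carrier_mat inj_K])
  have "c - proj c = 0\<^sub>m n n"
    unfolding diff_K[OF c(1), symmetric] c(2) proj_one by (rule minus_r_inv_mat) simp
  then have cp: "proj c = c" using mat_minus_eq_zero_iff[of c n n "proj c"] c(1) by simp
  then have c0: "ad c = 0\<^sub>m n n" using ad_proj[OF c(1)] by simp
  define s where "s = g * c"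
  have s: "s \<in> M" "Y * s = s * N" using inter[OF c(1) c0] g c(1) by (simp_all add: s_def)
  have ps: "proj s = 1\<^sub>m n" using proj_K[OF c(1)] by (simp add: c(2) cp proj_one s_def)
  have "sol Y = delta Y \<cdot>\<^sub>m s" by (rule sol_normalised[OF XYM(2) s ps])
  then have ds: "det s \<noteq> 0" using d(2) by auto
  obtain b where b: "b \<in> M" "ad b = 0\<^sub>m n n" "(X, Y) = param s b"
    using orbit_obtain_commuting[OF rep s(1) ds s(2)] .
  define w where "w = (s - 1\<^sub>m n) + b"
  have w: "w \<in> M" using s b by (simp add: w_def)
  have pw: "proj w = b"
    unfolding w_def using s b
    by (simp add: mat_linearD(2)[OF proj_linear] mat_linear_diff[OF proj_linear] ps proj_one
        minus_r_inv_mat[of _ n n] proj_kernel)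
  have "frame w = s"
  proof -
    have "frame w - 1\<^sub>m n + b = (s - 1\<^sub>m n) + b" 
      using frame_proj[OF w] unfolding pw by (simp only: w_def)
    then show ?thesis
      by (rule mat_cancel_minus_add[rotated 4]) (use frame_carrier[OF w] s(1) b(1) in auto)
  qed
  then show ?thesis using w pw ds b(3) XY by (intro bexI[of _ w]) (auto simp: slice_map_def)
qed

end


section \<open>The dimension of the closure of the orbit\<close>

lemma zariski_closed_rep_variety: "zariski_closed n (rep_variety n :: ('k :: field mat \<times> 'k mat) set)"
proof -
  let ?R = "poly_funs n :: ('k mat \<times> 'k mat \<Rightarrow> 'k) set"
  let ?X = "\<lambda>p :: 'k mat \<times> 'k mat. square_part n (fst p)"
  let ?Y = "\<lambda>p :: 'k mat \<times> 'k mat. square_part n (snd p)"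
  define E where "E p = ?X p * ?Y p - ?Y p * ?X p - ?Y p * ?Y p" for p :: "'k mat \<times> 'k mat"
  have E: "E \<in> mat_over ?R n n"
    unfolding E_def[abs_def]
    by (intro mat_over_minus mat_over_mult[of _ _ n n] fun_algebra_poly_funs
        square_part_over_fst square_part_over_snd)
  let ?F = "{\<lambda>p. E p $$ (i, j) | i j. i < n \<and> j < n}"
  have "?F \<subseteq> ?R" using mat_overD(2)[OF E] by auto
  moreover have "rep_variety n = zero_locus n ?F"
  proof (rule Set.set_eqI)
    fix p :: "'k mat \<times> 'k mat"
    obtain X Y where p: "p = (X, Y)" by fastforce
    show "p \<in> rep_variety n \<longleftrightarrow> p \<in> zero_locus n ?F"
    proof (cases "p \<in> mat_pairs n")
      case True
      then have XY: "X \<in> carrier_mat n n" "Y \<in> carrier_mat n n" by (auto simp: p mat_pairs_def)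
      then have Ep: "E p = X * Y - Y * X - Y * Y" by (simp add: E_def p square_part_id)
      have c: "X * Y - Y * X \<in> carrier_mat n n" "Y * Y \<in> carrier_mat n n"
        using XY by (auto intro!: minus_carrier_mat mult_carrier_mat)
      have "p \<in> rep_variety n \<longleftrightarrow> E p = 0\<^sub>m n n"
        unfolding Ep mat_minus_eq_zero_iff[OF c] using XY by (simp add: p rep_variety_iff)
      also have "\<dots> \<longleftrightarrow> (\<forall>i<n. \<forall>j<n. E p $$ (i, j) = 0)"
        using mat_overD(1)[OF E, of p] by (auto intro!: eq_matI)
      also have "\<dots> \<longleftrightarrow> p \<in> zero_locus n ?F" using True by (auto simp: zero_locus_def)
      finally show ?thesis .
    next
      case False
      then show ?thesis using rep_variety_subset_mat_pairs by (auto simp: zero_locus_def)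
    qed
  qed
  ultimately show ?thesis unfolding zariski_closed_def by blast
qed

context conjugacy_class
begin

lemma orbit_subset_rep_variety: "orbit \<subseteq> rep_variety n"
  by (auto simp: orbit_def)

lemma orbit_subset_mat_pairs: "orbit \<subseteq> mat_pairs n"
  using orbit_subset_rep_variety rep_variety_subset_mat_pairs by blast

lemma zclosure_orbit_subset_rep_variety: "zclosure n orbit \<subseteq> rep_variety n"
  by (rule zclosure_minimal[OF zariski_closed_rep_variety orbit_subset_rep_variety])

lemma base_point_good: "good (X0, N) \<noteq> 0"
  by (simp add: good_base)

text \<open>The locus \<open>good \<noteq> 0\<close> is dense in the orbit, because the orbit is irreducible and contains the
  base point.\<close>

lemma vanish_on_orbit:
  assumes "f \<in> poly_funs n" "\<And>p. p \<in> orbit \<Longrightarrow> good p \<noteq> 0 \<Longrightarrow> f p = 0" "p \<in> orbit"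
  shows "f p = 0"
  using poly_domainD[OF poly_domain_orbit good_poly assms(1)] assms(2,3)
    base_point_in_orbit base_point_good by (metis mult_eq_0_iff)

lemma sol_slice_map:
  assumes "w \<in> M" "det (frame w) \<noteq> 0"
  shows "snd (slice_map w) * sol (snd (slice_map w)) = sol (snd (slice_map w)) * N"
proof -
  define g where "g = frame w"
  have g: "g \<in> M" "det g \<noteq> 0" using assms by (simp_all add: g_def)
  note h = mat_inv[OF g]
  let ?Y = "g * N * mat_inv g"
  have Y: "?Y \<in> M" using g h by simp
  have Yg: "?Y * g = g * N"
    using g h by (simp add: assoc_mult_mat[of _ n n _ n _ n] right_mult_one_mat[OF N])
  have S: "sol ?Y = delta ?Y \<cdot>\<^sub>m g"
    using sol_normalised[OF Y g(1) Yg] proj_frame[OF assms(1)] by (simp add: g_def)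
  have "?Y * sol ?Y = sol ?Y * N"
    unfolding S mult_smult_distrib[OF Y g(1)] mult_smult_assoc_mat[OF g(1) N] Yg ..
  then show ?thesis by (simp add: slice_map_def param_def g_def)
qed

text \<open>The relation \<open>Y * sol Y = sol Y * N\<close> is polynomial, so it persists on the closure of the orbit.
  Where \<open>sol Y\<close> is invertible, it exhibits \<open>Y\<close> as a conjugate of \<open>N\<close>.\<close>

lemma zclosure_orbit_good:
  assumes p: "p \<in> zclosure n orbit" and good: "good p \<noteq> 0"
  shows "p \<in> orbit"
proof -
  obtain X Y where XY: "p = (X, Y)" by fastforce
  have rep: "(X, Y) \<in> rep_variety n" 
    using subsetD[OF zclosure_orbit_subset_rep_variety p] by (simp only: XY)
  then have XYM: "X \<in> M" "Y \<in> M" unfolding rep_variety_iff by simp_all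
  define E where "E q = square_part n (snd q) * sol (square_part n (snd q)) - sol (square_part n (snd q)) * N"
    for q :: "'k mat \<times> 'k mat"
  have E: "E \<in> mat_over (poly_funs n) n n"
    unfolding E_def[abs_def]
    by (intro mat_over_minus mat_over_mult[of _ _ n n] fun_algebra_poly_funs
        square_part_over_snd sol_over mat_over_const N)
  have "E q = 0\<^sub>m n n" if q: "q \<in> orbit" "good q \<noteq> 0" for q
  proof -
    obtain w where w: "w \<in> M" "det (frame w) \<noteq> 0" "q = slice_map w"
      using good_imp_slice[OF q] by blast
    have "snd q \<in> M" using q(1) orbit_subset_mat_pairs by (auto simp: mat_pairs_def)
    then show ?thesis
      using sol_slice_map[OF w(1,2)] by (simp add: E_def square_part_id w(3) minus_r_inv_mat[of _ n n])
  qed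
  then have "E q $$ (i, j) = 0" if "q \<in> orbit" "i < n" "j < n" for q i j
    using vanish_on_orbit[OF mat_overD(2)[OF E that(2,3)] _ that(1)] that by simp
  then have "E p $$ (i, j) = 0" if "i < n" "j < n" for i j
    using zclosureD[OF p mat_overD(2)[OF E that]] that by simp
  then have "E p = 0\<^sub>m n n" using mat_overD(1)[OF E, of p] by (intro eq_matI) auto
  moreover have "Y * sol Y \<in> M" "sol Y * N \<in> M" using XYM by simp_all
  ultimately have "Y * sol Y = sol Y * N"
    using mat_minus_eq_zero_iff[of "Y * sol Y" n n "sol Y * N"] by (simp add: E_def XY square_part_id[OF XYM(2)])
  moreover have "det (sol Y) \<noteq> 0" using good XYM by (simp add: XY good_eq)
  ultimately show ?thesis unfolding XY using orbitI[OF rep sol_carrier] by blast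
qed

lemma frame_over:
  assumes R: "fun_algebra R" and A: "A \<in> mat_over R n n"
  shows "(\<lambda>w. frame (A w)) \<in> mat_over R n n" "(\<lambda>w. proj (A w)) \<in> mat_over R n n"
  unfolding frame_def
  by (intro mat_over_add[OF R] mat_over_const[OF R] one_carrier_mat A
      mat_over_linear[OF R mat_linear_compose[OF Q(1) ad_linear]] mat_over_linear[OF R proj_linear])+

text \<open>A dense part of the orbit is parametrised by the \<open>n\<^sup>2\<close> entries of \<open>w\<close>, with a power of
  \<open>det (frame w)\<close> as common denominator.\<close>

lemma poly_funs_dependent_on_orbit:
  assumes gs: "set gs \<subseteq> poly_funs n" and len: "length gs = m" "n * n < m"
  shows "\<exists>d c. (\<exists>a\<in>exponents m d. c a \<noteq> 0) \<and>
     (\<forall>p\<in>zclosure n orbit. (\<Sum>a\<in>exponents m d. c a * monom_fun gs a p) = 0)"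
proof -
  define xs where "xs = map (\<lambda>e (w :: 'k mat). w $$ (e div n, e mod n)) [0..<n * n]"
  note R = fun_algebra_polys_in[of xs]
  have sq: "(\<lambda>w. square_part n w) \<in> mat_over (polys_in xs) n n"
    unfolding square_part_def
  proof (rule mat_over_mat)
    fix i j assume ij: "i < n" "j < n"
    have "(\<lambda>w. w $$ (i, j)) = (\<lambda>e (w :: 'k mat). w $$ (e div n, e mod n)) (i * n + j)"
      using ij by simp
    then have "(\<lambda>w. w $$ (i, j)) \<in> set xs"
      using index_less_square[OF ij] unfolding xs_def by force
    then show "(\<lambda>w. case (i, j) of (i, j) \<Rightarrow> w $$ (i, j)) \<in> polys_in xs"
      using polys_in_coordinate by simp
  qed
  define h where "h w = det (frame (square_part n w))" for w
  define \<phi> where "\<phi> w = slice_map (square_part n w)" for w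
  note F = frame_over[OF R sq]
  have h: "h \<in> polys_in xs" unfolding h_def[abs_def] by (rule mat_over_det[OF R F(1)])
  have "\<exists>e. \<exists>u\<in>polys_in xs. \<forall>w. h w \<noteq> 0 \<longrightarrow> f (\<phi> w) * h w ^ e = u w" if "f \<in> set gs" for f
  proof (rule poly_funs_pullback[OF R h])
    show "f \<in> poly_funs n" using gs that by blast
  qed (unfold h_def \<phi>_def slice_map_def, (rule param_entries[OF R F]; assumption)+)
  then obtain e u where u: "\<And>f. f \<in> set gs \<Longrightarrow> u f \<in> polys_in xs"
    "\<And>f w. f \<in> set gs \<Longrightarrow> h w \<noteq> 0 \<Longrightarrow> f (\<phi> w) * h w ^ e f = u f w"
    by metis
  define E where "E = Suc (\<Sum>f\<in>set gs. e f)"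
  have "\<exists>v\<in>polys_in xs. \<forall>w. h w ^ E \<noteq> 0 \<longrightarrow> v w = h w ^ E * f (\<phi> w)" if f: "f \<in> set gs" for f
  proof (rule bexI)
    show "(\<lambda>w. h w ^ (E - e f) * u f w) \<in> polys_in xs"
      by (intro fun_algebraD[OF R] fun_algebra_power[OF R] h u f)
    have "e f \<le> E" unfolding E_def using member_le_sum[of f "set gs" e] f by simp
    then have pow: "h w ^ (E - e f) * h w ^ e f = h w ^ E" for w by (simp add: power_add[symmetric])
    show "\<forall>w. h w ^ E \<noteq> 0 \<longrightarrow> h w ^ (E - e f) * u f w = h w ^ E * f (\<phi> w)"
    proof (intro allI impI)
      fix w assume "h w ^ E \<noteq> 0"
      then have "h w \<noteq> 0" by (auto simp: E_def)
      then have "h w ^ (E - e f) * u f w = (h w ^ (E - e f) * h w ^ e f) * f (\<phi> w)"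
        using u(2)[OF f, of w] by (simp add: mult_ac)
      then show "h w ^ (E - e f) * u f w = h w ^ E * f (\<phi> w)" by (simp only: pow)
    qed
  qed
  moreover have "(\<lambda>w. h w ^ E) \<in> polys_in xs" by (rule fun_algebra_power[OF R h])
  moreover have "length xs < m" using len by (simp add: xs_def)
  ultimately obtain d c where c: "\<exists>a\<in>exponents m d. c a \<noteq> 0"
    "\<And>w. h w ^ E \<noteq> 0 \<Longrightarrow> (\<Sum>a\<in>exponents m d. c a * monom_fun gs a (\<phi> w)) = 0"
    using more_functions_than_coordinates_dependent[OF len(1), of xs "\<lambda>w. h w ^ E" \<phi>] by blast
  define r where "r p = (\<Sum>a\<in>exponents m d. c a * monom_fun gs a p)" for p
  note P = fun_algebra_poly_funs[of n, where 'a = 'k]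
  have r: "r \<in> poly_funs n"
    unfolding r_def[abs_def]
    by (intro fun_algebra_sum[OF P] fun_algebraD[OF P] monom_fun_in_algebra[OF P] gs)
  have "r p = 0" if p: "p \<in> orbit" for p
  proof (rule vanish_on_orbit[OF r _ p])
    fix q assume "q \<in> orbit" "good q \<noteq> 0"
    then obtain w where w: "w \<in> M" "det (frame w) \<noteq> 0" "q = slice_map w"
      using good_imp_slice by blast
    then show "r q = 0" using c(2)[of w] by (simp add: r_def h_def \<phi>_def square_part_id)
  qed
  then have "r p = 0" if "p \<in> zclosure n orbit" for p using zclosureD[OF that r] by blast
  then show ?thesis using c(1) unfolding r_def by blast
qed

lemma chain_length_le:
  assumes "\<And>i. i \<le> m \<Longrightarrow> poly_domain n (Z i)" "\<And>i. i \<le> m \<Longrightarrow> zariski_closed n (Z i)"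
    and "\<And>i. i < m \<Longrightarrow> Z i \<subset> Z (Suc i)" and top: "Z m \<subseteq> zclosure n orbit"
  shows "m \<le> n * n"
proof (rule ccontr)
  assume m: "\<not> m \<le> n * n"
  have "\<exists>gs. length gs = m \<and> set gs \<subseteq> poly_funs n \<and>
    (\<forall>d c. (\<forall>p\<in>Z m. (\<Sum>a\<in>exponents m d. c a * monom_fun gs a p) = 0)
        \<longrightarrow> (\<forall>a\<in>exponents m d. c a = 0))"
    by (rule chain_imp_independent) (use assms(1-3) in auto)
  then obtain gs where gs: "length gs = m" "set gs \<subseteq> poly_funs n"
    "\<And>d c. (\<forall>p\<in>Z m. (\<Sum>a\<in>exponents m d. c a * monom_fun gs a p) = 0)
        \<Longrightarrow> (\<forall>a\<in>exponents m d. c a = 0)"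
    by blast
  obtain d c where c: "\<exists>a\<in>exponents m d. c a \<noteq> 0"
    "\<forall>p\<in>zclosure n orbit. (\<Sum>a\<in>exponents m d. c a * monom_fun gs a p) = 0"
    using poly_funs_dependent_on_orbit[OF gs(2,1)] m by auto
  then show False using gs(3)[of c d] top by blast
qed

text \<open>Coordinate subspaces all contain the point \<open>0\<close>, at which \<open>good\<close> and the denominator
  \<open>det (frame w)\<close> of the slice map equal \<open>1\<close>; so their images are never empty and \<open>good\<close> never
  vanishes identically on them.\<close>

definition flag :: "nat \<Rightarrow> 'k mat set" where
  "flag i = {w \<in> M. \<forall>e<n * n. i \<le> e \<longrightarrow> w $$ (e div n, e mod n) = 0}"

definition flag_image :: "nat \<Rightarrow> ('k mat \<times> 'k mat) set" where
  "flag_image i = slice_map ` {w \<in> flag i. det (frame w) \<noteq> 0}"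

lemma frame_zero: "frame (0\<^sub>m n n) = 1\<^sub>m n"
  by (simp add: frame_def ad_zero Q_zero)

lemma proj_zero: "proj (0\<^sub>m n n) = 0\<^sub>m n n"
  by (rule mat_linear_zero[OF proj_linear])

lemma zero_in_flag: "0\<^sub>m n n \<in> flag i"
  by (auto simp: flag_def index_div_less index_mod_less)

lemma frame_line:
  assumes w: "w \<in> M" "w' \<in> M"
  shows "frame w + t \<cdot>\<^sub>m (frame w' - frame w) = frame (w + t \<cdot>\<^sub>m (w' - w))"
    and "proj w + t \<cdot>\<^sub>m (proj w' - proj w) = proj (w + t \<cdot>\<^sub>m (w' - w))"
proof -
  have D: "w' - w \<in> M" using w by simp
  have *: "L (w + t \<cdot>\<^sub>m (w' - w)) = L w + t \<cdot>\<^sub>m (L w' - L w)" if L: "mat_linear n L" for L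
    using mat_linearD(2)[OF L w(1), of "t \<cdot>\<^sub>m (w' - w)"] mat_linearD(3)[OF L D]
      mat_linear_diff[OF L w(2,1)] D by simp
  show "proj w + t \<cdot>\<^sub>m (proj w' - proj w) = proj (w + t \<cdot>\<^sub>m (w' - w))"
    using *[OF proj_linear] by simp
  have "1\<^sub>m n + A + t \<cdot>\<^sub>m (1\<^sub>m n + B - (1\<^sub>m n + A)) = 1\<^sub>m n + (A + t \<cdot>\<^sub>m (B - A))"
    if "A \<in> M" "B \<in> M" for A B
    using that by (intro eq_matI) auto
  from this[of "Q (ad w)" "Q (ad w')"]
  show "frame w + t \<cdot>\<^sub>m (frame w' - frame w) = frame (w + t \<cdot>\<^sub>m (w' - w))"
    using w by (simp add: frame_def *[OF mat_linear_compose[OF Q(1) ad_linear]])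
qed

lemma poly_domain_flag_image: "poly_domain n (flag_image i)"
proof (rule poly_domain_param_image)
  let ?T = "(\<lambda>w. (frame w, proj w)) ` flag i"
  show "flag_image i \<noteq> {}"
    using zero_in_flag[of i] by (auto simp: flag_image_def frame_zero intro!: exI[of _ "0\<^sub>m n n"])
  show "p \<in> flag_image i \<longleftrightarrow> (\<exists>g c. (g, c) \<in> ?T \<and> det g \<noteq> 0 \<and> p = param g c)" for p
    by (auto simp: flag_image_def slice_map_def)
  show "g \<in> M \<and> c \<in> M" if "(g, c) \<in> ?T" for g c using that by (auto simp: flag_def)
  show "(g + t \<cdot>\<^sub>m (g' - g), c + t \<cdot>\<^sub>m (c' - c)) \<in> ?T" if T: "(g, c) \<in> ?T" "(g', c') \<in> ?T" for g c g' c' t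
  proof -
    obtain w w' where w: "w \<in> flag i" "g = frame w" "c = proj w" "w' \<in> flag i" "g' = frame w'" "c' = proj w'"
      using T by auto
    have "w + t \<cdot>\<^sub>m (w' - w) \<in> flag i"
      using w(1,4) by (auto simp: flag_def index_div_less index_mod_less)
    moreover have "w \<in> M" "w' \<in> M" using w by (auto simp: flag_def)
    ultimately show ?thesis by (simp add: w frame_line)
  qed
qed

text \<open>The numerator of the rational function that recovers entry number \<open>i\<close> of \<open>w\<close> vanishes on the
  smaller image.  On the larger one it is nonzero at some multiple of the matrix unit in that
  position: \<open>good\<close> and the denominator are nonzero for the multiple \<open>0\<close>, hence also for some other
  one.\<close>

lemma flag_image_strict:
  assumes i: "i < n * n"
  shows "zclosure n (flag_image i) \<subset> zclosure n (flag_image (Suc i))"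
proof
  have "flag i \<subseteq> flag (Suc i)" by (auto simp: flag_def)
  then show "zclosure n (flag_image i) \<subseteq> zclosure n (flag_image (Suc i))"
    by (intro zclosure_mono) (auto simp: flag_image_def)
  define f where "f p = coord_mat p $$ (i div n, i mod n)" for p
  have f: "f \<in> poly_funs n" unfolding f_def[abs_def]
    by (rule mat_overD(2)[OF coord_mat_over index_div_less[OF i] index_mod_less[OF i]])
  have f_slice: "f (slice_map w) = good (slice_map w) * w $$ (i div n, i mod n)"
    if "w \<in> M" "det (frame w) \<noteq> 0" for w
    using that index_div_less[OF i] index_mod_less[OF i] by (simp add: f_def coord_mat_slice_map)
  have f0: "f p = 0" if p: "p \<in> flag_image i" for p
  proof -
    obtain w where w: "w \<in> flag i" "det (frame w) \<noteq> 0" "p = slice_map w" using p by (auto simp: flag_image_def)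
    then have "w \<in> M" "w $$ (i div n, i mod n) = 0" using i by (auto simp: flag_def)
    then show ?thesis using f_slice w by simp
  qed
  have E: "(\<lambda>t :: 'k. t \<cdot>\<^sub>m mat_unit n i) \<in> mat_over (range poly) n n"
  proof (intro mat_over_smult mat_over_const fun_algebra_poly mat_unit_carrier)
    show "(\<lambda>t. t) \<in> range (poly :: 'k poly \<Rightarrow> _)" by (rule image_eqI[of _ _ "[:0, 1:]"]) auto
  qed
  define h where "h t = det (frame (t \<cdot>\<^sub>m mat_unit n i))" for t
  note F = frame_over[OF fun_algebra_poly E]
  have h: "h \<in> range poly" unfolding h_def[abs_def] by (rule mat_over_det[OF fun_algebra_poly F(1)])
  have "\<exists>e. \<exists>u\<in>range poly. \<forall>t. h t \<noteq> 0 \<longrightarrow> good (slice_map (t \<cdot>\<^sub>m mat_unit n i)) * h t ^ e = u t"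
    by (rule poly_funs_pullback[OF fun_algebra_poly h _ _ good_poly];
        unfold h_def slice_map_def, rule param_entries[OF fun_algebra_poly F]; assumption)
  then obtain e u where u: "\<And>t. h t \<noteq> 0 \<Longrightarrow> good (slice_map (t \<cdot>\<^sub>m mat_unit n i)) * h t ^ e = poly u t"
    by blast
  obtain h' where h': "h = poly h'" using h by auto
  have z: "(0 :: 'k) \<cdot>\<^sub>m mat_unit n i = 0\<^sub>m n n" by (intro eq_matI) (auto simp: mat_unit_def)
  have h0: "h 0 = 1" by (simp add: h_def z frame_zero)
  have "mat_inv (1\<^sub>m n) = (1\<^sub>m n :: 'k mat)"
    using mat_inv(2)[of "1\<^sub>m n :: 'k mat" n] mat_inv(1)[of "1\<^sub>m n :: 'k mat" n] by simp
  then have "slice_map (0\<^sub>m n n) = (X0, N)"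
    by (simp add: slice_map_def param_def frame_zero proj_zero left_mult_one_mat[of _ n n] right_mult_one_mat[of _ n n])
  then have "poly u 0 \<noteq> 0" using u[of 0] h0 by (simp add: z good_base)
  moreover have "poly h' 0 \<noteq> 0" using h0 h' by simp
  ultimately have "u * h' * [:0, 1:] \<noteq> 0" by auto
  then obtain t where "poly (u * h' * [:0, 1:]) t \<noteq> 0" using poly_all_0_iff_0 by blast
  then have t: "poly u t \<noteq> 0" "h t \<noteq> 0" "t \<noteq> 0" by (auto simp: h')
  define w where "w = t \<cdot>\<^sub>m mat_unit n i"
  have w: "w \<in> M" "det (frame w) \<noteq> 0" using t(2) by (simp_all add: w_def h_def)
  have wi: "w $$ (i div n, i mod n) = t"
    using index_div_less[OF i] index_mod_less[OF i] by (simp add: w_def mat_unit_def)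
  have "good (slice_map w) \<noteq> 0" using u[OF t(2)] t by (auto simp: w_def)
  then have "f (slice_map w) \<noteq> 0" using f_slice[OF w] wi t(3) by simp
  then have "slice_map w \<notin> zclosure n (flag_image i)" using zclosureD[OF _ f] f0 by blast
  moreover have "w \<in> flag (Suc i)"
    using w(1) by (auto simp: flag_def w_def mat_unit_def index_div_less index_mod_less)
  then have "slice_map w \<in> flag_image (Suc i)" using w(2) by (auto simp: flag_image_def)
  then have "slice_map w \<in> zclosure n (flag_image (Suc i))"
    using zclosure_superset poly_domain_flag_image[of "Suc i"] unfolding poly_domain_def by blast
  ultimately show "zclosure n (flag_image i) \<noteq> zclosure n (flag_image (Suc i))" by blast
qed

lemma flag_image_subset_orbit: "flag_image i \<subseteq> orbit"
  using slice_map_in_orbit by (auto simp: flag_image_def flag_def)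

end


section \<open>Nilpotency and Jordan normal forms\<close>

text \<open>The remaining columns are the unit vectors other than one at whose position \<open>v\<close> has a nonzero
  entry.\<close>

lemma exists_invertible_first_column:
  fixes v :: "'k :: field vec"
  assumes v: "v \<in> carrier_vec n" "v \<noteq> 0\<^sub>v n"
  shows "\<exists>P\<in>carrier_mat n n. det P \<noteq> 0 \<and> col P 0 = v"
proof -
  obtain k where k: "k < n" "v $ k \<noteq> 0" using v eq_vecI[of v "0\<^sub>v n"] by auto
  define s where "s j = (if j = k then 0 else j)" for j :: nat
  define P where "P = mat n n (\<lambda>(i, j). if j = 0 then v $ i else if i = s j then 1 else 0)"
  have P: "P \<in> carrier_mat n n" by (simp add: P_def)
  have "det P \<noteq> 0"
  proof
    assume "det P = 0"
    then obtain x where x: "x \<in> carrier_vec n" "x \<noteq> 0\<^sub>v n" "P *\<^sub>v x = 0\<^sub>v n"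
      using det_0_iff_vec_prod_zero[OF P] by blast
    have row: "v $ i * x $ 0 + (\<Sum>j\<in>{1..<n}. if i = s j then x $ j else 0) = 0" if i: "i < n" for i
    proof -
      have "(P *\<^sub>v x) $ i = (\<Sum>j\<in>{0..<n}. P $$ (i, j) * x $ j)"
        using i P x(1) by (simp add: scalar_prod_def)
      also have "\<dots> = P $$ (i, 0) * x $ 0 + (\<Sum>j\<in>{1..<n}. P $$ (i, j) * x $ j)"
        using k(1) by (simp add: sum.atLeast_Suc_lessThan)
      also have "(\<Sum>j\<in>{1..<n}. P $$ (i, j) * x $ j) = (\<Sum>j\<in>{1..<n}. if i = s j then x $ j else 0)"
        using i by (intro sum.cong) (auto simp: P_def)
      finally have "(P *\<^sub>v x) $ i = P $$ (i, 0) * x $ 0 + (\<Sum>j\<in>{1..<n}. if i = s j then x $ j else 0)" .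
      moreover have "(P *\<^sub>v x) $ i = 0" unfolding x(3) using i by simp
      moreover have "P $$ (i, 0) = v $ i" using i k(1) by (simp add: P_def)
      ultimately show ?thesis by simp
    qed
    have "(\<Sum>j\<in>{1..<n}. if k = s j then x $ j else 0) = 0"
      by (intro sum.neutral) (auto simp: s_def)
    then have x0: "x $ 0 = 0" using row[OF k(1)] k(2) by simp
    have "x $ j = 0" if j: "0 < j" "j < n" for j
    proof -
      have "s j < n" using j by (simp add: s_def)
      have "(\<Sum>i\<in>{1..<n}. if s j = s i then x $ i else 0) = (\<Sum>i\<in>{1..<n}. if i = j then x $ i else 0)"
        using j by (intro sum.cong) (auto simp: s_def)
      also have "\<dots> = x $ j" using j by (simp add: sum.delta)
      finally show ?thesis using row[OF \<open>s j < n\<close>] x0 by simp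
    qed
    then have "x = 0\<^sub>v n" using x(1) x0 by (intro eq_vecI) (auto, metis gr_zeroI)
    then show False using x(2) by simp
  qed
  moreover have "col P 0 = v" using v k(1) by (intro eq_vecI) (auto simp: P_def)
  ultimately show ?thesis using P by blast
qed

text \<open>Deflation: conjugating an eigenvector to the first unit vector leaves a block of size one less.\<close>

lemma similar_upper_triangular:
  fixes A :: "'k :: alg_closed_field mat"
  assumes "A \<in> carrier_mat n n"
  shows "\<exists>B\<in>carrier_mat n n. upper_triangular B \<and> similar_mat A B"
  using assms
proof (induction n arbitrary: A)
  case 0
  then show ?case by (intro bexI[of _ A]) (auto intro: similar_mat_refl)
next
  case (Suc n)
  have "degree (char_poly A) = Suc n" using degree_monic_char_poly[OF Suc.prems] by simp
  then obtain e where "poly (char_poly A) e = 0" using alg_closed_imp_poly_has_root[of "char_poly A"] by auto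
  then obtain v where ev: "eigenvector A v e"
    using eigenvalue_root_char_poly[OF Suc.prems] by (auto simp: eigenvalue_def)
  then have v: "v \<in> carrier_vec (Suc n)" "v \<noteq> 0\<^sub>v (Suc n)" "A *\<^sub>v v = e \<cdot>\<^sub>v v"
    using Suc.prems by (auto simp: eigenvector_def)
  obtain P where P: "P \<in> carrier_mat (Suc n) (Suc n)" "det P \<noteq> 0" "col P 0 = v"
    using exists_invertible_first_column[OF v(1,2)] by blast
  note h = mat_inv[OF P(1,2)]
  define C where "C = mat_inv P * A * P"
  have C: "C \<in> carrier_mat (Suc n) (Suc n)"
    unfolding C_def using h P Suc.prems by (meson mult_carrier_mat)
  have "P * C * mat_inv P = A"
    unfolding C_def by (rule conjugate_cancel[OF P(1) h(1) Suc.prems h(2)])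
  then have AC: "similar_mat A C"
    by (intro similar_matI[of _ _ P "mat_inv P" "Suc n"]) (use P h C Suc.prems in auto)
  have AP: "A * P \<in> carrier_mat (Suc n) (Suc n)" using Suc.prems P(1) by (rule mult_carrier_mat)
  have "col C 0 = mat_inv P *\<^sub>v (A *\<^sub>v v)"
    unfolding C_def assoc_mult_mat[OF h(1) Suc.prems P(1)] col_mult2[OF h(1) AP zero_less_Suc]
      col_mult2[OF Suc.prems P(1) zero_less_Suc] P(3) ..
  also have "\<dots> = e \<cdot>\<^sub>v (mat_inv P *\<^sub>v v)" unfolding v(3) by (rule mult_mat_vec[OF h(1) v(1)])
  also have "mat_inv P *\<^sub>v v = col (mat_inv P * P) 0"
    unfolding col_mult2[OF h(1) P(1) zero_less_Suc] P(3) ..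
  finally have col0: "col C 0 = e \<cdot>\<^sub>v unit_vec (Suc n) 0" by (simp add: h(3))
  define A1 where "A1 = mat 1 1 (\<lambda>_. e)"
  define A0 where "A0 = mat 1 n (\<lambda>(i, j). C $$ (0, Suc j))"
  define A2 where "A2 = mat n n (\<lambda>(i, j). C $$ (Suc i, Suc j))"
  have C0: "C $$ (i, 0) = (if i = 0 then e else 0)" if "i < Suc n" for i
    using arg_cong[OF col0, of "\<lambda>v. v $ i"] that C by (auto simp: unit_vec_def)
  have Cb: "C = four_block_mat A1 A0 (0\<^sub>m n 1) A2"
    using C C0 by (intro eq_matI) (auto simp: A1_def A0_def A2_def)
  obtain B2 where B2: "B2 \<in> carrier_mat n n" "upper_triangular B2" "similar_mat A2 B2"
    using Suc.IH[of A2] by (auto simp: A2_def)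
  have A1: "A1 \<in> carrier_mat 1 1" by (simp add: A1_def)
  have A02: "A0 \<in> carrier_mat 1 n" "A2 \<in> carrier_mat n n" by (simp_all add: A0_def A2_def)
  obtain B0 where B0: "B0 \<in> carrier_mat 1 n" "similar_mat C (four_block_mat A1 B0 (0\<^sub>m n 1) B2)"
    using similar_mat_four_block_0_ex[OF similar_mat_refl[OF A1] B2(3) A02(1) A1 A02(2)]
    unfolding Cb[symmetric] by blast
  let ?B = "four_block_mat A1 B0 (0\<^sub>m n 1) B2"
  have "upper_triangular ?B"
    by (rule upper_triangular_four_block[OF A1 B2(1) _ B2(2)]) (auto simp: A1_def)
  moreover have "?B \<in> carrier_mat (Suc n) (Suc n)" using A1 B2(1) by auto
  ultimately show ?case using similar_mat_trans[OF AC B0(2)] by blast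
qed

lemma jordan_nf_exists_alg_closed:
  fixes A :: "'k :: alg_closed_field mat"
  assumes "A \<in> carrier_mat n n"
  shows "\<exists>n_as. jordan_nf A n_as"
proof -
  obtain B where B: "B \<in> carrier_mat n n" "upper_triangular B" "similar_mat A B"
    using similar_upper_triangular[OF assms] by blast
  then show ?thesis
    using triangular_to_jnf_vector[OF B(1,2)] similar_mat_trans unfolding jordan_nf_def by blast
qed

definition mat_trace :: "'k :: comm_ring_1 mat \<Rightarrow> 'k" where
  "mat_trace A = (\<Sum>i<dim_row A. A $$ (i, i))"

lemma mat_trace_mult_commute:
  assumes "A \<in> carrier_mat n n" "B \<in> carrier_mat n n"
  shows "mat_trace (A * B) = mat_trace (B * A)"
proof -
  have "mat_trace (A * B) = (\<Sum>i<n. \<Sum>j<n. A $$ (i, j) * B $$ (j, i))"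
    using assms by (simp add: mat_trace_def scalar_prod_def lessThan_atLeast0)
  also have "\<dots> = (\<Sum>j<n. \<Sum>i<n. A $$ (i, j) * B $$ (j, i))" by (rule sum.swap)
  also have "\<dots> = mat_trace (B * A)"
    using assms by (simp add: mat_trace_def scalar_prod_def lessThan_atLeast0 mult.commute)
  finally show ?thesis .
qed

lemma upper_triangular_pow_diag:
  fixes A :: "'k :: comm_ring_1 mat"
  assumes A: "A \<in> carrier_mat n n" "upper_triangular A"
  shows "upper_triangular (A ^\<^sub>m k) \<and> (\<forall>i<n. (A ^\<^sub>m k) $$ (i, i) = (A $$ (i, i)) ^ k)"
proof (induction k)
  case 0
  then show ?case using A by simp
next
  case (Suc k)
  let ?B = "A ^\<^sub>m k"
  have B: "?B \<in> carrier_mat n n" using A(1) by simp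
  have low: "?B $$ (i, j) = 0" "A $$ (i, j) = 0" if "j < i" "i < n" for i j
    using Suc A B that by (auto simp: upper_triangular_def)
  have entry: "(?B * A) $$ (i, j) = (\<Sum>l<n. ?B $$ (i, l) * A $$ (l, j))" if "i < n" "j < n" for i j
    using that A B by (simp add: scalar_prod_def lessThan_atLeast0)
  have "(?B * A) $$ (i, j) = 0" if "j < i" "i < n" for i j
  proof -
    have "?B $$ (i, l) * A $$ (l, j) = 0" if "l < n" for l
      using low[of l i] low[of j l] \<open>j < i\<close> \<open>i < n\<close> that by (cases "l < i") auto
    then show ?thesis using that entry by simp
  qed
  moreover have "(?B * A) $$ (i, i) = (A $$ (i, i)) ^ Suc k" if "i < n" for i
  proof -
    have "?B $$ (i, l) * A $$ (l, i) = 0" if "l < n" "l \<noteq> i" for l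
      using low[of l i] low[of i l] \<open>i < n\<close> that by (cases "l < i") auto
    then have "(\<Sum>l<n. ?B $$ (i, l) * A $$ (l, i)) = (\<Sum>l\<in>{i}. ?B $$ (i, l) * A $$ (l, i))"
      using that by (intro sum.mono_neutral_right) auto
    then show ?thesis using entry[OF that that] Suc that by (simp add: mult.commute)
  qed
  ultimately show ?case using A B by (auto simp: upper_triangular_def)
qed

text \<open>The sums of \<open>d i ^ 2 * poly p (d i)\<close> vanish for every polynomial \<open>p\<close>.  Choosing \<open>p\<close> with
  all values of \<open>d\<close> but one as roots isolates that value, with a multiplicity that is nonzero in
  characteristic \<open>0\<close>.\<close>

lemma power_sums_zero:
  fixes d :: "'i \<Rightarrow> 'k :: field_char_0"
  assumes I: "finite I" and sums: "\<And>k. k \<ge> 2 \<Longrightarrow> (\<Sum>i\<in>I. d i ^ k) = 0" and j: "j \<in> I"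
  shows "d j = 0"
proof (rule ccontr)
  assume nz: "d j \<noteq> 0"
  define p where "p = (\<Prod>\<mu>\<in>d ` I - {d j}. [:- \<mu>, 1:])"
  have "(\<Sum>i\<in>I. d i ^ 2 * poly p (d i)) = (\<Sum>l\<le>degree p. coeff p l * (\<Sum>i\<in>I. d i ^ (l + 2)))"
    unfolding poly_altdef sum_distrib_left by (subst sum.swap) (simp add: power_add mult_ac power2_eq_square)
  also have "\<dots> = 0"
  proof -
    have "(\<Sum>i\<in>I. d i ^ (l + 2)) = 0" for l by (rule sums) simp
    then show ?thesis by (simp only: mult_zero_right sum.neutral_const)
  qed
  finally have zero: "(\<Sum>i\<in>I. d i ^ 2 * poly p (d i)) = 0" .
  have p0: "poly p (d i) = 0" if "i \<in> I" "d i \<noteq> d j" for i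
    unfolding p_def poly_prod using I that by (intro prod_zero) auto
  have pj: "poly p (d j) \<noteq> 0"
    unfolding p_def poly_prod using I by (subst prod_zero_iff) auto
  have "(\<Sum>i\<in>I. d i ^ 2 * poly p (d i)) = (\<Sum>i\<in>{i \<in> I. d i = d j}. d i ^ 2 * poly p (d i))"
    using I p0 by (intro sum.mono_neutral_right) auto
  also have "\<dots> = of_nat (card {i \<in> I. d i = d j}) * (d j ^ 2 * poly p (d j))" by simp
  finally have "card {i \<in> I. d i = d j} = 0" using zero nz pj by simp
  then show False using I j by auto
qed

lemma commutator_power:
  fixes X Y :: "'k :: comm_ring_1 mat"
  assumes X: "X \<in> carrier_mat n n" and Y: "Y \<in> carrier_mat n n" and rel: "X * Y - Y * X = Y * Y"
  shows "X * Y ^\<^sub>m k = Y ^\<^sub>m k * X + of_nat k \<cdot>\<^sub>m Y ^\<^sub>m Suc k"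
proof (induction k)
  case 0
  have Y0: "Y ^\<^sub>m 0 = 1\<^sub>m n" "Y ^\<^sub>m Suc 0 = Y" using Y by simp_all
  have "X = X + of_nat 0 \<cdot>\<^sub>m Y" using X Y by (intro eq_matI) auto
  then show ?case unfolding Y0 left_mult_one_mat[OF X] right_mult_one_mat[OF X] .
next
  case (Suc k)
  let ?Z = "Y ^\<^sub>m k"
  have Z0: "?Z \<in> carrier_mat n n" using Y by simp
  have Z1: "?Z * Y \<in> carrier_mat n n" by (rule mult_carrier_mat[OF Z0 Y])
  note Z = Z0 Z1 mult_carrier_mat[OF Z1 Y]
  note YX = mult_carrier_mat[OF Y X] mult_carrier_mat[OF Y Y] mult_carrier_mat[OF Z0 X]
  have XY: "X * Y = Y * X + Y * Y"
    using mat_add_minus_cancel[OF YX(1) mult_carrier_mat[OF X Y]] unfolding rel by (rule sym)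
  have "X * Y ^\<^sub>m Suc k = (X * ?Z) * Y"
    using assoc_mult_mat[OF X Z(1) Y] by simp
  also have "\<dots> = (?Z * X) * Y + (of_nat k \<cdot>\<^sub>m (?Z * Y)) * Y"
    unfolding Suc using add_mult_distrib_mat[OF YX(3), of "of_nat k \<cdot>\<^sub>m (?Z * Y)" Y n] Z Y by simp
  also have "(?Z * X) * Y = ?Z * (Y * X) + ?Z * (Y * Y)"
    using assoc_mult_mat[OF Z(1) X Y] mult_add_distrib_mat[OF Z(1) YX(1,2)] by (simp add: XY)
  also have "?Z * (Y * X) = Y ^\<^sub>m Suc k * X" using assoc_mult_mat[OF Z(1) Y X] by simp
  also have "?Z * (Y * Y) = Y ^\<^sub>m Suc (Suc k)" using assoc_mult_mat[OF Z(1) Y Y] by simp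
  also have "(of_nat k \<cdot>\<^sub>m (?Z * Y)) * Y = of_nat k \<cdot>\<^sub>m Y ^\<^sub>m Suc (Suc k)"
    using mult_smult_assoc_mat[OF Z(2) Y] by simp
  also have "Y ^\<^sub>m Suc k * X + Y ^\<^sub>m Suc (Suc k) + of_nat k \<cdot>\<^sub>m Y ^\<^sub>m Suc (Suc k)
      = Y ^\<^sub>m Suc k * X + of_nat (Suc k) \<cdot>\<^sub>m Y ^\<^sub>m Suc (Suc k)"
  proof -
    have "A + B + c \<cdot>\<^sub>m B = A + (1 + c) \<cdot>\<^sub>m B"
      if "A \<in> carrier_mat n n" "B \<in> carrier_mat n n" for A B :: "'k mat" and c
      using that by (intro eq_matI) (auto simp: algebra_simps)
    from this[of "Y ^\<^sub>m Suc k * X" "Y ^\<^sub>m Suc (Suc k)" "of_nat k"]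
    show ?thesis using Z(3) mult_carrier_mat[OF Z(2) X] by simp
  qed
  finally show ?case .
qed

text \<open>Since commutators have trace \<open>0\<close>, the identity \<open>[X, Y ^ k] = k Y ^ (k + 1)\<close> kills all power
  sums of the eigenvalues of \<open>Y\<close> from the second on.\<close>

lemma rep_variety_jordan_eigenvalues_zero:
  fixes X Y :: "'k :: field_char_0 mat"
  assumes rep: "(X, Y) \<in> rep_variety n" and jnf: "jordan_nf Y n_as" and m: "(m, a) \<in> set n_as"
  shows "a = 0"
proof -
  have X: "X \<in> carrier_mat n n" and Y: "Y \<in> carrier_mat n n" and rel: "X * Y - Y * X = Y * Y"
    using rep by (auto simp: rep_variety_iff)
  define J where "J = jordan_matrix n_as"
  obtain P R where wit: "similar_mat_wit Y J P R"
    using jnf by (auto simp: jordan_nf_def similar_mat_def J_def)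
  note w = similar_mat_witD2[OF Y wit]
  have ut: "upper_triangular J"
    using w(5) jordan_matrix_upper_triangular[of _ n_as] by (auto simp: J_def upper_triangular_def)
  have tr0: "mat_trace (Y ^\<^sub>m Suc k) = 0" if "k > 0" for k
  proof -
    have Z0: "Y ^\<^sub>m k \<in> carrier_mat n n" using Y by simp
    have Z1: "Y ^\<^sub>m Suc k \<in> carrier_mat n n" using mult_carrier_mat[OF Z0 Y] by simp
    note Z = Z0 mult_carrier_mat[OF Z0 X] Z1
    have "mat_trace (A + c \<cdot>\<^sub>m B) = mat_trace A + c * mat_trace B"
      if "A \<in> carrier_mat n n" "B \<in> carrier_mat n n" for A B :: "'k mat" and c
      using that by (simp add: mat_trace_def sum.distrib sum_distrib_left)
    from this[OF Z(2,3), of "of_nat k"]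
    have "mat_trace (X * Y ^\<^sub>m k) = mat_trace (Y ^\<^sub>m k * X) + of_nat k * mat_trace (Y ^\<^sub>m Suc k)"
      by (simp only: commutator_power[OF X Y rel])
    then show ?thesis using mat_trace_mult_commute[OF X Z(1)] that by simp
  qed
  have "(\<Sum>i<n. J $$ (i, i) ^ k) = 0" if k: "k \<ge> 2" for k
  proof -
    obtain l where l: "k = Suc l" "l > 0" using k by (cases k) auto
    have Jk: "J ^\<^sub>m k \<in> carrier_mat n n" using w(5) by simp
    have "mat_trace (Y ^\<^sub>m k) = mat_trace (P * (J ^\<^sub>m k * R))"
      unfolding similar_mat_wit_pow_id[OF wit] using assoc_mult_mat[OF w(6) Jk w(7)] by simp
    also have "\<dots> = mat_trace (J ^\<^sub>m k * R * P)"
      by (rule mat_trace_mult_commute[OF w(6)]) (rule mult_carrier_mat[OF Jk w(7)])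
    also have "J ^\<^sub>m k * R * P = J ^\<^sub>m k"
      unfolding assoc_mult_mat[OF Jk w(7,6)] w(2) by (rule right_mult_one_mat[OF Jk])
    also have "mat_trace (J ^\<^sub>m k) = (\<Sum>i<n. J $$ (i, i) ^ k)"
      using upper_triangular_pow_diag[OF w(5) ut, of k] Jk w(5) by (simp add: mat_trace_def)
    finally show ?thesis using tr0[OF l(2)] l(1) by simp
  qed
  then have diag: "J $$ (i, i) = 0" if "i < n" for i
    using power_sums_zero[of "{..<n}" "\<lambda>i. J $$ (i, i)" i] that by simp
  have "m \<noteq> 0" using jnf m by (force simp: jordan_nf_def)
  have "poly (char_poly J) a = (\<Prod>(m, b)\<leftarrow>n_as. poly ([:- b, 1:] ^ m) a)"
    unfolding J_def jordan_matrix_char_poly by (induction n_as) auto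
  also have "\<dots> = 0"
    using m \<open>m \<noteq> 0\<close> by (auto simp: prod_list_zero_iff image_iff intro!: bexI[of _ "(m, a)"])
  finally have "poly (char_poly J) a = 0" .
  moreover have "char_poly J = (\<Prod>b\<leftarrow>diag_mat J. [:- b, 1:])"
    by (rule char_poly_upper_triangular[OF w(5) ut])
  ultimately have "a \<in> set (diag_mat J)"
    by (auto simp: poly_prod_list prod_list_zero_iff)
  then show ?thesis using diag w(5) by (auto simp: diag_mat_def)
qed

lemma four_block_diag_swap:
  fixes A B :: "'k :: comm_ring_1 mat"
  assumes A: "A \<in> carrier_mat a a" and B: "B \<in> carrier_mat b b"
  shows "similar_mat (four_block_mat A (0\<^sub>m a b) (0\<^sub>m b a) B) (four_block_mat B (0\<^sub>m b a) (0\<^sub>m a b) A)"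
proof (rule similar_matI[of _ _ "four_block_mat (0\<^sub>m a b) (1\<^sub>m a) (1\<^sub>m b) (0\<^sub>m b a)"
      "four_block_mat (0\<^sub>m b a) (1\<^sub>m b) (1\<^sub>m a) (0\<^sub>m a b)" "a + b"])
  let ?P = "four_block_mat (0\<^sub>m a b) (1\<^sub>m a) (1\<^sub>m b) (0\<^sub>m b a) :: 'k mat"
  let ?R = "four_block_mat (0\<^sub>m b a) (1\<^sub>m b) (1\<^sub>m a) (0\<^sub>m a b) :: 'k mat"
  let ?D = "four_block_mat B (0\<^sub>m b a) (0\<^sub>m a b) A"
  show "{four_block_mat A (0\<^sub>m a b) (0\<^sub>m b a) B, ?D, ?P, ?R} \<subseteq> carrier_mat (a + b) (a + b)"
    using A B by (auto simp: add.commute)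
  show "?P * ?R = 1\<^sub>m (a + b)"
    by (subst mult_four_block_mat[of _ a b _ a _ b _ _ a _ b]) auto
  show "?R * ?P = 1\<^sub>m (a + b)"
    by (subst mult_four_block_mat[of _ b a _ b _ a _ _ b _ a]) (auto simp: add.commute)
  have "?P * ?D = four_block_mat (0\<^sub>m a b) A B (0\<^sub>m b a)"
    using A B by (subst mult_four_block_mat[of _ a b _ a _ b _ _ b _ a]) auto
  moreover have "four_block_mat (0\<^sub>m a b) A B (0\<^sub>m b a) * ?R = four_block_mat A (0\<^sub>m a b) (0\<^sub>m b a) B"
    using A B by (subst mult_four_block_mat[of _ a b _ a _ b _ _ a _ b]) auto
  ultimately show "four_block_mat A (0\<^sub>m a b) (0\<^sub>m b a) B = ?P * ?D * ?R" by simp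
qed

lemma jordan_matrix_append:
  "jordan_matrix (xs @ ys) = four_block_mat (jordan_matrix xs)
     (0\<^sub>m (sum_list (map fst xs)) (sum_list (map fst ys)))
     (0\<^sub>m (sum_list (map fst ys)) (sum_list (map fst xs))) (jordan_matrix ys)"
proof -
  have "jordan_matrix (xs @ ys) = (let A = jordan_matrix xs; B = jordan_matrix ys in
      four_block_mat A (0\<^sub>m (dim_row A) (dim_col B)) (0\<^sub>m (dim_row B) (dim_col A)) B)"
    unfolding jordan_matrix_def map_append by (rule diag_block_mat_append)
  then show ?thesis by (simp add: Let_def)
qed

lemma similar_jordan_matrix_append:
  fixes xs ys :: "(nat \<times> 'k :: comm_ring_1) list"
  assumes xs: "similar_mat (jordan_matrix xs) (jordan_matrix xs')"
    and ys: "similar_mat (jordan_matrix ys) (jordan_matrix ys')"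
  shows "similar_mat (jordan_matrix (xs @ ys)) (jordan_matrix (xs' @ ys'))"
proof -
  have dim: "sum_list (map fst xs') = sum_list (map fst xs)"
    if s: "similar_mat (jordan_matrix xs) (jordan_matrix xs')" for xs xs' :: "(nat \<times> 'k) list"
    using similar_matD[OF s] by (metis carrier_matD(1) insert_subset jordan_matrix_dim(1))
  show ?thesis
    unfolding jordan_matrix_append dim[OF xs] dim[OF ys]
    by (rule similar_mat_four_block_0_0[OF xs ys]) auto
qed

text \<open>Rotating sublists by \<open>four_block_diag_swap\<close> brings any block to the front.\<close>

lemma similar_jordan_matrix_mset:
  fixes xs ys :: "(nat \<times> 'k :: comm_ring_1) list"
  assumes "mset xs = mset ys"
  shows "similar_mat (jordan_matrix xs) (jordan_matrix ys)"
  using assms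
proof (induction xs arbitrary: ys)
  case Nil
  then show ?case using similar_mat_refl[OF jordan_matrix_carrier[of "[]"]] by simp
next
  case (Cons x xs)
  have refl: "similar_mat (jordan_matrix zs) (jordan_matrix zs)" for zs :: "(nat \<times> 'k) list"
    by (rule similar_mat_refl[OF jordan_matrix_carrier])
  have "x \<in> set ys" using Cons.prems by (metis list.set_intros(1) mset_eq_setD)
  then obtain as bs where ys: "ys = as @ x # bs" by (meson split_list)
  have IH: "similar_mat (jordan_matrix xs) (jordan_matrix (as @ bs))"
    by (rule Cons.IH) (use Cons.prems ys in simp)
  have swap: "similar_mat (jordan_matrix ([x] @ as)) (jordan_matrix (as @ [x]))"
    unfolding jordan_matrix_append by (rule four_block_diag_swap) auto
  have "similar_mat (jordan_matrix (x # xs)) (jordan_matrix (x # as @ bs))"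
    using similar_jordan_matrix_append[OF refl[of "[x]"] IH] by simp
  moreover have "similar_mat (jordan_matrix (x # as @ bs)) (jordan_matrix ys)"
    using similar_jordan_matrix_append[OF swap refl[of bs]] by (simp add: ys)
  ultimately show ?case by (rule similar_mat_trans)
qed

definition nilpotent_jordan :: "nat list \<Rightarrow> 'k :: field mat" where
  "nilpotent_jordan P = jordan_matrix (map (\<lambda>p. (p, 0)) P)"

lemma nilpotent_jordan_carrier: "P \<in> partitions n \<Longrightarrow> nilpotent_jordan P \<in> carrier_mat n n"
  using jordan_matrix_carrier[of "map (\<lambda>p. (p, 0)) P"]
  by (simp add: nilpotent_jordan_def partitions_def comp_def)

lemma stratum_iff:
  assumes "P \<in> partitions n"
  shows "stratum n P = {(X, Y) \<in> rep_variety n. similar_mat Y (nilpotent_jordan P)}"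
  using assms by (force simp: stratum_def jordan_nf_def nilpotent_jordan_def partitions_def)

lemma rep_variety_covered:
  fixes p :: "'k :: {alg_closed_field, field_char_0} mat \<times> 'k mat"
  assumes p: "p \<in> rep_variety n"
  shows "\<exists>P\<in>partitions n. p \<in> stratum n P"
proof -
  obtain X Y where XY: "p = (X, Y)" by fastforce
  have Y: "Y \<in> carrier_mat n n" using p by (simp add: XY rep_variety_iff)
  obtain n_as where jnf: "jordan_nf Y n_as" using jordan_nf_exists_alg_closed[OF Y] by blast
  define ms where "ms = map fst n_as"
  define P where "P = rev (sort ms)"
  have "n_as = map (\<lambda>p. (p, 0)) ms"
    unfolding ms_def map_map
  proof (rule map_idI[symmetric])
    fix x assume "x \<in> set n_as"
    then show "((\<lambda>p. (p, 0)) \<circ> fst) x = x"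
      using rep_variety_jordan_eigenvalues_zero[OF p[unfolded XY] jnf, of "fst x" "snd x"]
      by (simp add: prod_eq_iff)
  qed
  then have "mset n_as = mset (map (\<lambda>p. (p, 0)) P)" by (simp add: P_def)
  from similar_jordan_matrix_mset[OF this]
  have "similar_mat (jordan_matrix n_as) (nilpotent_jordan P)"
    by (simp only: nilpotent_jordan_def)
  moreover have "similar_mat Y (jordan_matrix n_as)" using jnf by (simp add: jordan_nf_def)
  ultimately have sim: "similar_mat Y (nilpotent_jordan P)"
    by (rule similar_mat_trans[rotated])
  have "dim_row (nilpotent_jordan P :: 'k mat) = n"
    using similar_matD[OF sim] Y by auto
  then have "sum_list P = n" by (simp add: nilpotent_jordan_def comp_def)
  moreover have "sorted_wrt (\<ge>) P" by (simp add: P_def sorted_wrt_rev)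
  moreover have "\<forall>p\<in>set P. p \<ge> 1"
    using jnf by (force simp: P_def ms_def jordan_nf_def Suc_le_eq)
  ultimately have "P \<in> partitions n" by (simp add: partitions_def)
  then show ?thesis using stratum_iff p sim XY by blast
qed

text \<open>The number of Jordan blocks of each size is determined by \<open>Y\<close>, and a partition is determined by
  its multiset of parts.\<close>

lemma strata_disjoint:
  fixes p :: "'k :: field mat \<times> 'k mat"
  assumes P: "P \<in> partitions n" and R: "R \<in> partitions n" and p: "p \<in> stratum n P" "p \<in> stratum n R"
  shows "P = R"
proof -
  obtain X Y where XY: "p = (X, Y)" by fastforce
  have jnf: "jordan_nf Y (map (\<lambda>p. (p, 0)) P)" "jordan_nf Y (map (\<lambda>p. (p, 0)) R)"
    using p by (auto simp: stratum_def XY)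
  have *: "count (mset S) k = compute_nr_of_jordan_blocks Y 0 k"
    if "jordan_nf Y (map (\<lambda>p. (p, 0)) S)" "k \<noteq> 0" for S k
  proof -
    have "count (mset S) k = length (filter ((=) (k, 0 :: 'k)) (map (\<lambda>p. (p, 0)) S))"
      by (induction S) auto
    then show ?thesis using compute_nr_of_jordan_blocks[OF that] by simp
  qed
  have "count (mset P) k = count (mset R) k" if "k \<noteq> 0" for k
    unfolding *[OF jnf(1) that] *[OF jnf(2) that] ..
  moreover have "count (mset P) 0 = 0" "count (mset R) 0 = 0"
    using P R by (auto simp: partitions_def count_eq_zero_iff)
  ultimately have "mset P = mset R" by (intro multiset_eqI) (metis (no_types))
  then have "mset (rev P) = mset (rev R)" by simp
  moreover have "sorted (rev P)" "sorted (rev R)"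
    using P R by (auto simp: partitions_def sorted_wrt_rev)
  ultimately have "rev P = rev R" by (metis properties_for_sort)
  then show ?thesis by simp
qed

lemma finite_partitions: "finite (partitions n)"
proof (rule finite_subset)
  have "length P \<le> sum_list P" if "\<forall>p\<in>set P. p \<ge> (1::nat)" for P
    using that by (induction P) auto
  then show "partitions n \<subseteq> {P. set P \<subseteq> {..n} \<and> length P \<le> n}"
    by (auto simp: partitions_def member_le_sum_list)
qed (simp add: finite_lists_length_le)

text \<open>On the superdiagonal matrix \<open>N\<close> the diagonal matrix \<open>H\<close> with entries \<open>0, -1, -2, \<dots>\<close>
  satisfies \<open>[H, N] = N\<close>, so \<open>H N\<close> solves \<open>[X, N] = N\<^sup>2\<close>.\<close>

definition jordan_base :: "'k :: comm_ring_1 mat \<Rightarrow> 'k mat" where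
  "jordan_base N = mat (dim_row N) (dim_col N) (\<lambda>(i, j). - of_nat i * N $$ (i, j))"

lemma nilpotent_jordan_superdiagonal:
  "i < sum_list P \<Longrightarrow> j < sum_list P \<Longrightarrow> j \<noteq> Suc i \<Longrightarrow> (nilpotent_jordan P :: 'k :: field mat) $$ (i, j) = 0"
proof (induction P arbitrary: i j)
  case (Cons p P)
  have "jordan_matrix [(p, 0 :: 'k)] = jordan_block p 0"
    by (simp only: jordan_matrix_def list.map prod.case diag_block_mat_singleton)
  then have "nilpotent_jordan (p # P) = four_block_mat (jordan_block p (0 :: 'k)) (0\<^sub>m p (sum_list P))
      (0\<^sub>m (sum_list P) p) (nilpotent_jordan P)"
    using jordan_matrix_append[of "[(p, 0 :: 'k)]" "map (\<lambda>p. (p, 0)) P"]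
    by (simp add: nilpotent_jordan_def comp_def)
  moreover have "(nilpotent_jordan P :: 'k mat) \<in> carrier_mat (sum_list P) (sum_list P)"
    using jordan_matrix_carrier[of "map (\<lambda>p. (p, 0 :: 'k)) P"] by (simp add: nilpotent_jordan_def comp_def)
  ultimately show ?case using Cons.IH[of "i - p" "j - p"] Cons.prems by (auto simp: jordan_block_def)
qed simp

lemma conjugacy_class_nilpotent_jordan:
  assumes P: "P \<in> partitions n"
  shows "conjugacy_class n (nilpotent_jordan P) (jordan_base (nilpotent_jordan P) :: 'k :: field_char_0 mat)"
proof
  let ?N = "nilpotent_jordan P :: 'k mat" and ?X = "jordan_base (nilpotent_jordan P) :: 'k mat"
  show N: "?N \<in> carrier_mat n n" by (rule nilpotent_jordan_carrier[OF P])
  then show X: "?X \<in> carrier_mat n n" by (auto simp: jordan_base_def)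
  have sd: "?N $$ (i, j) = 0" if "i < n" "j < n" "j \<noteq> Suc i" for i j
    using nilpotent_jordan_superdiagonal[of i P j] P that by (simp add: partitions_def)
  show "?X * ?N - ?N * ?X = ?N * ?N"
  proof (rule eq_matI)
    fix i j assume "i < dim_row (?N * ?N)" "j < dim_col (?N * ?N)"
    then have ij: "i < n" "j < n" using N by auto
    have "(?X * ?N - ?N * ?X) $$ (i, j)
        = (\<Sum>k<n. ?X $$ (i, k) * ?N $$ (k, j)) - (\<Sum>k<n. ?N $$ (i, k) * ?X $$ (k, j))"
      using N X ij by (simp add: scalar_prod_def lessThan_atLeast0)
    also have "\<dots> = (\<Sum>k<n. (of_nat k - of_nat i) * (?N $$ (i, k) * ?N $$ (k, j)))"
      unfolding sum_subtractf[symmetric] using N ij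
      by (intro sum.cong) (auto simp: jordan_base_def algebra_simps)
    also have "\<dots> = (\<Sum>k<n. ?N $$ (i, k) * ?N $$ (k, j))"
    proof (intro sum.cong refl)
      fix k assume "k \<in> {..<n}"
      then show "(of_nat k - of_nat i) * (?N $$ (i, k) * ?N $$ (k, j)) = ?N $$ (i, k) * ?N $$ (k, j)"
        using sd[OF ij(1), of k] by (cases "k = Suc i") auto
    qed
    also have "\<dots> = (?N * ?N) $$ (i, j)"
      using N ij by (simp add: scalar_prod_def lessThan_atLeast0)
    finally show "(?X * ?N - ?N * ?X) $$ (i, j) = (?N * ?N) $$ (i, j)" .
  qed (use N X in auto)
qed


section \<open>The irreducible components\<close>

lemma irreducible_subset_rep_space_iff:
  "irreducible_subset (rep_space n) S \<longleftrightarrow> S \<subseteq> rep_variety n \<and> poly_domain n S"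
proof (cases "S \<subseteq> rep_variety n")
  case True
  then have S: "S \<subseteq> mat_pairs n" "rep_variety n \<inter> S = S" using rep_variety_subset_mat_pairs by auto
  have top: "topspace (rep_space n :: ('a mat \<times> 'a mat) topology) = rep_variety n"
    using rep_variety_subset_mat_pairs by (auto simp: rep_space_def)
  show ?thesis
    using irreducible_space_zariski_iff[OF S(1)] True
    unfolding irreducible_subset_def top unfolding rep_space_def subtopology_subtopology S(2) by blast
next
  case False
  then show ?thesis by (auto simp: irreducible_subset_def rep_space_def)
qed

lemma subtopology_rep_space:
  assumes "Z \<subseteq> rep_variety n"
  shows "subtopology (rep_space n) Z = subtopology (zariski n) Z"
proof -
  have "rep_variety n \<inter> Z = Z" using assms by blast
  then show ?thesis by (simp add: rep_space_def subtopology_subtopology)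
qed

lemma irreducible_subset_subtopology_iff:
  assumes "Z \<subseteq> mat_pairs n"
  shows "irreducible_subset (subtopology (zariski n) Z) S \<longleftrightarrow> S \<subseteq> Z \<and> poly_domain n S"
proof (cases "S \<subseteq> Z")
  case True
  then have S: "S \<subseteq> mat_pairs n" "Z \<inter> S = S" using assms by auto
  have top: "topspace (subtopology (zariski n) Z) = Z" using assms by auto
  show ?thesis
    using irreducible_space_zariski_iff[OF S(1)] True
    unfolding irreducible_subset_def top subtopology_subtopology S(2) by blast
next
  case False
  then show ?thesis by (auto simp: irreducible_subset_def)
qed

lemma closedin_subtopology_closed_iff:
  assumes "zariski_closed n Z"
  shows "closedin (subtopology (zariski n) Z) C \<longleftrightarrow> zariski_closed n C \<and> C \<subseteq> Z"
  using assms closedin_closed_subtopology[of "zariski n" Z C] by (simp add: closedin_zariski)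

lemma closure_of_rep_space:
  assumes S: "S \<subseteq> rep_variety n"
  shows "rep_space n closure_of S = zclosure n S"
proof -
  have "rep_variety n \<inter> S = S" "S \<subseteq> mat_pairs n" using S rep_variety_subset_mat_pairs by auto
  then have "rep_space n closure_of S = rep_variety n \<inter> zclosure n S"
    unfolding rep_space_def closure_of_subtopology by (simp add: closure_of_zariski)
  also have "\<dots> = zclosure n S"
    using zclosure_minimal[OF zariski_closed_rep_variety S] by blast
  finally show ?thesis .
qed

lemma poly_domain_subset_finite_Union:
  assumes dom: "poly_domain n Z" and "finite F" "\<And>C. C \<in> F \<Longrightarrow> zariski_closed n C" "Z \<subseteq> \<Union>F"
  shows "\<exists>C\<in>F. Z \<subseteq> C"
  using assms(2-4)
proof (induction F)
  case empty
  then show ?case using dom by (auto simp: poly_domain_def)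
next
  case (insert C F)
  have Z: "Z \<subseteq> mat_pairs n" using dom by (simp add: poly_domain_def)
  have top: "topspace (subtopology (zariski n) Z) = Z" using Z by auto
  have irr: "irreducible_space (subtopology (zariski n) Z)"
    using irreducible_space_zariski_iff[OF Z] dom by blast
  have "closedin (zariski n) C" using insert.prems by (simp add: closedin_zariski)
  moreover have "closedin (zariski n) (\<Union>F)"
    using insert by (intro closedin_Union) (auto simp: closedin_zariski)
  ultimately have "closedin (subtopology (zariski n) Z) (Z \<inter> C)"
    "closedin (subtopology (zariski n) Z) (Z \<inter> \<Union>F)"
    by (simp_all add: closedin_subtopology_Int_closed)
  moreover have "Z \<inter> C \<union> Z \<inter> \<Union>F = Z" using insert.prems by auto
  ultimately have "Z \<inter> C = Z \<or> Z \<inter> \<Union>F = Z"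
    using irr unfolding irreducible_space_def top by blast
  then show ?case
  proof
    assume "Z \<inter> C = Z"
    then show ?thesis by blast
  next
    assume "Z \<inter> \<Union>F = Z"
    then have "Z \<subseteq> \<Union>F" by blast
    then show ?thesis using insert.IH insert.prems by blast
  qed
qed

text \<open>The closures of the flag images form a chain of length \<open>n\<^sup>2\<close>, and \<open>chain_length_le\<close> excludes
  longer ones.\<close>

lemma (in conjugacy_class) krull_dim_zclosure_orbit:
  "krull_dim (subtopology (rep_space n) (zclosure n orbit)) = enat (n ^ 2)"
proof -
  let ?Z = "zclosure n orbit"
  have sub: "subtopology (rep_space n) ?Z = subtopology (zariski n) ?Z"
    by (rule subtopology_rep_space[OF zclosure_orbit_subset_rep_variety])
  note iff = irreducible_subset_subtopology_iff[OF zclosure_subset_mat_pairs[of n orbit]]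
    closedin_subtopology_closed_iff[OF zariski_closed_zclosure[of n orbit]]
  let ?S = "{enat l | l. \<exists>Z :: nat \<Rightarrow> ('k mat \<times> 'k mat) set.
     (\<forall>i\<le>l. closedin (subtopology (zariski n) ?Z) (Z i) \<and>
       irreducible_subset (subtopology (zariski n) ?Z) (Z i)) \<and> (\<forall>i<l. Z i \<subset> Z (Suc i))}"
  have "Sup ?S = enat (n ^ 2)"
  proof (rule antisym)
    show "Sup ?S \<le> enat (n ^ 2)"
    proof (rule Sup_least)
      fix x assume "x \<in> ?S"
      then obtain l Z where l: "x = enat l" and Z: "\<forall>i\<le>l. closedin (subtopology (zariski n) ?Z) (Z i) \<and>
       irreducible_subset (subtopology (zariski n) ?Z) (Z i)" "\<forall>i<l. Z i \<subset> Z (Suc i)" by blast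
      have "l \<le> n * n"
        by (rule chain_length_le[of l Z]) (use Z in \<open>simp_all add: iff\<close>)
      then show "x \<le> enat (n ^ 2)" by (simp add: l power2_eq_square)
    qed
    have "zclosure n (flag_image i) \<subseteq> ?Z" for i
      by (rule zclosure_mono[OF flag_image_subset_orbit])
    then have "enat (n ^ 2) \<in> ?S"
      using flag_image_strict poly_domain_zclosure[OF poly_domain_flag_image]
      by (intro CollectI exI[of _ "n ^ 2"] conjI refl exI[of _ "\<lambda>i. zclosure n (flag_image i)"])
        (simp_all add: iff power2_eq_square zariski_closed_zclosure)
    then show "enat (n ^ 2) \<le> Sup ?S" by (rule Sup_upper)
  qed
  then show ?thesis unfolding krull_dim_def sub .
qed

lemma stratum_eq_orbit:
  fixes P :: "nat list"
  assumes "P \<in> partitions n"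
  shows "stratum n P = conjugacy_class.orbit n (nilpotent_jordan P :: 'k :: field_char_0 mat)"
  unfolding stratum_iff[OF assms]
    conjugacy_class.orbit_def[OF conjugacy_class_nilpotent_jordan[OF assms]] ..

text \<open>If the closures were different, a chain of
  length \<open>n\<^sup>2\<close> in the smaller one could be prolonged; if they are equal, both strata contain
  nonempty open subsets of the same irreducible set and therefore meet.\<close>

lemma zclosure_stratum_incomparable:
  fixes P R :: "nat list"
  assumes P: "P \<in> partitions n" and R: "R \<in> partitions n"
    and sub: "zclosure n (stratum n P :: ('k :: field_char_0 mat \<times> 'k mat) set) \<subseteq> zclosure n (stratum n R)"
  shows "P = R"
proof -
  interpret A: conjugacy_class n "nilpotent_jordan P" "jordan_base (nilpotent_jordan P) :: 'k mat"
    by (rule conjugacy_class_nilpotent_jordan[OF P])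
  interpret B: conjugacy_class n "nilpotent_jordan R" "jordan_base (nilpotent_jordan R) :: 'k mat"
    by (rule conjugacy_class_nilpotent_jordan[OF R])
  note sub = sub[unfolded stratum_eq_orbit[OF P] stratum_eq_orbit[OF R]]
  have eq: "zclosure n A.orbit = zclosure n B.orbit"
  proof (rule ccontr)
    assume ne: "zclosure n A.orbit \<noteq> zclosure n B.orbit"
    define Z where "Z i = (if i \<le> n * n then zclosure n (A.flag_image i) else zclosure n B.orbit)" for i
    have "Suc (n * n) \<le> n * n"
    proof (rule B.chain_length_le)
      show "poly_domain n (Z i)" for i
        unfolding Z_def
        by (simp add: poly_domain_zclosure A.poly_domain_flag_image B.poly_domain_orbit)
      show "zariski_closed n (Z i)" for i
        unfolding Z_def by (simp add: zariski_closed_zclosure)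
      show "Z i \<subset> Z (Suc i)" if "i < Suc (n * n)" for i
      proof (cases "i < n * n")
        case True
        then show ?thesis using A.flag_image_strict[of i] by (simp add: Z_def)
      next
        case False
        then have "i = n * n" using that by simp
        moreover have "zclosure n (A.flag_image (n * n)) \<subseteq> zclosure n A.orbit"
          by (rule zclosure_mono[OF A.flag_image_subset_orbit])
        ultimately show ?thesis using sub ne by (auto simp: Z_def)
      qed
      show "Z (Suc (n * n)) \<subseteq> zclosure n B.orbit" by (simp add: Z_def)
    qed
    then show False by simp
  qed
  have "A.orbit \<subseteq> zclosure n A.orbit" "B.orbit \<subseteq> zclosure n A.orbit"
    using zclosure_superset[OF A.orbit_subset_mat_pairs] zclosure_superset[OF B.orbit_subset_mat_pairs] eq
    by auto
  then have "\<not> (\<forall>p\<in>zclosure n A.orbit. A.good p = 0)" "\<not> (\<forall>p\<in>zclosure n A.orbit. B.good p = 0)"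
    using A.base_point_in_orbit A.base_point_good B.base_point_in_orbit B.base_point_good by blast+
  then obtain p where p: "p \<in> zclosure n A.orbit" "A.good p * B.good p \<noteq> 0"
    using poly_domainD[OF poly_domain_zclosure[OF A.poly_domain_orbit] A.good_poly B.good_poly] by blast
  have "p \<in> A.orbit" by (rule A.zclosure_orbit_good) (use p in auto)
  then have pP: "p \<in> stratum n P" by (simp only: stratum_eq_orbit[OF P])
  have "p \<in> B.orbit" by (rule B.zclosure_orbit_good) (use p eq in auto)
  then have pR: "p \<in> stratum n R" by (simp only: stratum_eq_orbit[OF R])
  show ?thesis by (rule strata_disjoint[OF P R pP pR])
qed

lemma irreducible_components_rep_space:
  "irreducible_components (rep_space n :: ('k :: {alg_closed_field, field_char_0} mat \<times> 'k mat) topology)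
     = (\<lambda>P. zclosure n (stratum n P)) ` partitions n"
proof -
  let ?V = "rep_space n :: ('k mat \<times> 'k mat) topology"
  let ?K = "\<lambda>P. zclosure n (stratum n P) :: ('k mat \<times> 'k mat) set"
  have dom: "irreducible_subset ?V (?K P)" if P: "P \<in> partitions n" for P
  proof -
    interpret conjugacy_class n "nilpotent_jordan P" "jordan_base (nilpotent_jordan P) :: 'k mat"
      by (rule conjugacy_class_nilpotent_jordan[OF P])
    show ?thesis
      unfolding irreducible_subset_rep_space_iff stratum_eq_orbit[OF P]
      using zclosure_orbit_subset_rep_variety poly_domain_zclosure[OF poly_domain_orbit] by blast
  qed
  have covered: "\<exists>P\<in>partitions n. W \<subseteq> ?K P" if W: "irreducible_subset ?V W" for W
  proof -
    have W': "W \<subseteq> rep_variety n" "poly_domain n W"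
      using W unfolding irreducible_subset_rep_space_iff by auto
    have "W \<subseteq> \<Union>(?K ` partitions n)"
    proof
      fix p assume "p \<in> W"
      then obtain P where P: "P \<in> partitions n" "p \<in> stratum n P"
        using rep_variety_covered[OF subsetD[OF W'(1) \<open>p \<in> W\<close>]] by blast
      have "stratum n P \<subseteq> ?K P"
        using rep_variety_subset_mat_pairs by (intro zclosure_superset) (auto simp: stratum_def)
      then show "p \<in> \<Union>(?K ` partitions n)" using P by blast
    qed
    then have "\<exists>C\<in>?K ` partitions n. W \<subseteq> C"
      by (intro poly_domain_subset_finite_Union[OF W'(2)])
         (auto simp: finite_partitions zariski_closed_zclosure)
    then show ?thesis by blast
  qed
  show ?thesis
  proof
    show "irreducible_components ?V \<subseteq> ?K ` partitions n"
    proof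
      fix Z assume "Z \<in> irreducible_components ?V"
      then have Z: "irreducible_subset ?V Z" "\<And>W. irreducible_subset ?V W \<Longrightarrow> Z \<subseteq> W \<Longrightarrow> W = Z"
        by (auto simp: irreducible_components_def)
      obtain P where P: "P \<in> partitions n" "Z \<subseteq> ?K P" using covered[OF Z(1)] by blast
      then show "Z \<in> ?K ` partitions n" using Z(2)[OF dom[OF P(1)] P(2)] by blast
    qed
    show "?K ` partitions n \<subseteq> irreducible_components ?V"
    proof
      fix Z assume "Z \<in> ?K ` partitions n"
      then obtain P where P: "P \<in> partitions n" "Z = ?K P" by blast
      have "W = Z" if W: "irreducible_subset ?V W" "Z \<subseteq> W" for W
      proof -
        obtain R where R: "R \<in> partitions n" "W \<subseteq> ?K R" using covered[OF W(1)] by blast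
        have "P = R" by (rule zclosure_stratum_incomparable[OF P(1) R(1)]) (use W(2) R(2) P(2) in blast)
        then show ?thesis using W(2) R(2) P(2) by blast
      qed
      then show "Z \<in> irreducible_components ?V"
        using dom[OF P(1)] P(2) unfolding irreducible_components_def by blast
    qed
  qed
qed

theorem mainTheorem1:
  fixes n :: nat
  defines "V \<equiv> (rep_space n :: ('k :: {alg_closed_field, field_char_0} mat \<times> 'k mat) topology)"
  assumes "n \<ge> 1"
  shows "(\<forall>Z \<in> irreducible_components V.
            \<exists>P \<in> partitions n. stratum n P \<subseteq> Z
              \<and> (\<forall>Q \<in> partitions n. stratum n Q \<subseteq> Z \<longrightarrow> Q = P)
              \<and> Z = V closure_of (stratum n P))
         \<and> (finite (irreducible_components V)
              \<and> card (irreducible_components V) = card (partitions n))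
         \<and> (equidimensional V
              \<and> (\<forall>Z \<in> irreducible_components V. krull_dim (subtopology V Z) = enat (n ^ 2)))"
proof -
  let ?K = "\<lambda>P. zclosure n (stratum n P) :: ('k mat \<times> 'k mat) set"
  have comps: "irreducible_components V = ?K ` partitions n"
    unfolding V_def by (rule irreducible_components_rep_space)
  have rep: "stratum n P \<subseteq> (rep_variety n :: ('k mat \<times> 'k mat) set)" for P
    by (auto simp: stratum_def)
  have sup: "stratum n P \<subseteq> ?K P" for P
    using rep rep_variety_subset_mat_pairs by (intro zclosure_superset) blast
  have only: "Q = P" if P: "P \<in> partitions n" and Q: "Q \<in> partitions n" and sub: "stratum n Q \<subseteq> ?K P" for P Q
    by (rule zclosure_stratum_incomparable[OF Q P zclosure_minimal[OF zariski_closed_zclosure sub]])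
  have 1: "\<exists>P \<in> partitions n. stratum n P \<subseteq> Z
              \<and> (\<forall>Q \<in> partitions n. stratum n Q \<subseteq> Z \<longrightarrow> Q = P)
              \<and> Z = V closure_of (stratum n P)" if Z: "Z \<in> irreducible_components V" for Z
  proof -
    obtain P where P: "P \<in> partitions n" "Z = ?K P" using Z comps by blast
    have "Z = V closure_of (stratum n P)"
      unfolding V_def P(2) by (rule closure_of_rep_space[OF rep, symmetric])
    then show ?thesis using P(1) sup[of P] only[OF P(1)] unfolding P(2) by blast
  qed
  have inj: "inj_on ?K (partitions n)"
  proof (rule inj_onI)
    fix P Q assume "P \<in> partitions n" "Q \<in> partitions n" "?K P = ?K Q"
    then show "P = Q" using zclosure_stratum_incomparable[of P n Q, where 'k = 'k] by simp
  qed
  have dim: "krull_dim (subtopology V Z) = enat (n ^ 2)" if Z: "Z \<in> irreducible_components V" for Z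
  proof -
    obtain P where P: "P \<in> partitions n" "Z = ?K P" using Z comps by blast
    show ?thesis
      unfolding V_def P(2) stratum_eq_orbit[OF P(1)]
      by (rule conjugacy_class.krull_dim_zclosure_orbit[OF conjugacy_class_nilpotent_jordan[OF P(1)]])
  qed
  show ?thesis
    using 1 dim card_image[OF inj] finite_partitions[of n]
    unfolding equidimensional_def comps by simp
qed

end
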